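(* There is no finite-dimensional complex Lie algebra whose Jordan–Kronecker invariants contain exactly one Kronecker block, this block being of size $1\times1$, and more than one Jordan tuple with multiple maxima.
   Context: For a finite-dimensional complex Lie algebra $\mathfrak g$ and $x\in\mathfrak g^*$, let $\mathcal A_x$ be the skew form $(\xi,\eta)\mapsto\langle x,[\xi,\eta]\rangle$. By the Jordan–Kronecker theorem, a pair of skew forms on a finite-dimensional complex vector space admits a basis in which both are block-diagonal with Jordan $2n\times2n$ blocks with eigenvalues $\mu\in\mathbb C\cup\{\infty\}$ and Kronecker $(2k-1)\times(2k-1)$ blocks ($k\ge1$); block data grouped by eigenvalue are unique. The JK invariants of $\mathfrak g$ are the Kronecker sizes and Jordan tuples $J_{\lambda_i}(2n_{i1},\dots,2n_{is_i})$, $n_{i1}\ge\dots\ge n_{is_i}$ (sizes of Jordan blocks with common eigenvalue $\lambda_i$) of $(\mathcal A_x,\mathcal A_a)$ for $(x,a)$ in a nonempty Zariski open subset of $\mathfrak g^*\times\mathfrak g^*$ where they are constant. A Jordan tuple has multiple maxima if $s_i\ge2$ and $n_{i1}=n_{i2}$. *)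

theory Defs
  imports Complex_Main "HOL-Library.Multiset"
begin

text \<open>Matrices are represented as functions nat => nat => complex, only the entries
  with indices below the relevant size being meaningful.\<close>

type_synonym cmat = "nat \<Rightarrow> nat \<Rightarrow> complex"

text \<open>A Lie algebra of dimension n with basis e_0,...,e_{n-1} and
  [e_i,e_j] = sum_k c i j k e_k.\<close>

definition is_lie_algebra :: "nat \<Rightarrow> (nat \<Rightarrow> nat \<Rightarrow> nat \<Rightarrow> complex) \<Rightarrow> bool" where
  "is_lie_algebra n c \<longleftrightarrow>
     (\<forall>i<n. \<forall>k<n. c i i k = 0) \<and>
     (\<forall>i<n. \<forall>j<n. \<forall>k<n. c i j k = - c j i k) \<and>
     (\<forall>i<n. \<forall>j<n. \<forall>k<n. \<forall>m<n.
        (\<Sum>l<n. c i j l * c l k m + c j k l * c l i m + c k i l * c l j m) = 0)"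

text \<open>Gram matrix of the skew form A_x(xi,eta) = <x,[xi,eta]> for x in g^*
  (x given by its coordinates in the dual basis).\<close>

definition lie_form :: "nat \<Rightarrow> (nat \<Rightarrow> nat \<Rightarrow> nat \<Rightarrow> complex) \<Rightarrow> (nat \<Rightarrow> complex) \<Rightarrow> cmat" where
  "lie_form n c x = (\<lambda>i j. \<Sum>k<n. x k * c i j k)"

definition skew_block :: "nat \<Rightarrow> cmat \<Rightarrow> cmat" where
  "skew_block p X = (\<lambda>i j. if i < p \<and> p \<le> j then X i (j - p)
                           else if p \<le> i \<and> j < p then - X j (i - p) else 0)"

definition jordan_mat :: "complex \<Rightarrow> cmat" where
  "jordan_mat ev = (\<lambda>i j. if i = j then ev else if j = Suc i then 1 else 0)"

definition id_mat :: cmat where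
  "id_mat = (\<lambda>i j. if i = j then 1 else 0)"

text \<open>Block data: Jor e m is a Jordan block of size 2m with eigenvalue e
  (None meaning infinity); Kron k is a Kronecker block of size 2k-1.\<close>

datatype jk_block = Jor "complex option" nat | Kron nat

fun block_size :: "jk_block \<Rightarrow> nat" where
  "block_size (Jor e m) = 2 * m"
| "block_size (Kron k) = 2 * k - 1"

fun block_valid :: "jk_block \<Rightarrow> bool" where
  "block_valid (Jor e m) = (m \<ge> 1)"
| "block_valid (Kron k) = (k \<ge> 1)"

text \<open>The pair of forms (first form, second form) of a canonical block. For a
  finite eigenvalue lambda the pencil first - mu * second degenerates exactly at
  mu = lambda; for eigenvalue infinity the second form is degenerate.\<close>

fun block_pair :: "jk_block \<Rightarrow> cmat \<times> cmat" where
  "block_pair (Jor (Some ev) m) = (skew_block m (jordan_mat ev), skew_block m id_mat)"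
| "block_pair (Jor None m) = (skew_block m id_mat, skew_block m (jordan_mat 0))"
| "block_pair (Kron k) =
     (skew_block (k - 1) (\<lambda>i j. if j = i then 1 else 0),
      skew_block (k - 1) (\<lambda>i j. if j = Suc i then 1 else 0))"

fun dsum :: "(nat \<times> cmat) list \<Rightarrow> cmat" where
  "dsum [] = (\<lambda>i j. 0)"
| "dsum ((s, M) # bs) = (\<lambda>i j. if i < s \<and> j < s then M i j
                           else if s \<le> i \<and> s \<le> j then dsum bs (i - s) (j - s) else 0)"

definition canon_pair :: "jk_block list \<Rightarrow> cmat \<times> cmat" where
  "canon_pair bs =
     (dsum (map (\<lambda>b. (block_size b, fst (block_pair b))) bs),
      dsum (map (\<lambda>b. (block_size b, snd (block_pair b))) bs))"

definition congruent_pair :: "nat \<Rightarrow> cmat \<Rightarrow> cmat \<Rightarrow> cmat \<Rightarrow> cmat \<Rightarrow> bool" where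
  "congruent_pair n A B A' B' \<longleftrightarrow>
     (\<exists>P Q. (\<forall>i<n. \<forall>j<n. (\<Sum>k<n. P i k * Q k j) = (if i = j then 1 else 0)) \<and>
            (\<forall>i<n. \<forall>j<n. (\<Sum>k<n. Q i k * P k j) = (if i = j then 1 else 0)) \<and>
            (\<forall>i<n. \<forall>j<n. (\<Sum>k<n. \<Sum>l<n. P k i * A k l * P l j) = A' i j) \<and>
            (\<forall>i<n. \<forall>j<n. (\<Sum>k<n. \<Sum>l<n. P k i * B k l * P l j) = B' i j))"

definition kron_sizes :: "jk_block list \<Rightarrow> nat multiset" where
  "kron_sizes bs = mset (concat (map (\<lambda>b. case b of Kron k \<Rightarrow> [k] | Jor e m \<Rightarrow> []) bs))"

definition jordan_eigs :: "jk_block list \<Rightarrow> complex option list" where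
  "jordan_eigs bs = remdups (concat (map (\<lambda>b. case b of Jor e m \<Rightarrow> [e] | Kron k \<Rightarrow> []) bs))"

definition jordan_tuple :: "jk_block list \<Rightarrow> complex option \<Rightarrow> nat multiset" where
  "jordan_tuple bs e =
     mset (concat (map (\<lambda>b. case b of Jor e' m \<Rightarrow> (if e' = e then [m] else []) | Kron k \<Rightarrow> []) bs))"

definition jordan_tuples :: "jk_block list \<Rightarrow> nat multiset multiset" where
  "jordan_tuples bs = mset (map (jordan_tuple bs) (jordan_eigs bs))"

definition has_jk_type :: "nat \<Rightarrow> cmat \<Rightarrow> cmat \<Rightarrow> nat multiset \<Rightarrow> nat multiset multiset \<Rightarrow> bool" where
  "has_jk_type n A B K T \<longleftrightarrow>
     (\<exists>bs. (\<forall>b\<in>set bs. block_valid b) \<and> sum_list (map block_size bs) = n \<and>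
           congruent_pair n A B (fst (canon_pair bs)) (snd (canon_pair bs)) \<and>
           kron_sizes bs = K \<and> jordan_tuples bs = T)"

inductive_set polyfuns :: "nat \<Rightarrow> ((nat \<Rightarrow> complex) \<times> (nat \<Rightarrow> complex) \<Rightarrow> complex) set"
  for n :: nat where
  const: "(\<lambda>z. a) \<in> polyfuns n"
| coord1: "i < n \<Longrightarrow> (\<lambda>z. fst z i) \<in> polyfuns n"
| coord2: "i < n \<Longrightarrow> (\<lambda>z. snd z i) \<in> polyfuns n"
| add: "p \<in> polyfuns n \<Longrightarrow> q \<in> polyfuns n \<Longrightarrow> (\<lambda>z. p z + q z) \<in> polyfuns n"
| mult: "p \<in> polyfuns n \<Longrightarrow> q \<in> polyfuns n \<Longrightarrow> (\<lambda>z. p z * q z) \<in> polyfuns n"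

definition zariski_open :: "nat \<Rightarrow> ((nat \<Rightarrow> complex) \<times> (nat \<Rightarrow> complex)) set \<Rightarrow> bool" where
  "zariski_open n U \<longleftrightarrow> (\<exists>S \<subseteq> polyfuns n. U = - {z. \<forall>p\<in>S. p z = 0})"

definition lie_jk_invariants ::
  "nat \<Rightarrow> (nat \<Rightarrow> nat \<Rightarrow> nat \<Rightarrow> complex) \<Rightarrow> nat multiset \<Rightarrow> nat multiset multiset \<Rightarrow> bool" where
  "lie_jk_invariants n c K T \<longleftrightarrow>
     (\<exists>U. zariski_open n U \<and> U \<noteq> {} \<and>
          (\<forall>(x, a)\<in>U. has_jk_type n (lie_form n c x) (lie_form n c a) K T))"

definition multiple_maxima :: "nat multiset \<Rightarrow> bool" where
  "multiple_maxima t \<longleftrightarrow> size t \<ge> 2 \<and> count t (Max (set_mset t)) \<ge> 2"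

end

theory Submission
  imports Defs "Jordan_Normal_Form.Determinant"
    "HOL-Computational_Algebra.Fundamental_Theorem_Algebra"
begin

text \<open>With a single trivial Kronecker block, generic forms \<open>A\<^sub>x\<close> share a one-dimensional kernel, spanned by a
  central vector \<open>z\<close>. On an affine slice \<open>\<langle>x, z\<rangle> = const\<close> the Lie-Poisson bivector is generically
  invertible, and by the Jacobi identity its inverse \<open>\<Omega>\<close> is a closed 2-form with poles along the hypersurfaces
  of degenerate \<open>x\<close>. Along the component through \<open>p = x - \<lambda> a\<close> the pole order is the size \<open>m\<close> of the largest
  Jordan block at \<open>\<lambda>\<close>, and the leading coefficient \<open>\<omega>\<close> has rank twice the number of maximal blocks. The lowest order
  part of \<open>d\<Omega> = 0\<close> is \<open>\<tau> \<and> \<omega> = 0\<close>, where \<open>\<tau>\<close> is a multiple of the differential of the equation of the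
  component. If \<open>\<omega>\<close> has rank at least 4 this forces \<open>\<tau> = 0\<close> on the slice, which is impossible when
  \<open>\<langle>p, z\<rangle> \<noteq> 0\<close>. Since \<open>\<langle>x - \<lambda> a, z\<rangle> = 0\<close> determines \<open>\<lambda>\<close>, at most one eigenvalue can have multiple maxima.

  That the pole moves differentiably with \<open>x\<close> uses that the type is constant on an open set.\<close>

section \<open>Coefficientwise convergence of polynomials\<close>

text \<open>No calculus in several variables is used. \<open>x\<close> moves to
  \<open>x + \<epsilon> v\<close> along a sequence \<epsilon> \<rightarrow> 0, the forms are
  polynomial matrices in the pencil parameter \<open>X\<close>, and leading behaviour at a pole
  becomes a congruence modulo a power of \<open>X - \<lambda>\<close>. The obstacle is that a
  multiple eigenvalue of a perturbed pencil may split and that its pole order may jump; then it has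
  no velocity. A constant type fixes the number of eigenvalues and the sum of their maximal block
  sizes. Since each multiplicity and each pole order is semicontinuous, none of them can change, and
  the difference quotient of the eigenvalue converges. Why \<tau> cannot vanish on the slice: moving
  \<open>x\<close> along \<open>a\<close> merely translates the pencil, so it shifts every
  eigenvalue at unit speed. The direction \<open>a\<close> need not be tangent to the slice, but
  \<open>p = x - \<lambda> a\<close> is the radial direction of the cone of degenerate covectors, so
  \<open>a\<close> may be corrected by a multiple of \<open>p\<close>. The condition \<langle>p,
  z\<rangle> \<noteq> 0 is what makes a correction into the slice possible.\<close>

definition pconv :: "(nat \<Rightarrow> complex poly) \<Rightarrow> complex poly \<Rightarrow> bool" where
  "pconv f g \<longleftrightarrow> (\<exists>d. \<forall>k. degree (f k) \<le> d) \<and> (\<forall>j. (\<lambda>k. coeff (f k) j) \<longlonglongrightarrow> coeff g j)"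

lemma pconvI:
  "(\<And>k. degree (f k) \<le> d) \<Longrightarrow> (\<And>j. (\<lambda>k. coeff (f k) j) \<longlonglongrightarrow> coeff g j) \<Longrightarrow> pconv f g"
  unfolding pconv_def by blast

lemma pconv_coeff: "pconv f g \<Longrightarrow> (\<lambda>k. coeff (f k) j) \<longlonglongrightarrow> coeff g j"
  unfolding pconv_def by blast

lemma pconv_const: "pconv (\<lambda>_. p) p"
  by (rule pconvI[of _ "degree p"]) auto

lemma pconv_add: assumes "pconv f p" "pconv g q" shows "pconv (\<lambda>k. f k + g k) (p + q)"
proof -
  obtain a b where "\<And>k. degree (f k) \<le> a" "\<And>k. degree (g k) \<le> b"
    using assms unfolding pconv_def by blast
  then have "degree (f k + g k) \<le> max a b" for k
    by (meson degree_add_le le_max_iff_disj)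
  then show ?thesis
    by (rule pconvI) (auto intro!: tendsto_add pconv_coeff assms)
qed

lemma pconv_mult: assumes "pconv f p" "pconv g q" shows "pconv (\<lambda>k. f k * g k) (p * q)"
proof -
  obtain a b where "\<And>k. degree (f k) \<le> a" "\<And>k. degree (g k) \<le> b"
    using assms unfolding pconv_def by blast
  then have "degree (f k * g k) \<le> a + b" for k
    by (meson add_mono degree_mult_le order_trans)
  then show ?thesis
    by (rule pconvI) (auto simp: coeff_mult intro!: tendsto_sum tendsto_mult pconv_coeff assms)
qed

lemma pconv_const_poly: "c \<longlonglongrightarrow> a \<Longrightarrow> pconv (\<lambda>k. [:c k:]) [:a:]"
  by (rule pconvI[of _ 0]) (auto simp: coeff_pCons split: nat.splits)

lemma pconv_smult: "c \<longlonglongrightarrow> a \<Longrightarrow> pconv f p \<Longrightarrow> pconv (\<lambda>k. smult (c k) (f k)) (smult a p)"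
  using pconv_mult[OF pconv_const_poly, of c a f p] by simp

lemma pconv_uminus: "pconv f p \<Longrightarrow> pconv (\<lambda>k. - f k) (- p)"
  using pconv_smult[OF tendsto_const, of f p "-1"] by simp

lemma pconv_diff: "pconv f p \<Longrightarrow> pconv g q \<Longrightarrow> pconv (\<lambda>k. f k - g k) (p - q)"
  using pconv_add[OF _ pconv_uminus, of f p g q] by simp

lemma pconv_sum: "(\<And>i. i \<in> I \<Longrightarrow> pconv (f i) (p i)) \<Longrightarrow> pconv (\<lambda>k. \<Sum>i\<in>I. f i k) (\<Sum>i\<in>I. p i)"
  by (induction I rule: infinite_finite_induct) (auto intro: pconv_const pconv_add)

lemma pconv_prod: "(\<And>i. i \<in> I \<Longrightarrow> pconv (f i) (p i)) \<Longrightarrow> pconv (\<lambda>k. \<Prod>i\<in>I. f i k) (\<Prod>i\<in>I. p i)"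
  by (induction I rule: infinite_finite_induct) (auto intro: pconv_const pconv_mult)

lemma pconv_power: "pconv f p \<Longrightarrow> pconv (\<lambda>k. f k ^ n) (p ^ n)"
  by (induction n) (auto intro: pconv_const pconv_mult)

lemma pconv_linear: "e \<longlonglongrightarrow> \<mu> \<Longrightarrow> pconv (\<lambda>k. [:e k, c:]) [:\<mu>, c:]"
  using pconv_add[OF pconv_const_poly pconv_const[of "[:0, c:]"], of e \<mu>] by simp

lemma pconv_pderiv: assumes "pconv f p" shows "pconv (\<lambda>k. pderiv (f k)) (pderiv p)"
proof -
  obtain a where "\<And>k. degree (f k) \<le> a"
    using assms unfolding pconv_def by blast
  then have "degree (pderiv (f k)) \<le> a" for k
    by (metis degree_pderiv diff_le_self order_trans)
  then show ?thesis
    by (rule pconvI) (auto simp: coeff_pderiv intro!: tendsto_mult pconv_coeff assms)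
qed

lemma pconv_subseq: "pconv f p \<Longrightarrow> strict_mono r \<Longrightarrow> pconv (\<lambda>k. f (r k)) p"
  unfolding pconv_def using LIMSEQ_subseq_LIMSEQ[unfolded comp_def] by blast

lemma pconv_unique: "pconv f p \<Longrightarrow> pconv f q \<Longrightarrow> p = q"
  by (rule poly_eqI) (blast intro: LIMSEQ_unique dest: pconv_coeff)

text \<open>The uniform degree bound in \<open>pconv\<close> makes evaluation a sum of fixed length.
  Coefficientwise limits alone would not do: the powers \<open>X ^ k\<close> tend to 0
  coefficientwise but have value 1 at 1.\<close>

lemma pconv_poly: assumes "pconv f p" "e \<longlonglongrightarrow> \<mu>" shows "(\<lambda>k. poly (f k) (e k)) \<longlonglongrightarrow> poly p \<mu>"
proof -
  obtain a where a: "\<And>k. degree (f k) \<le> a"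
    using assms unfolding pconv_def by blast
  have *: "poly q x = (\<Sum>i\<le>b. coeff q i * x ^ i)" if "degree q \<le> b" for b and q :: "complex poly" and x
    unfolding poly_altdef using that
    by (intro sum.mono_neutral_left) (auto simp: coeff_eq_0)
  define b where "b = max a (degree p)"
  have "(\<lambda>k. \<Sum>i\<le>b. coeff (f k) i * e k ^ i) \<longlonglongrightarrow> (\<Sum>i\<le>b. coeff p i * \<mu> ^ i)"
    by (intro tendsto_sum tendsto_mult tendsto_power assms pconv_coeff)
  moreover have "poly (f k) (e k) = (\<Sum>i\<le>b. coeff (f k) i * e k ^ i)" for k
    using a by (intro *) (auto simp: b_def le_max_iff_disj)
  moreover have "poly p \<mu> = (\<Sum>i\<le>b. coeff p i * \<mu> ^ i)"
    by (intro *) (auto simp: b_def)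
  ultimately show ?thesis by simp
qed

text \<open>Synthetic division: each coefficient of the quotient is a coefficient of the dividend
  plus \<open>e k\<close> times the next higher coefficient of the quotient, so limits propagate
  downwards from the degree bound.\<close>

lemma pconv_div_linear:
  assumes f: "pconv f p" and e: "e \<longlonglongrightarrow> \<mu>" and fh: "\<And>k. f k = [:- e k, 1:] * h k"
  shows "\<exists>q. pconv h q \<and> p = [:- \<mu>, 1:] * q"
proof -
  obtain a where a: "\<And>k. degree (f k) \<le> a"
    using f unfolding pconv_def by blast
  have dh: "degree (h k) \<le> a" for k
  proof (cases "h k = 0")
    case False
    then have "degree (f k) = 1 + degree (h k)"
      unfolding fh by (subst degree_mult_eq) auto
    then show ?thesis using a[of k] by simp
  qed simp
  have rec: "coeff (h k) j = coeff (f k) (Suc j) + e k * coeff (h k) (Suc j)" for k j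
    unfolding fh by simp
  \<comment> \<open>Downward induction on the coefficient index, started at \<open>Suc a\<close>,
    where all coefficients vanish. Once \<open>j\<close> exceeds \<open>a\<close>, truncated
    subtraction keeps the index at 0.\<close>
  have ex: "\<exists>l. (\<lambda>k. coeff (h k) (Suc a - j)) \<longlonglongrightarrow> l" for j
  proof (induction j)
    case 0
    have "coeff (h k) (Suc a) = 0" for k
      using dh[of k] by (intro coeff_eq_0) simp
    then show ?case by auto
  next
    case (Suc j)
    show ?case
    proof (cases "j \<le> a")
      case True
      then have [simp]: "Suc (a - j) = Suc a - j" by simp
      obtain l where l: "(\<lambda>k. coeff (h k) (Suc a - j)) \<longlonglongrightarrow> l" using Suc by blast
      have "(\<lambda>k. coeff (h k) (a - j)) \<longlonglongrightarrow> coeff p (Suc (a - j)) + \<mu> * l"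
        unfolding rec[of _ "a - j"] using l
        by (intro tendsto_add tendsto_mult e pconv_coeff[OF f]) simp
      then show ?thesis by auto
    next
      case False
      then show ?thesis using Suc by simp
    qed
  qed
  have "\<exists>l. (\<lambda>k. coeff (h k) j) \<longlonglongrightarrow> l" for j
  proof (cases "j \<le> Suc a")
    case True
    then show ?thesis using ex[of "Suc a - j"] by simp
  next
    case False
    then have "coeff (h k) j = 0" for k using dh[of k] by (intro coeff_eq_0) simp
    then show ?thesis by auto
  qed
  then obtain l where l: "\<And>j. (\<lambda>k. coeff (h k) j) \<longlonglongrightarrow> l j" by metis
  have l0: "l j = 0" if "j > a" for j
  proof -
    have "coeff (h k) j = 0" for k using dh[of k] that by (intro coeff_eq_0) simp
    then show ?thesis using l[of j] by (simp add: LIMSEQ_const_iff)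
  qed
  define q where "q = Abs_poly l"
  have cq: "coeff q = l"
    unfolding q_def by (rule coeff_Abs_poly[of a]) (use l0 in auto)
  have hq: "pconv h q"
    by (rule pconvI[OF dh]) (simp add: cq l)
  have "pconv f ([:- \<mu>, 1:] * q)"
    unfolding fh by (intro pconv_mult hq pconv_linear tendsto_minus e)
  then show ?thesis using hq f pconv_unique by blast
qed

lemma pconv_div_power:
  assumes "pconv f p" "e \<longlonglongrightarrow> \<mu>" "\<And>k. f k = [:- e k, 1:] ^ r * h k"
  shows "\<exists>q. pconv h q \<and> p = [:- \<mu>, 1:] ^ r * q"
  using assms(1,3)
proof (induction r arbitrary: f p)
  case (Suc r)
  obtain q where q: "pconv (\<lambda>k. [:- e k, 1:] ^ r * h k) q" "p = [:- \<mu>, 1:] * q"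
    using pconv_div_linear[OF Suc.prems(1) assms(2), of "\<lambda>k. [:- e k, 1:] ^ r * h k"] Suc.prems(2)
    unfolding power_Suc mult.assoc by blast
  show ?case using Suc.IH[OF q(1)] q(2) unfolding power_Suc mult.assoc by blast
next
  case 0
  then have "f = h" by (simp add: fun_eq_iff)
  with 0 show ?case by auto
qed

text \<open>Exact divisibility survives limits, and a subsequence is enough. This is the
  semicontinuity used later: neither the multiplicity of a root of the determinant nor the order to
  which the adjugate vanishes there drops in the limit.\<close>

lemma pconv_dvd_frequently:
  assumes "pconv f p" "e \<longlonglongrightarrow> \<mu>" "\<exists>\<^sub>F k in sequentially. [:- e k, 1:] ^ r dvd f k"
  shows "[:- \<mu>, 1:] ^ r dvd p"
proof -
  have "infinite {k. [:- e k, 1:] ^ r dvd f k}"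
    using assms(3)[folded cofinite_eq_sequentially] by (simp only: frequently_cofinite not_False_eq_True)
  then obtain s :: "nat \<Rightarrow> nat" where s: "strict_mono s" "\<And>k. [:- e (s k), 1:] ^ r dvd f (s k)"
    using infinite_enumerate[of "{k. [:- e k, 1:] ^ r dvd f k}"] by auto
  then obtain h where "\<And>k. f (s k) = [:- e (s k), 1:] ^ r * h k"
    unfolding dvd_def by metis
  moreover have "pconv (\<lambda>k. f (s k)) p" "(\<lambda>k. e (s k)) \<longlonglongrightarrow> \<mu>"
    using pconv_subseq[OF assms(1) s(1)] LIMSEQ_subseq_LIMSEQ[OF assms(2) s(1)] by (simp_all add: comp_def)
  ultimately show ?thesis
    using pconv_div_power[of "\<lambda>k. f (s k)" p "\<lambda>k. e (s k)" \<mu> r "\<lambda>k. h k"] by auto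
qed

text \<open>Factor by factor, a root at distance at least \<open>r\<close> from \<mu> gives a growth
  factor of at most \<open>1 + norm s / r\<close>. Hence a polynomial that is small at \<mu> and has
  no root nearby is small everywhere, a quantitative substitute for the theorem of Hurwitz.\<close>

lemma norm_poly_le_of_far_roots:
  fixes p :: "complex poly"
  assumes "\<And>x. poly p x = 0 \<Longrightarrow> r \<le> dist x \<mu>" "r > 0"
  shows "norm (poly p (\<mu> + s)) \<le> norm (poly p \<mu>) * (1 + norm s / r) ^ degree p"
proof -
  obtain A where A: "size A = degree p" "p = smult (lead_coeff p) (\<Prod>x\<in>#A. [:- x, 1:])"
    using alg_closed_imp_factorization[of p] by (cases "p = 0") auto
  have far: "r \<le> dist x \<mu>" if "x \<in># A" for x
  proof (rule assms(1))
    have "poly (\<Prod>x\<in>#A. [:- x, 1:]) x = 0"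
      using that by (simp add: poly_prod_mset prod_mset_zero_iff)
    then show "poly p x = 0" by (subst A(2)) simp
  qed
  have "norm (poly (\<Prod>x\<in>#A. [:- x, 1:]) (\<mu> + s)) \<le>
      norm (poly (\<Prod>x\<in>#A. [:- x, 1:]) \<mu>) * (1 + norm s / r) ^ size A" using far
  proof (induction A)
    case (add x A)
    have r: "r \<le> norm (\<mu> - x)" using add.prems[of x] by (simp add: dist_norm norm_minus_commute)
    have "norm (\<mu> + s - x) \<le> norm (\<mu> - x) + norm s"
      by (metis add.commute add_diff_eq norm_triangle_ineq)
    also have "norm s = r * (norm s / r)" using assms(2) by simp
    also have "\<dots> \<le> norm (\<mu> - x) * (norm s / r)" using r assms(2) by (intro mult_right_mono) auto
    finally have 1: "norm (\<mu> + s - x) \<le> norm (\<mu> - x) * (1 + norm s / r)" by (simp add: algebra_simps)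
    have 2: "norm (poly (\<Prod>x\<in>#A. [:- x, 1:]) (\<mu> + s)) \<le>
      norm (poly (\<Prod>x\<in>#A. [:- x, 1:]) \<mu>) * (1 + norm s / r) ^ size A"
      using add by simp
    have *: "norm (poly (\<Prod>x\<in>#add_mset x A. [:- x, 1:]) y) =
        norm (y - x) * norm (poly (\<Prod>x\<in>#A. [:- x, 1:]) y)" for y
      by (subst norm_mult[symmetric]) (simp add: algebra_simps)
    show ?case unfolding * using mult_mono[OF 1 2] assms(2) by (simp add: mult_ac)
  qed simp
  then have "norm (lead_coeff p) * norm (poly (\<Prod>x\<in>#A. [:- x, 1:]) (\<mu> + s)) \<le>
      norm (lead_coeff p) * (norm (poly (\<Prod>x\<in>#A. [:- x, 1:]) \<mu>) * (1 + norm s / r) ^ size A)"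
    by (intro mult_left_mono) auto
  moreover have "poly p x = lead_coeff p * poly (\<Prod>x\<in>#A. [:- x, 1:]) x" for x
    by (subst A(2)) simp
  ultimately show ?thesis
    using A(1) by (simp add: norm_mult)
qed

text \<open>If roots stayed away from \<mu> infinitely often, the growth bound would force the
  values at a fixed \<open>y\<close> with \<open>poly p y \<noteq> 0\<close> towards 0, as the
  values at \<mu> tend to 0. Comparing values instead of leading coefficients copes with a degree
  that drops in the limit.\<close>

lemma eventually_root_near:
  assumes f: "pconv f p" and p: "p \<noteq> 0" "poly p \<mu> = 0" and r: "r > 0"
  shows "\<forall>\<^sub>F k in sequentially. \<exists>x. poly (f k) x = 0 \<and> dist x \<mu> < r"
proof (rule ccontr)
  assume "\<not> ?thesis"
  then have fr: "\<exists>\<^sub>F k in sequentially. \<forall>x. poly (f k) x = 0 \<longrightarrow> r \<le> dist x \<mu>"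
    by (simp add: not_eventually not_less)
  obtain a where a: "\<And>k. degree (f k) \<le> a"
    using f unfolding pconv_def by blast
  obtain y where y: "poly p y \<noteq> 0" using p(1) poly_all_0_iff_0 by blast
  define s where "s = y - \<mu>"
  define c where "c = (1 + norm s / r) ^ a"
  have "(\<lambda>k. norm (poly (f k) \<mu>) * c) \<longlonglongrightarrow> norm (poly p \<mu>) * c"
    by (intro tendsto_mult tendsto_norm pconv_poly f tendsto_const)
  moreover have "(\<lambda>k. norm (poly (f k) y)) \<longlonglongrightarrow> norm (poly p y)"
    by (intro tendsto_norm pconv_poly f tendsto_const)
  ultimately have "\<forall>\<^sub>F k in sequentially. norm (poly (f k) \<mu>) * c < norm (poly p y) / 2"
    "\<forall>\<^sub>F k in sequentially. norm (poly p y) / 2 < norm (poly (f k) y)"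
    using y p(2) by (auto elim!: order_tendstoD simp del: less_divide_eq_numeral1 divide_less_eq_numeral1) simp
  then have "\<forall>\<^sub>F k in sequentially. \<not> (\<forall>x. poly (f k) x = 0 \<longrightarrow> r \<le> dist x \<mu>)"
  proof eventually_elim
    case (elim k)
    show ?case
    proof
      assume "\<forall>x. poly (f k) x = 0 \<longrightarrow> r \<le> dist x \<mu>"
      then have "norm (poly (f k) (\<mu> + s)) \<le> norm (poly (f k) \<mu>) * (1 + norm s / r) ^ degree (f k)"
        using r by (intro norm_poly_le_of_far_roots) auto
      also have "\<dots> \<le> norm (poly (f k) \<mu>) * c"
        unfolding c_def using a r by (intro mult_left_mono power_increasing) auto
      finally show False using elim by (simp add: s_def)
    qed
  qed
  then show False using fr by (simp add: frequently_def)
qed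

text \<open>The two lemmas on the drift of a root compare an \<open>n\<close>-fold root \<open>e k\<close> with its limit \<open>\<mu>\<close>, to first order in
  \<open>\<epsilon>\<close>: the first gives the velocity \<open>\<sigma>\<close>, the second the derivative modulo \<open>(X - \<mu>)^n\<close>.\<close>

lemma root_drift_converges:
  assumes "n \<ge> 1" "\<And>k. \<epsilon> k \<noteq> 0" "pconv f f0" "poly f0 \<mu> \<noteq> 0" "pconv G G0" "e \<longlonglongrightarrow> \<mu>"
    "\<And>k. smult (\<epsilon> k) (G k) = [:- e k, 1:] ^ n * f k - [:- \<mu>, 1:] ^ n * H k"
  shows "\<exists>\<sigma>. (\<lambda>k. (e k - \<mu>) / \<epsilon> k) \<longlonglongrightarrow> \<sigma>"
  using assms
proof (induction n arbitrary: f f0 G G0 H)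
  case (Suc n)
  show ?case
  proof (cases "n = 0")
    case True
    \<comment> \<open>For a simple root, evaluation at \<mu> removes the \<open>H\<close> term and
      leaves an equation linear in the displacement of the root.\<close>
    have *: "\<epsilon> k * poly (G k) \<mu> = (\<mu> - e k) * poly (f k) \<mu>" for k
      using arg_cong[OF Suc.prems(7)[of k], of "\<lambda>p. poly p \<mu>"] True by (simp add: algebra_simps)
    have fl: "(\<lambda>k. poly (f k) \<mu>) \<longlonglongrightarrow> poly f0 \<mu>"
      using Suc.prems(3) by (intro pconv_poly) auto
    have "(\<lambda>k. - (poly (G k) \<mu> / poly (f k) \<mu>)) \<longlonglongrightarrow> - (poly G0 \<mu> / poly f0 \<mu>)"
      using Suc.prems(3-6) by (intro tendsto_minus tendsto_divide pconv_poly) auto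
    moreover have "\<forall>\<^sub>F k in sequentially. - (poly (G k) \<mu> / poly (f k) \<mu>) = (e k - \<mu>) / \<epsilon> k"
      using tendsto_imp_eventually_ne[OF fl Suc.prems(4)]
    proof eventually_elim
      case (elim k)
      then show ?case using *[of k] Suc.prems(2)[of k]
        by (simp add: field_simps)
    qed
    ultimately have "(\<lambda>k. (e k - \<mu>) / \<epsilon> k) \<longlonglongrightarrow> - (poly G0 \<mu> / poly f0 \<mu>)"
      by (rule Lim_transform_eventually)
    then show ?thesis ..
  next
    case False
    \<comment> \<open>Differentiating lowers the multiplicity by one. The cofactors change to
      \<open>?f\<close> and \<open>?H\<close>; at \<mu> the limit of \<open>?f\<close> is
      \<open>Suc n\<close> times \<open>poly f0 \<mu>\<close>, hence still nonzero.\<close>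
    let ?f = "\<lambda>k. of_nat (Suc n) * f k + [:- e k, 1:] * pderiv (f k)"
    let ?H = "\<lambda>k. of_nat (Suc n) * H k + [:- \<mu>, 1:] * pderiv (H k)"
    have pd: "pderiv ([:- c, 1:] ^ Suc n * p) = [:- c, 1:] ^ n * (of_nat (Suc n) * p + [:- c, 1:] * pderiv p)"
      for c :: complex and p
    proof -
      have P: "pderiv [:- c, 1:] = 1" by (simp add: pderiv_pCons)
      have S: "smult a q = [:a:] * q" for a :: complex and q by simp
      show ?thesis
        by (simp only: pderiv_mult pderiv_power_Suc P S of_nat_poly)
          (simp only: algebra_simps mult_1_right mult_1_left power_Suc)
    qed
    show ?thesis
    proof (rule Suc.IH[where f = ?f and H = ?H and G = "\<lambda>k. pderiv (G k)"])
      show "pconv ?f (of_nat (Suc n) * f0 + [:- \<mu>, 1:] * pderiv f0)"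
        using Suc.prems(3,6)
        by (intro pconv_add pconv_mult pconv_pderiv pconv_const pconv_linear tendsto_minus) auto
      show "poly (of_nat (Suc n) * f0 + [:- \<mu>, 1:] * pderiv f0) \<mu> \<noteq> 0"
        using Suc.prems(4) by (simp add: of_nat_poly del: of_nat_Suc)
      show "pconv (\<lambda>k. pderiv (G k)) (pderiv G0)"
        using Suc.prems(5) by (intro pconv_pderiv) auto
      show "smult (\<epsilon> k) (pderiv (G k)) = [:- e k, 1:] ^ n * ?f k - [:- \<mu>, 1:] ^ n * ?H k" for k
        using arg_cong[OF Suc.prems(7)[of k], of pderiv]
        unfolding pderiv_smult pderiv_diff pd .
    qed (use False Suc.prems(2,6) in auto)
  qed
qed simp

lemma root_drift_limit:
  assumes n: "n \<ge> 1" and \<epsilon>: "\<And>k. \<epsilon> k \<noteq> 0" and f: "pconv f f0" and G: "pconv G G0" and e: "e \<longlonglongrightarrow> \<mu>"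
    and eq: "\<And>k. smult (\<epsilon> k) (G k) = [:- e k, 1:] ^ n * f k - [:- \<mu>, 1:] ^ n * H k"
    and \<sigma>: "(\<lambda>k. (e k - \<mu>) / \<epsilon> k) \<longlonglongrightarrow> \<sigma>"
  shows "[:- \<mu>, 1:] ^ n dvd G0 - smult (- of_nat n * \<sigma>) ([:- \<mu>, 1:] ^ (n - 1) * f0)"
proof -
  let ?S = "\<lambda>k. \<Sum>i<n. [:- \<mu>, 1:] ^ (n - Suc i) * [:- e k, 1:] ^ i"
  have eqS: "[:- e k, 1:] ^ n - [:- \<mu>, 1:] ^ n = smult (\<mu> - e k) (?S k)" for k
    by (subst power_diff_sumr2) simp
  have S: "pconv ?S (\<Sum>i<n. [:- \<mu>, 1:] ^ (n - Suc i) * [:- \<mu>, 1:] ^ i)"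
    by (intro pconv_sum pconv_mult pconv_power pconv_linear pconv_const tendsto_minus e)
  have "(\<Sum>i<n. [:- \<mu>, 1:] ^ (n - Suc i) * [:- \<mu>, 1:] ^ i) = (\<Sum>i<n. [:- \<mu>, 1:] ^ (n - 1))"
    by (intro sum.cong refl) (simp flip: power_add)
  with S have S: "pconv ?S (smult (of_nat n) ([:- \<mu>, 1:] ^ (n - 1)))"
    by (simp add: of_nat_poly)
  \<comment> \<open>\<open>g\<close> is \<open>G\<close> minus the contribution of the moving root,
    that is \<open>([:- e k, 1:] ^ n - [:- \<mu>, 1:] ^ n) * f k\<close> divided by
    \<open>\<epsilon> k\<close>. What remains is a multiple of \<open>[:- \<mu>, 1:] ^ n\<close> for
    every \<open>k\<close>.\<close>
  define g where "g = (\<lambda>k. G k - smult (- ((e k - \<mu>) / \<epsilon> k)) (?S k * f k))"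
  have "g k = [:- \<mu>, 1:] ^ n * smult (1 / \<epsilon> k) (f k - H k)" for k
  proof -
    have "smult (\<epsilon> k) (g k) = smult (\<epsilon> k) (G k) - smult (\<mu> - e k) (?S k) * f k"
    proof -
      have "\<epsilon> k * (- ((e k - \<mu>) / \<epsilon> k)) = \<mu> - e k" using \<epsilon>[of k] by simp
      then show ?thesis by (simp only: g_def smult_diff_right smult_smult mult_smult_left)
    qed
    also have "\<dots> = [:- \<mu>, 1:] ^ n * (f k - H k)"
      unfolding eq eqS[symmetric] by (simp add: algebra_simps)
    finally have "smult (1 / \<epsilon> k) (smult (\<epsilon> k) (g k)) = smult (1 / \<epsilon> k) ([:- \<mu>, 1:] ^ n * (f k - H k))"
      by simp
    then show ?thesis using \<epsilon>[of k] by simp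
  qed
  moreover have "pconv g (G0 - smult (- \<sigma>) (smult (of_nat n) ([:- \<mu>, 1:] ^ (n - 1)) * f0))"
    unfolding g_def by (intro pconv_diff pconv_smult pconv_mult S G f tendsto_minus \<sigma>)
  ultimately obtain q where q:
    "G0 - smult (- \<sigma>) (smult (of_nat n) ([:- \<mu>, 1:] ^ (n - 1)) * f0) = [:- \<mu>, 1:] ^ n * q"
    using pconv_div_power[of g _ "\<lambda>_. \<mu>" \<mu> n "\<lambda>k. smult (1 / \<epsilon> k) (f k - H k)"] by auto
  then show ?thesis by (simp add: mult.commute)
qed

section \<open>Limits of determinants and adjugates\<close>

lemma pconv_det:
  assumes "\<And>k. A k \<in> carrier_mat n n" "B \<in> carrier_mat n n"
    "\<And>i j. i < n \<Longrightarrow> j < n \<Longrightarrow> pconv (\<lambda>k. A k $$ (i,j)) (B $$ (i,j))"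
  shows "pconv (\<lambda>k. det (A k)) (det B)"
  unfolding det_def'[OF assms(1)] det_def'[OF assms(2)]
  by (intro pconv_sum pconv_mult pconv_const pconv_prod assms(3)) (auto dest: permutes_in_image)

lemma pconv_adj_mat:
  assumes A: "\<And>k. A k \<in> carrier_mat n n" and B: "B \<in> carrier_mat n n"
    and AB: "\<And>i j. i < n \<Longrightarrow> j < n \<Longrightarrow> pconv (\<lambda>k. A k $$ (i,j)) (B $$ (i,j))"
    and ij: "i < n" "j < n"
  shows "pconv (\<lambda>k. adj_mat (A k) $$ (i,j)) (adj_mat B $$ (i,j))"
proof -
  have "pconv (\<lambda>k. det (mat_delete (A k) j i)) (det (mat_delete B j i))"
  proof (rule pconv_det[where n = "n - 1"])
    show "mat_delete (A k) j i \<in> carrier_mat (n - 1) (n - 1)" for k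
      by (rule mat_delete_carrier) (rule A)
    show "mat_delete B j i \<in> carrier_mat (n - 1) (n - 1)"
      by (rule mat_delete_carrier) (rule B)
    fix i' j' assume *: "i' < n - 1" "j' < n - 1"
    then have md: "mat_delete M j i $$ (i', j') = M $$ (insert_index j i', insert_index i j')"
      if "M \<in> carrier_mat n n" for M :: "complex poly mat"
      using that by (simp add: mat_delete_def insert_index_def)
    show "pconv (\<lambda>k. mat_delete (A k) j i $$ (i', j')) (mat_delete B j i $$ (i', j'))"
      unfolding md[OF A] md[OF B] using * ij by (intro AB) (auto simp: insert_index_def)
  qed
  then have "pconv (\<lambda>k. (-1)^(j+i) * det (mat_delete (A k) j i)) ((-1)^(j+i) * det (mat_delete B j i))"
    by (intro pconv_mult pconv_const)
  moreover have "adj_mat M $$ (i,j) = (-1)^(j+i) * det (mat_delete M j i)"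
    if "M \<in> carrier_mat n n" for M :: "complex poly mat"
    using that ij by (simp add: adj_mat_def cofactor_def)
  ultimately show ?thesis by (simp only: A B)
qed

section \<open>Matrices and vectors as functions, over numbers and over polynomials\<close>

definition mv :: "nat \<Rightarrow> (nat \<Rightarrow> nat \<Rightarrow> 'a::comm_ring_1) \<Rightarrow> (nat \<Rightarrow> 'a) \<Rightarrow> nat \<Rightarrow> 'a" where
  "mv n S x i = (\<Sum>j<n. S i j * x j)"

definition dp :: "nat \<Rightarrow> (nat \<Rightarrow> 'a::comm_ring_1) \<Rightarrow> (nat \<Rightarrow> 'a) \<Rightarrow> 'a" where
  "dp n u v = (\<Sum>i<n. u i * v i)"

text \<open>The Gram matrix of \<open>A - X B\<close>; for two Lie forms it is the form at the
  covector \<open>x - X a\<close>.\<close>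

definition pencil :: "cmat \<Rightarrow> cmat \<Rightarrow> nat \<Rightarrow> nat \<Rightarrow> complex poly" where
  "pencil A B i j = [:A i j, - B i j:]"

abbreviation cvec :: "(nat \<Rightarrow> complex) \<Rightarrow> nat \<Rightarrow> complex poly" where
  "cvec u \<equiv> \<lambda>i. [:u i:]"

abbreviation cmatp :: "cmat \<Rightarrow> nat \<Rightarrow> nat \<Rightarrow> complex poly" where
  "cmatp B \<equiv> \<lambda>i j. [:B i j:]"

lemma mv_cong: "(\<And>i j. i < n \<Longrightarrow> j < n \<Longrightarrow> S i j = S' i j) \<Longrightarrow> (\<And>j. j < n \<Longrightarrow> x j = y j) \<Longrightarrow> i < n \<Longrightarrow>
    mv n S x i = mv n S' y i"
  unfolding mv_def by (intro sum.cong) auto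

lemma dp_cong: "(\<And>i. i < n \<Longrightarrow> u i = u' i) \<Longrightarrow> (\<And>i. i < n \<Longrightarrow> v i = v' i) \<Longrightarrow> dp n u v = dp n u' v'"
  unfolding dp_def by (intro sum.cong) auto

lemma mv_add: "mv n S (\<lambda>j. x j + y j) i = mv n S x i + mv n S y i"
  by (simp add: mv_def algebra_simps sum.distrib)

lemma mv_diff: "mv n S (\<lambda>j. x j - y j) i = mv n S x i - mv n S y i"
  by (simp add: mv_def algebra_simps sum_subtractf)

lemma mv_scale: "mv n S (\<lambda>j. c * x j) i = c * mv n S x i"
  by (simp add: mv_def sum_distrib_left mult_ac)

lemma dp_add_right: "dp n u (\<lambda>j. x j + y j) = dp n u x + dp n u y"
  by (simp add: dp_def algebra_simps sum.distrib)

lemma dp_diff_right: "dp n u (\<lambda>j. x j - y j) = dp n u x - dp n u y"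
  by (simp add: dp_def algebra_simps sum_subtractf)

lemma dp_scale_right: "dp n u (\<lambda>j. c * x j) = c * dp n u x"
  by (simp add: dp_def sum_distrib_left mult_ac)

lemma dp_commute: "dp n u v = dp n v u"
  by (simp add: dp_def mult.commute)

lemma dp_mv_skew:
  assumes "\<And>i j. i < n \<Longrightarrow> j < n \<Longrightarrow> S i j = - S j i"
  shows "dp n u (mv n S v) = - dp n (mv n S u) v"
proof -
  have "dp n u (mv n S v) = (\<Sum>j<n. \<Sum>i<n. u i * (S i j * v j))"
    unfolding dp_def mv_def sum_distrib_left by (rule sum.swap)
  also have "\<dots> = (\<Sum>j<n. \<Sum>i<n. - (S j i * u i * v j))"
  proof (intro sum.cong refl)
    fix i j assume "i \<in> {..<n}" "j \<in> {..<n}"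
    then show "u i * (S i j * v j) = - (S j i * u i * v j)"
      using assms[of i j] by (simp add: mult_ac)
  qed
  also have "\<dots> = - dp n (mv n S u) v"
    by (simp add: dp_def mv_def sum_negf sum_distrib_right)
  finally show ?thesis .
qed

lemma sum_lessThan_add: "(\<Sum>i<a + b. f i) = (\<Sum>i<a. f i) + (\<Sum>j<b. f (a + j :: nat))"
  for f :: "nat \<Rightarrow> 'a::comm_monoid_add"
  by (induction b) (auto simp: add.assoc)

lemma sum_const_poly: "(\<Sum>i\<in>I. [:f i:]) = [:\<Sum>i\<in>I. f i:]" for f :: "'b \<Rightarrow> complex"
  by (induction I rule: infinite_finite_induct) auto

lemma poly_mv: "poly (mv n S x i) a = mv n (\<lambda>i j. poly (S i j) a) (\<lambda>j. poly (x j) a) i"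
  by (simp add: mv_def poly_sum)

lemma poly_dp: "poly (dp n u v) a = dp n (\<lambda>i. poly (u i) a) (\<lambda>i. poly (v i) a)"
  by (simp add: dp_def poly_sum)

lemma mv_const: "mv n (cmatp A) (cvec x) i = [:mv n A x i:]"
  by (simp add: mv_def sum_const_poly mult.commute)

lemma dp_const: "dp n (cvec u) (cvec v) = [:dp n u v:]"
  by (simp add: dp_def sum_const_poly mult.commute)

section \<open>Canonical pairs\<close>

text \<open>A version of \<open>dsum\<close> over any ring, driven by a matrix for each block, so
  that the polynomial pencil and the second form share their lemmas.\<close>

fun dsum_of :: "(jk_block \<Rightarrow> nat \<Rightarrow> nat \<Rightarrow> 'a::comm_ring_1) \<Rightarrow> jk_block list \<Rightarrow> nat \<Rightarrow> nat \<Rightarrow> 'a" where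
  "dsum_of h [] = (\<lambda>i j. 0)"
| "dsum_of h (b # bs) = (\<lambda>i j. if i < block_size b \<and> j < block_size b then h b i j
     else if block_size b \<le> i \<and> block_size b \<le> j then dsum_of h bs (i - block_size b) (j - block_size b) else 0)"

definition block_pencil :: "jk_block \<Rightarrow> nat \<Rightarrow> nat \<Rightarrow> complex poly" where
  "block_pencil b = pencil (fst (block_pair b)) (snd (block_pair b))"

definition block_snd :: "jk_block \<Rightarrow> nat \<Rightarrow> nat \<Rightarrow> complex poly" where
  "block_snd b = cmatp (snd (block_pair b))"

abbreviation total_size :: "jk_block list \<Rightarrow> nat" where
  "total_size bs \<equiv> sum_list (map block_size bs)"

lemma pencil_canon_pair: "pencil (fst (canon_pair bs)) (snd (canon_pair bs)) = dsum_of block_pencil bs"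
  unfolding canon_pair_def fst_conv snd_conv
  by (induction bs) (auto simp: pencil_def block_pencil_def fun_eq_iff)

lemma cmatp_canon_pair: "cmatp (snd (canon_pair bs)) = dsum_of block_snd bs"
  unfolding canon_pair_def fst_conv snd_conv
  by (induction bs) (auto simp: block_snd_def fun_eq_iff)

lemma mv_dsum_Cons:
  assumes "i < block_size b + m"
  shows "mv (block_size b + m) (dsum_of h (b # bs)) x i =
    (if i < block_size b then mv (block_size b) (h b) x i
     else mv m (dsum_of h bs) (\<lambda>j. x (block_size b + j)) (i - block_size b))"
  using assms unfolding mv_def sum_lessThan_add by simp

lemma mv_zero_right: "mv n S (\<lambda>j. 0) i = 0"
  by (simp add: mv_def)

definition embed :: "nat \<Rightarrow> nat \<Rightarrow> (nat \<Rightarrow> 'a::zero) \<Rightarrow> nat \<Rightarrow> 'a" where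
  "embed k s x i = (if k \<le> i \<and> i < k + s then x (i - k) else 0)"

lemma mv_dsum_embed:
  assumes "i < total_size (bs1 @ b # bs2)"
  shows "mv (total_size (bs1 @ b # bs2)) (dsum_of h (bs1 @ b # bs2)) (embed (total_size bs1) (block_size b) x) i =
    embed (total_size bs1) (block_size b) (mv (block_size b) (h b) x) i"
  using assms
proof (induction bs1 arbitrary: i)
  case Nil
  have "mv (total_size bs2) (dsum_of h bs2) (\<lambda>j. embed 0 (block_size b) x (block_size b + j)) k = 0" for k
    by (simp add: embed_def mv_zero_right)
  moreover have "i < block_size b \<Longrightarrow> mv (block_size b) (h b) (embed 0 (block_size b) x) i = mv (block_size b) (h b) x i"
    by (intro mv_cong) (auto simp: embed_def)
  ultimately show ?case
    using Nil by (simp add: mv_dsum_Cons del: dsum_of.simps) (simp add: embed_def)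
next
  case (Cons b' bs1)
  let ?s = "block_size b'"
  have 1: "mv ?s (h b') (embed (?s + total_size bs1) (block_size b) x) k = 0" for k
  proof -
    have "mv ?s (h b') (embed (?s + total_size bs1) (block_size b) x) k = (\<Sum>j<?s. 0)"
      unfolding mv_def by (intro sum.cong) (auto simp: embed_def)
    then show ?thesis by simp
  qed
  have 2: "(\<lambda>j. embed (?s + total_size bs1) (block_size b) x (?s + j)) = embed (total_size bs1) (block_size b) x"
    by (auto simp: embed_def fun_eq_iff)
  show ?case
  proof (cases "i < ?s")
    case True
    then show ?thesis using 1
      by (simp add: mv_dsum_Cons add.assoc del: dsum_of.simps) (simp add: embed_def)
  next
    case False
    then have "i - ?s < total_size (bs1 @ b # bs2)" using Cons.prems by simp
    from Cons.IH[OF this] show ?thesis using False Cons.prems 2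
      by (simp add: mv_dsum_Cons add.assoc del: dsum_of.simps) (auto simp: embed_def)
  qed
qed

section \<open>Jordan blocks as skew matrices with a bidiagonal corner\<close>

definition skew_of :: "nat \<Rightarrow> (nat \<Rightarrow> nat \<Rightarrow> 'a::comm_ring_1) \<Rightarrow> nat \<Rightarrow> nat \<Rightarrow> 'a" where
  "skew_of p X = (\<lambda>i j. if i < p \<and> p \<le> j then X i (j - p)
                           else if p \<le> i \<and> j < p then - X j (i - p) else 0)"

definition bidiag :: "'a::comm_ring_1 \<Rightarrow> 'a \<Rightarrow> nat \<Rightarrow> nat \<Rightarrow> 'a" where
  "bidiag \<alpha> \<beta> i j = (if i = j then \<alpha> else if j = Suc i then \<beta> else 0)"

lemma pencil_skew_block: "pencil (skew_block m X) (skew_block m Y) = skew_of m (pencil X Y)"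
  by (intro ext) (simp add: pencil_def skew_of_def skew_block_def)

lemma pencil_jordan_id: "pencil (jordan_mat e) id_mat = bidiag [:e, -1:] 1"
  by (intro ext) (simp add: pencil_def bidiag_def jordan_mat_def id_mat_def one_pCons)

lemma pencil_id_jordan: "pencil id_mat (jordan_mat 0) = bidiag 1 [:0, -1:]"
  by (intro ext) (simp add: pencil_def bidiag_def jordan_mat_def id_mat_def one_pCons)

lemma block_pencil_Some: "block_pencil (Jor (Some e) m) = skew_of m (bidiag [:e, -1:] 1)"
  by (simp add: block_pencil_def pencil_skew_block pencil_jordan_id)

lemma block_pencil_None: "block_pencil (Jor None m) = skew_of m (bidiag 1 [:0, -1:])"
  by (simp add: block_pencil_def pencil_skew_block pencil_id_jordan)

lemma cmatp_skew_block: "cmatp (skew_block m X) = skew_of m (cmatp X)"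
  by (intro ext) (simp add: skew_of_def skew_block_def)

lemma block_snd_Some: "block_snd (Jor (Some e) m) = skew_of m (bidiag 1 0)"
proof -
  have "cmatp id_mat = bidiag 1 0"
    by (intro ext) (simp add: bidiag_def id_mat_def one_pCons)
  then show ?thesis by (simp add: block_snd_def cmatp_skew_block)
qed

lemma block_snd_None: "block_snd (Jor None m) = skew_of m (bidiag 0 1)"
proof -
  have "cmatp (jordan_mat 0) = bidiag 0 1"
    by (intro ext) (simp add: bidiag_def jordan_mat_def one_pCons)
  then show ?thesis by (simp add: block_snd_def cmatp_skew_block)
qed

lemma mv_skew_of:
  assumes "i < m + m"
  shows "mv (m + m) (skew_of m X) x i =
    (if i < m then (\<Sum>q<m. X i q * x (m + q)) else - (\<Sum>p<m. X p (i - m) * x p))"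
  using assms unfolding mv_def sum_lessThan_add by (simp add: skew_of_def sum_negf)

lemma sum_bidiag_row: "i < m \<Longrightarrow>
    (\<Sum>q<m. bidiag \<alpha> \<beta> i q * y q) = \<alpha> * y i + (if Suc i < m then \<beta> * y (Suc i) else 0)"
proof -
  assume i: "i < m"
  have "(\<Sum>q<m. bidiag \<alpha> \<beta> i q * y q) = (\<Sum>q<m. (if q = i then \<alpha> * y q else 0) + (if q = Suc i then \<beta> * y q else 0))"
    by (intro sum.cong) (auto simp: bidiag_def)
  also have "\<dots> = \<alpha> * y i + (if Suc i < m then \<beta> * y (Suc i) else 0)"
    using i unfolding sum.distrib by (simp add: sum.delta)
  finally show ?thesis .
qed

lemma sum_bidiag_col: "q < m \<Longrightarrow>
    (\<Sum>p<m. bidiag \<alpha> \<beta> p q * y p) = \<alpha> * y q + (if 0 < q then \<beta> * y (q - 1) else 0)"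
proof -
  assume q: "q < m"
  have "(\<Sum>p<m. bidiag \<alpha> \<beta> p q * y p) = (\<Sum>p<m. (if p = q then \<alpha> * y p else 0) + (if p = q - 1 \<and> 0 < q then \<beta> * y p else 0))"
    by (intro sum.cong) (auto simp: bidiag_def)
  also have "\<dots> = \<alpha> * y q + (if 0 < q then \<beta> * y (q - 1) else 0)"
    using q unfolding sum.distrib by (cases q) (simp_all add: sum.delta)
  finally show ?thesis .
qed

text \<open>The matrix is \<alpha> times the identity plus \<beta> times a nilpotent shift. Its
  inverse is a finite geometric series whose worst denominator is \<open>\<alpha> ^ m\<close>, and
  the right-hand side carries exactly this factor.\<close>

lemma bidiag_row_solvable:
  fixes \<alpha> \<beta> g :: "'a::comm_ring_1"
  shows "\<exists>y. \<forall>i<m. (\<Sum>q<m. bidiag \<alpha> \<beta> i q * y q) = \<alpha> ^ m * g * w i"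
proof (intro exI allI impI)
  fix i assume i: "i < m"
  let ?y = "\<lambda>i. \<Sum>k\<in>{i..<m}. \<alpha> ^ (m - 1 - (k - i)) * (- \<beta>) ^ (k - i) * g * w k"
  have eq: "\<alpha> * (\<alpha> ^ (m - 1 - (k - i)) * (- \<beta>) ^ (k - i) * g * w k) =
      - \<beta> * (\<alpha> ^ (m - 1 - (k - Suc i)) * (- \<beta>) ^ (k - Suc i) * g * w k)" if "k \<in> {Suc i..<m}" for k
  proof -
    have "m - 1 - (k - Suc i) = Suc (m - 1 - (k - i))" "k - i = Suc (k - Suc i)" using that by auto
    then show ?thesis by simp
  qed
  have "\<alpha> * ?y i = \<alpha> * (\<alpha> ^ (m - 1) * g * w i) +
      (\<Sum>k\<in>{Suc i..<m}. \<alpha> * (\<alpha> ^ (m - 1 - (k - i)) * (- \<beta>) ^ (k - i) * g * w k))"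
    using i by (simp add: sum.atLeast_Suc_lessThan distrib_left sum_distrib_left)
  also have "(\<Sum>k\<in>{Suc i..<m}. \<alpha> * (\<alpha> ^ (m - 1 - (k - i)) * (- \<beta>) ^ (k - i) * g * w k)) =
      (\<Sum>k\<in>{Suc i..<m}. - \<beta> * (\<alpha> ^ (m - 1 - (k - Suc i)) * (- \<beta>) ^ (k - Suc i) * g * w k))"
    by (intro sum.cong refl eq)
  also have "\<dots> = - \<beta> * ?y (Suc i)" by (simp only: sum_distrib_left)
  also have "\<alpha> * (\<alpha> ^ (m - 1) * g * w i) = \<alpha> ^ m * g * w i"
    using i by (cases m) (auto simp: mult_ac)
  finally have "\<alpha> * ?y i = \<alpha> ^ m * g * w i + - \<beta> * ?y (Suc i)" .
  then show "(\<Sum>q<m. bidiag \<alpha> \<beta> i q * ?y q) = \<alpha> ^ m * g * w i"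
    unfolding sum_bidiag_row[OF i] using i by (cases "Suc i < m") auto
qed

text \<open>Reversing the order of both indices turns the transposed matrix back into an upper
  bidiagonal one.\<close>

lemma bidiag_col_solvable:
  fixes \<alpha> \<beta> g :: "'a::comm_ring_1"
  shows "\<exists>y. \<forall>q<m. (\<Sum>p<m. bidiag \<alpha> \<beta> p q * y p) = \<alpha> ^ m * g * w q"
proof -
  obtain y where y: "\<And>i. i < m \<Longrightarrow> (\<Sum>q<m. bidiag \<alpha> \<beta> i q * y q) = \<alpha> ^ m * g * w (m - Suc i)"
    using bidiag_row_solvable[of m \<alpha> \<beta> g "\<lambda>i. w (m - Suc i)"] by blast
  have "(\<Sum>p<m. bidiag \<alpha> \<beta> p q * y (m - Suc p)) = \<alpha> ^ m * g * w q" if q: "q < m" for q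
  proof -
    have "(\<Sum>p<m. bidiag \<alpha> \<beta> p q * y (m - Suc p)) = (\<Sum>p<m. bidiag \<alpha> \<beta> (m - Suc p) q * y (m - Suc (m - Suc p)))"
      by (rule sum.nat_diff_reindex[symmetric])
    also have "\<dots> = (\<Sum>p<m. bidiag \<alpha> \<beta> (m - Suc q) p * y p)"
    proof (intro sum.cong refl)
      fix p assume "p \<in> {..<m}"
      then have p: "p < m" by simp
      have "m - Suc p = q \<longleftrightarrow> m - Suc q = p" "q = Suc (m - Suc p) \<longleftrightarrow> p = Suc (m - Suc q)"
        "m - Suc (m - Suc p) = p" using p q by presburger+
      then show "bidiag \<alpha> \<beta> (m - Suc p) q * y (m - Suc (m - Suc p)) = bidiag \<alpha> \<beta> (m - Suc q) p * y p"
        unfolding bidiag_def by (simp only:)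
    qed
    also have "\<dots> = \<alpha> ^ m * g * w (m - Suc (m - Suc q))" using q by (intro y) simp
    also have "m - Suc (m - Suc q) = q" using q by simp
    finally show ?thesis .
  qed
  then show ?thesis by (intro exI[of _ "\<lambda>p. y (m - Suc p)"] allI impI)
qed

lemma skew_bidiag_solvable:
  fixes \<alpha> \<beta> M :: "'a::comm_ring_1"
  assumes "\<alpha> ^ m dvd M"
  shows "\<exists>x. \<forall>i<m + m. mv (m + m) (skew_of m (bidiag \<alpha> \<beta>)) x i = M * w i"
proof -
  obtain g where g: "M = \<alpha> ^ m * g" using assms by (auto elim: dvdE)
  obtain y where y: "\<And>i. i < m \<Longrightarrow> (\<Sum>q<m. bidiag \<alpha> \<beta> i q * y q) = \<alpha> ^ m * g * w i"
    using bidiag_row_solvable by blast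
  obtain y' where y': "\<And>q. q < m \<Longrightarrow> (\<Sum>p<m. bidiag \<alpha> \<beta> p q * y' p) = \<alpha> ^ m * g * - w (m + q)"
    using bidiag_col_solvable[of m \<alpha> \<beta> g "\<lambda>q. - w (m + q)"] by blast
  define x where "x = (\<lambda>i. if i < m then y' i else y (i - m))"
  have "mv (m + m) (skew_of m (bidiag \<alpha> \<beta>)) x i = M * w i" if i: "i < m + m" for i
  proof (cases "i < m")
    case True
    have "(\<Sum>q<m. bidiag \<alpha> \<beta> i q * x (m + q)) = M * w i"
      using y[OF True] by (simp add: x_def g)
    then show ?thesis using True unfolding mv_skew_of[OF i] by simp
  next
    case False
    have "(\<Sum>p<m. bidiag \<alpha> \<beta> p (i - m) * x p) = (\<Sum>p<m. bidiag \<alpha> \<beta> p (i - m) * y' p)"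
      by (intro sum.cong) (auto simp: x_def)
    moreover have "i - m < m" "m + (i - m) = i" using i False by auto
    ultimately show ?thesis using y'[of "i - m"] False unfolding mv_skew_of[OF i] g by simp
  qed
  then show ?thesis by blast
qed

text \<open>The test is made on the polynomial pencil, so a null column marks a basis vector lying
  in the kernels of both forms.\<close>

definition null_column :: "jk_block list \<Rightarrow> nat \<Rightarrow> bool" where
  "null_column bs j \<longleftrightarrow> (\<forall>i<total_size bs. dsum_of block_pencil bs i j = 0)"

lemma null_column_Cons:
  "null_column (b # bs) j \<longleftrightarrow> (if j < block_size b then \<forall>i<block_size b. block_pencil b i j = 0
     else null_column bs (j - block_size b))"
proof (cases "j < block_size b")
  case False
  have "(\<forall>i<block_size b + total_size bs. dsum_of block_pencil (b # bs) i j = 0) \<longleftrightarrow>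
      (\<forall>i<total_size bs. dsum_of block_pencil bs i (j - block_size b) = 0)"
  proof safe
    fix i assume *: "\<forall>i<block_size b + total_size bs. dsum_of block_pencil (b # bs) i j = 0" "i < total_size bs"
    then show "dsum_of block_pencil bs i (j - block_size b) = 0"
      using False *(1)[rule_format, of "block_size b + i"] by simp
  next
    fix i assume "\<forall>i<total_size bs. dsum_of block_pencil bs i (j - block_size b) = 0"
      "i < block_size b + total_size bs"
    then show "dsum_of block_pencil (b # bs) i j = 0"
      using False by (cases "i < block_size b") auto
  qed
  then show ?thesis using False unfolding null_column_def by simp
qed (auto simp: null_column_def)

lemma Jor_no_null_column:
  assumes "j < block_size (Jor e m)"
  shows "\<exists>i<block_size (Jor e m). block_pencil (Jor e m) i j \<noteq> 0"
proof -
  obtain \<alpha> \<beta> where ab: "block_pencil (Jor e m) = skew_of m (bidiag \<alpha> \<beta>)" "\<alpha> \<noteq> 0"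
    by (cases e) (auto simp: block_pencil_Some block_pencil_None intro: that)
  show ?thesis
  proof (cases "j < m")
    case True
    then show ?thesis using ab by (intro exI[of _ "m + j"]) (auto simp: skew_of_def bidiag_def)
  next
    case False
    then show ?thesis using ab assms by (intro exI[of _ "j - m"]) (auto simp: skew_of_def bidiag_def)
  qed
qed

lemma kron_sizes_simps [simp]:
  "kron_sizes [] = {#}" "kron_sizes (Jor e m # bs) = kron_sizes bs"
  "kron_sizes (Kron k # bs) = add_mset k (kron_sizes bs)"
  by (auto simp: kron_sizes_def)

lemma no_null_column: "kron_sizes bs = {#} \<Longrightarrow> j < total_size bs \<Longrightarrow> \<not> null_column bs j"
proof (induction bs arbitrary: j)
  case (Cons b bs)
  show ?case
  proof (cases b)
    case (Jor e m)
    then show ?thesis using Cons Jor_no_null_column[of j e m]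
      by (cases "j < block_size b") (auto simp: null_column_Cons)
  qed (use Cons in auto)
qed simp

text \<open>Every column of a Jordan block contains its nonzero diagonal entry up to sign, also at
  infinity, where this entry is 1. So the only null column comes from the zero
  \<open>1 \<times> 1\<close> matrix of the Kronecker block.\<close>

lemma unique_null_column:
  "kron_sizes bs = {#1#} \<Longrightarrow> \<exists>j0<total_size bs. \<forall>j<total_size bs. null_column bs j \<longleftrightarrow> j = j0"
proof (induction bs)
  case (Cons b bs)
  show ?case
  proof (cases b)
    case (Jor e m)
    then obtain j0 where j0: "j0 < total_size bs" "\<And>j. j < total_size bs \<Longrightarrow> null_column bs j \<longleftrightarrow> j = j0"
      using Cons by auto
    show ?thesis
    proof (rule exI[of _ "block_size b + j0"], intro conjI allI impI)
      fix j assume j: "j < total_size (b # bs)"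
      show "null_column (b # bs) j \<longleftrightarrow> j = block_size b + j0"
      proof (cases "j < block_size b")
        case True
        then show ?thesis using Jor_no_null_column[of j e m] Jor by (auto simp: null_column_Cons)
      next
        case False
        then show ?thesis using j0(2)[of "j - block_size b"] j by (auto simp: null_column_Cons)
      qed
    qed (use j0 in simp)
  next
    case (Kron k)
    then have k: "k = 1" and bs: "kron_sizes bs = {#}" using Cons.prems by auto
    have "null_column (b # bs) 0" "block_size b = 1"
      using Kron k by (auto simp: null_column_Cons block_pencil_def pencil_def skew_block_def)
    moreover have "\<not> null_column (b # bs) j" if "0 < j" "j < total_size (b # bs)" for j
      using that Kron k no_null_column[OF bs, of "j - 1"] by (auto simp: null_column_Cons)
    ultimately show ?thesis by (intro exI[of _ 0]) auto
  qed
qed simp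

lemma linear_power_dvd_iff: "[:e, -1:] ^ m dvd (M :: complex poly) \<longleftrightarrow> [:- e, 1:] ^ m dvd M"
proof -
  have "[:e, -1:] = - [:- e, 1:]" by simp
  then have "[:e, -1:] ^ m = [:- e, 1:] ^ m \<or> [:e, -1:] ^ m = - ([:- e, 1:] ^ m)"
    by (metis power_minus_even power_minus_odd)
  then show ?thesis by (metis minus_dvd_iff)
qed

text \<open>Block by block: a finite eigenvalue needs \<open>M\<close> to clear its pole, a block at
  infinity has a polynomial inverse because of its unit diagonal, and the trivial Kronecker block
  only demands that the right-hand side vanish there.\<close>

lemma dsum_pencil_solvable:
  assumes "\<And>k. Kron k \<in> set bs \<Longrightarrow> k = 1"
    "\<And>e m. Jor (Some e) m \<in> set bs \<Longrightarrow> [:- e, 1:] ^ m dvd M"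
    "\<And>j. j < total_size bs \<Longrightarrow> null_column bs j \<Longrightarrow> w j = 0"
  shows "\<exists>x. \<forall>i<total_size bs. mv (total_size bs) (dsum_of block_pencil bs) x i = M * w i"
  using assms
proof (induction bs arbitrary: w)
  case (Cons b bs)
  let ?s = "block_size b"
  have "\<exists>x. \<forall>i<total_size bs. mv (total_size bs) (dsum_of block_pencil bs) x i = M * w (?s + i)"
    using Cons.prems by (intro Cons.IH) (auto simp: null_column_Cons)
  then obtain x where x: "\<And>i. i < total_size bs \<Longrightarrow> mv (total_size bs) (dsum_of block_pencil bs) x i = M * w (?s + i)"
    by blast
  have "\<exists>y. \<forall>i<?s. mv ?s (block_pencil b) y i = M * w i"
  proof (cases b)
    case (Jor e m)
    show ?thesis
    proof (cases e)
      case None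
      then show ?thesis using skew_bidiag_solvable[of 1 m M] Jor by (simp add: block_pencil_None mult_2)
    next
      case (Some e')
      then have "[:e', -1:] ^ m dvd M" using Cons.prems(2) Jor by (simp add: linear_power_dvd_iff)
      then show ?thesis using skew_bidiag_solvable[of "[:e', -1:]" m M] Jor Some
        by (simp add: block_pencil_Some mult_2)
    qed
  next
    case (Kron k)
    then have k: "k = 1" using Cons.prems by simp
    then have "null_column (b # bs) 0"
      using Kron by (auto simp: null_column_Cons block_pencil_def pencil_def skew_block_def)
    then have "w 0 = 0" using Cons.prems(3)[of 0] Kron k by simp
    then show ?thesis using Kron k
      by (auto simp: mv_def block_pencil_def pencil_def skew_block_def)
  qed
  then obtain y where y: "\<And>i. i < ?s \<Longrightarrow> mv ?s (block_pencil b) y i = M * w i" by blast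
  define z where "z = (\<lambda>i. if i < ?s then y i else x (i - ?s))"
  have "mv (?s + total_size bs) (dsum_of block_pencil (b # bs)) z i = M * w i" if i: "i < ?s + total_size bs" for i
  proof (cases "i < ?s")
    case True
    have "mv ?s (block_pencil b) z i = mv ?s (block_pencil b) y i"
      using True by (intro mv_cong) (auto simp: z_def)
    then show ?thesis using i True y by (simp add: mv_dsum_Cons del: dsum_of.simps)
  next
    case False
    then show ?thesis using i x[of "i - ?s"] by (simp add: mv_dsum_Cons z_def del: dsum_of.simps)
  qed
  then show ?case by (auto simp del: dsum_of.simps)
qed simp

text \<open>Up to sign, the next two vectors are \<open>(X - e)^m\<close> times a column of the inverse of the block pencil,
  so the pencil maps them to \<open>(X - e)^m\<close> times constant covectors.\<close>

definition chain_upper :: "nat \<Rightarrow> complex \<Rightarrow> nat \<Rightarrow> complex poly" where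
  "chain_upper m e i = (if i < m then [:- e, 1:] ^ (m - 1 - i) else 0)"

definition chain_lower :: "nat \<Rightarrow> complex \<Rightarrow> nat \<Rightarrow> complex poly" where
  "chain_lower m e i = (if i < m then 0 else [:- e, 1:] ^ (i - m))"

lemma mv_chain_upper:
  assumes "m \<ge> 1" "i < block_size (Jor (Some e) m)"
  shows "mv (block_size (Jor (Some e) m)) (block_pencil (Jor (Some e) m)) (chain_upper m e) i =
    [:- e, 1:] ^ m * (if i = m then 1 else 0)"
proof -
  have neg: "[:e, -1:] = - [:- e, 1:]" by simp
  have i: "i < m + m" using assms by simp
  show ?thesis
  proof (cases "i < m")
    case True
    then show ?thesis using i
      by (simp add: mult_2 block_pencil_Some mv_skew_of chain_upper_def)
  next
    case False
    define q where "q = i - m"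
    have q: "q < m" using i False by (simp add: q_def)
    have "mv (m + m) (skew_of m (bidiag [:e, -1:] 1)) (chain_upper m e) i =
      [:- e, 1:] * chain_upper m e q - (if 0 < q then chain_upper m e (q - 1) else 0)"
      using i False q unfolding mv_skew_of[OF i] q_def[symmetric] sum_bidiag_col[OF q] neg
      by (simp add: algebra_simps)
    also have "\<dots> = [:- e, 1:] ^ m * (if i = m then 1 else 0)"
    proof (cases "q = 0")
      case True
      then show ?thesis using assms(1) False q_def
        by (simp add: chain_upper_def power_eq_if[of _ m])
    next
      case False
      then have "m - 1 - (q - 1) = Suc (m - 1 - q)" "i \<noteq> m" using q q_def by auto
      then show ?thesis using False q by (simp add: chain_upper_def)
    qed
    finally show ?thesis by (simp add: mult_2 block_pencil_Some)
  qed
qed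

lemma mv_chain_lower:
  assumes "m \<ge> 1" "i < block_size (Jor (Some e) m)"
  shows "mv (block_size (Jor (Some e) m)) (block_pencil (Jor (Some e) m)) (chain_lower m e) i =
    [:- e, 1:] ^ m * (if i = m - 1 then - 1 else 0)"
proof -
  have neg: "[:e, -1:] = - [:- e, 1:]" by simp
  have i: "i < m + m" using assms by simp
  show ?thesis
  proof (cases "i < m")
    case False
    then show ?thesis using i assms
      by (simp add: mult_2 block_pencil_Some mv_skew_of chain_lower_def)
  next
    case True
    have "mv (m + m) (skew_of m (bidiag [:e, -1:] 1)) (chain_lower m e) i =
      - ([:- e, 1:] * chain_lower m e (m + i)) + (if Suc i < m then chain_lower m e (m + Suc i) else 0)"
      using True unfolding mv_skew_of[OF i] sum_bidiag_row[OF True] neg by simp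
    also have "\<dots> = [:- e, 1:] ^ m * (if i = m - 1 then - 1 else 0)"
    proof (cases "Suc i < m")
      case False
      then have "m = Suc i" using True by simp
      then show ?thesis by (simp add: chain_lower_def)
    qed (auto simp: chain_lower_def)
    finally show ?thesis by (simp add: mult_2 block_pencil_Some)
  qed
qed

lemma mv_snd_chain_lower:
  assumes "i < block_size (Jor (Some e) m)"
  shows "mv (block_size (Jor (Some e) m)) (block_snd (Jor (Some e) m)) (chain_lower m e) i =
    (if i < m then [:- e, 1:] ^ i else 0)"
  using assms sum_bidiag_row[of i m 1 0 "\<lambda>q. chain_lower m e (m + q)"]
  by (simp add: mult_2 block_snd_Some mv_skew_of chain_lower_def)

lemma dp_embed:
  assumes "k + s \<le> n"
  shows "dp n (embed k s x) v = (\<Sum>i<s. x i * v (k + i))"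
proof -
  have n: "n = k + (s + (n - k - s))" using assms by simp
  show ?thesis unfolding dp_def by (subst n, unfold sum_lessThan_add) (simp add: embed_def)
qed

section \<open>Transport along a congruence\<close>

lemma mv_congruence_transpose:
  fixes P :: "nat \<Rightarrow> nat \<Rightarrow> 'a::comm_ring_1"
  assumes "\<And>i j. i < n \<Longrightarrow> j < n \<Longrightarrow> (\<Sum>k<n. \<Sum>l<n. P k i * S k l * P l j) = L i j" "j < n"
  shows "mv n L x j = (\<Sum>k<n. P k j * mv n S (mv n P x) k)"
proof -
  have "mv n L x j = (\<Sum>m<n. \<Sum>k<n. \<Sum>l<n. P k j * (S k l * (P l m * x m)))"
    unfolding mv_def using assms
    by (intro sum.cong refl) (simp add: sum_distrib_right mult.assoc flip: assms(1))
  also have "\<dots> = (\<Sum>k<n. \<Sum>m<n. \<Sum>l<n. P k j * (S k l * (P l m * x m)))"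
    by (rule sum.swap)
  also have "\<dots> = (\<Sum>k<n. \<Sum>l<n. \<Sum>m<n. P k j * (S k l * (P l m * x m)))"
    by (intro sum.cong refl sum.swap)
  also have "\<dots> = (\<Sum>k<n. P k j * mv n S (mv n P x) k)"
    unfolding mv_def sum_distrib_left ..
  finally show ?thesis .
qed

lemma sum_delta_product:
  fixes P :: "nat \<Rightarrow> nat \<Rightarrow> 'a::comm_ring_1"
  assumes "\<And>i j. i < n \<Longrightarrow> j < n \<Longrightarrow> (\<Sum>k<n. P i k * Q k j) = (if i = j then 1 else 0)" "i < n"
  shows "(\<Sum>j<n. Q j i * (\<Sum>k<n. P k j * y k)) = y i"
proof -
  have "(\<Sum>j<n. Q j i * (\<Sum>k<n. P k j * y k)) = (\<Sum>j<n. \<Sum>k<n. P k j * Q j i * y k)"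
    unfolding sum_distrib_left by (intro sum.cong refl) (simp add: mult_ac)
  also have "\<dots> = (\<Sum>k<n. (\<Sum>j<n. P k j * Q j i) * y k)"
    unfolding sum_distrib_right by (rule sum.swap)
  also have "\<dots> = (\<Sum>k<n. if k = i then y k else 0)"
    using assms by (intro sum.cong refl) auto
  also have "\<dots> = y i" using assms(2) by simp
  finally show ?thesis .
qed

text \<open>From \<open>L = P^T S P\<close> and \<open>P Q = 1\<close> follows
  \<open>S P = Q^T L\<close>: vectors are transported by \<open>P\<close>, covectors by the
  transpose of its inverse.\<close>

lemma mv_congruence:
  fixes P :: "nat \<Rightarrow> nat \<Rightarrow> 'a::comm_ring_1"
  assumes "\<And>i j. i < n \<Longrightarrow> j < n \<Longrightarrow> (\<Sum>k<n. \<Sum>l<n. P k i * S k l * P l j) = L i j"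
    "\<And>i j. i < n \<Longrightarrow> j < n \<Longrightarrow> (\<Sum>k<n. P i k * Q k j) = (if i = j then 1 else 0)" "i < n"
  shows "mv n S (mv n P x) i = (\<Sum>j<n. Q j i * mv n L x j)"
proof -
  have "(\<Sum>j<n. Q j i * mv n L x j) = (\<Sum>j<n. Q j i * (\<Sum>k<n. P k j * mv n S (mv n P x) k))"
    using mv_congruence_transpose[of n P S L, OF assms(1)] by (intro sum.cong refl) auto
  also have "\<dots> = mv n S (mv n P x) i"
    by (rule sum_delta_product[OF assms(2,3)])
  finally show ?thesis by simp
qed

lemma dp_congruence:
  fixes P :: "nat \<Rightarrow> nat \<Rightarrow> 'a::comm_ring_1"
  assumes "\<And>i j. i < n \<Longrightarrow> j < n \<Longrightarrow> (\<Sum>k<n. Q i k * P k j) = (if i = j then 1 else 0)"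
  shows "dp n (\<lambda>i. \<Sum>j<n. Q j i * u j) (mv n P x) = dp n u x"
proof -
  have "dp n (\<lambda>i. \<Sum>j<n. Q j i * u j) (mv n P x) = (\<Sum>i<n. \<Sum>j<n. \<Sum>k<n. u j * x k * (Q j i * P i k))"
    unfolding dp_def mv_def sum_product by (intro sum.cong refl) (simp add: mult_ac)
  also have "\<dots> = (\<Sum>j<n. \<Sum>k<n. \<Sum>i<n. u j * x k * (Q j i * P i k))"
    by (subst sum.swap, intro sum.cong refl sum.swap)
  also have "\<dots> = (\<Sum>j<n. \<Sum>k<n. u j * x k * (if j = k then 1 else 0))"
    unfolding sum_distrib_left[symmetric] by (intro sum.cong refl) (simp add: assms)
  also have "\<dots> = dp n u x" by (simp add: dp_def if_distrib sum.delta cong: if_cong)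
  finally show ?thesis .
qed

lemma dp_mv_congruence:
  fixes P :: "nat \<Rightarrow> nat \<Rightarrow> 'a::comm_ring_1"
  assumes "\<And>i j. i < n \<Longrightarrow> j < n \<Longrightarrow> (\<Sum>k<n. \<Sum>l<n. P k i * S k l * P l j) = L i j"
  shows "dp n (mv n P a) (mv n S (mv n P b)) = dp n a (mv n L b)"
proof -
  have "dp n a (mv n L b) = (\<Sum>j<n. \<Sum>k<n. a j * (P k j * mv n S (mv n P b) k))"
    unfolding dp_def
    by (intro sum.cong refl) (simp add: mv_congruence_transpose[of n P S L, OF assms] sum_distrib_left)
  also have "\<dots> = (\<Sum>k<n. \<Sum>j<n. a j * (P k j * mv n S (mv n P b) k))" by (rule sum.swap)
  also have "\<dots> = dp n (mv n P a) (mv n S (mv n P b))"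
    unfolding dp_def mv_def[of n P a] sum_distrib_right by (intro sum.cong refl) (simp add: mult_ac)
  finally show ?thesis by simp
qed

section \<open>Pencils and chains in arbitrary coordinates\<close>

lemma const_poly_mult: "[:a:] * [:b:] = [:a * b:]" for a b :: complex
  by simp

lemma mv_pencil_const: "mv n (pencil A B) (cvec z) i = [:mv n A z i, - mv n B z i:]"
proof -
  have "mv n (pencil A B) (cvec z) i = (\<Sum>j<n. [:A i j * z j:] + [:0, 1:] * [:- (B i j * z j):])"
    unfolding mv_def pencil_def by (intro sum.cong refl) (simp add: mult_ac)
  also have "\<dots> = [:mv n A z i, - mv n B z i:]"
    unfolding sum.distrib sum_distrib_left[symmetric] sum_const_poly mv_def by (simp add: sum_negf)
  finally show ?thesis .
qed

lemma pencil_congruence: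
  assumes "(\<Sum>k<n. \<Sum>l<n. P k i * A k l * P l j) = C i j" "(\<Sum>k<n. \<Sum>l<n. P k i * B k l * P l j) = D i j"
  shows "(\<Sum>k<n. \<Sum>l<n. cmatp P k i * pencil A B k l * cmatp P l j) = pencil C D i j"
proof -
  have "(\<Sum>k<n. \<Sum>l<n. cmatp P k i * pencil A B k l * cmatp P l j) =
      (\<Sum>k<n. \<Sum>l<n. [:P k i * A k l * P l j:] + [:0, -1:] * [:P k i * B k l * P l j:])"
    unfolding pencil_def by (intro sum.cong refl) (simp add: mult_ac)
  also have "\<dots> = [:\<Sum>k<n. \<Sum>l<n. P k i * A k l * P l j:] + [:0, -1:] * [:\<Sum>k<n. \<Sum>l<n. P k i * B k l * P l j:]"
    unfolding sum.distrib sum_distrib_left[symmetric] sum_const_poly ..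
  finally show ?thesis unfolding assms by (simp add: pencil_def)
qed

text \<open>\<open>E\<close> and \<open>F\<close>, divided by \<open>(X - e)^m\<close>, solve the
  pencil for the constant covectors \<open>u\<close> and \<open>v\<close>;
  \<open>u \<bullet> F = 1\<close> says that the \<open>(u, v)\<close> entry of the inverse is
  \<open>(X - e)^(-m)\<close>. For skew forms the last condition is the derivative of that entry
  with respect to \<open>X\<close>.\<close>

definition chain_pair ::
  "nat \<Rightarrow> cmat \<Rightarrow> cmat \<Rightarrow> complex \<Rightarrow> nat \<Rightarrow> (nat \<Rightarrow> complex poly) \<Rightarrow> (nat \<Rightarrow> complex poly) \<Rightarrow>
    (nat \<Rightarrow> complex) \<Rightarrow> (nat \<Rightarrow> complex) \<Rightarrow> bool" where
  "chain_pair n A B e m E F u v \<longleftrightarrow>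
    (\<forall>i<n. mv n (pencil A B) E i = [:- e, 1:] ^ m * [:u i:]) \<and>
    (\<forall>i<n. mv n (pencil A B) F i = [:- e, 1:] ^ m * [:v i:]) \<and>
    dp n (cvec u) F = 1 \<and> dp n E (mv n (cmatp B) F) = of_nat m * [:- e, 1:] ^ (m - 1)"

lemma mv_dsum_chain:
  assumes "m \<ge> 1" "bs = bs1 @ Jor (Some e) m # bs2" "i < total_size bs"
  shows "mv (total_size bs) (dsum_of block_pencil bs) (embed (total_size bs1) (2 * m) (chain_upper m e)) i =
      [:- e, 1:] ^ m * [:embed (total_size bs1) (2 * m) (\<lambda>i. if i = m then 1 else 0) i:]"
    "mv (total_size bs) (dsum_of block_pencil bs) (embed (total_size bs1) (2 * m) (chain_lower m e)) i =
      [:- e, 1:] ^ m * [:embed (total_size bs1) (2 * m) (\<lambda>i. if i = m - 1 then - 1 else 0) i:]"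
proof -
  note em = mv_dsum_embed[of i bs1 "Jor (Some e) m" bs2 block_pencil, folded assms(2), OF assms(3)]
  have sz: "block_size (Jor (Some e) m) = 2 * m" by simp
  show "mv (total_size bs) (dsum_of block_pencil bs) (embed (total_size bs1) (2 * m) (chain_upper m e)) i =
      [:- e, 1:] ^ m * [:embed (total_size bs1) (2 * m) (\<lambda>i. if i = m then 1 else 0) i:]"
    using em mv_chain_upper[OF assms(1), of "i - total_size bs1" e] unfolding sz
    by (auto simp: embed_def one_pCons)
  show "mv (total_size bs) (dsum_of block_pencil bs) (embed (total_size bs1) (2 * m) (chain_lower m e)) i =
      [:- e, 1:] ^ m * [:embed (total_size bs1) (2 * m) (\<lambda>i. if i = m - 1 then - 1 else 0) i:]"
    using em mv_chain_lower[OF assms(1), of "i - total_size bs1" e] unfolding sz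
    by (auto simp: embed_def one_pCons)
qed

lemma cvec_embed: "cvec (embed k s u) = embed k s (cvec u)"
  by (auto simp: embed_def fun_eq_iff)

lemma dp_embed_disjoint:
  "k + s \<le> l \<or> l + t \<le> k \<Longrightarrow> dp n (embed k s u) (embed l t v) = 0"
  unfolding dp_def by (intro sum.neutral) (auto simp: embed_def)

text \<open>Each of the \<open>m\<close> positions contributes a product of complementary powers of
  \<open>X - e\<close>. The factor \<open>m\<close>, nonzero in characteristic 0, is what the final
  contradiction rests on.\<close>

lemma dp_chain_snd:
  assumes "bs = bs1 @ Jor (Some e) m # bs2"
  shows "dp (total_size bs) (embed (total_size bs1) (2 * m) (chain_upper m e))
     (mv (total_size bs) (dsum_of block_snd bs) (embed (total_size bs1) (2 * m) (chain_lower m e))) =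
     of_nat m * [:- e, 1:] ^ (m - 1)"
proof -
  have le: "total_size bs1 + 2 * m \<le> total_size bs" using assms by simp
  have "dp (total_size bs) (embed (total_size bs1) (2 * m) (chain_upper m e))
     (mv (total_size bs) (dsum_of block_snd bs) (embed (total_size bs1) (2 * m) (chain_lower m e))) =
     (\<Sum>i<2 * m. chain_upper m e i * (if i < m then [:- e, 1:] ^ i else 0))"
    unfolding dp_embed[OF le]
  proof (intro sum.cong refl)
    fix i assume i: "i \<in> {..<2 * m}"
    have "total_size bs1 + i < total_size bs" using i le by simp
    note em = mv_dsum_embed[of "total_size bs1 + i" bs1 "Jor (Some e) m" bs2 block_snd, folded assms, OF this]
    show "chain_upper m e i * mv (total_size bs) (dsum_of block_snd bs) (embed (total_size bs1) (2 * m) (chain_lower m e)) (total_size bs1 + i) =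
      chain_upper m e i * (if i < m then [:- e, 1:] ^ i else 0)"
      using em mv_snd_chain_lower[of i e m] i by (simp add: embed_def)
  qed
  also have "\<dots> = (\<Sum>i<m. [:- e, 1:] ^ (m - 1 - i) * [:- e, 1:] ^ i)"
    unfolding mult_2 sum_lessThan_add by (simp add: chain_upper_def)
  also have "\<dots> = (\<Sum>i<m. [:- e, 1:] ^ (m - 1))"
    by (intro sum.cong refl) (simp flip: power_add)
  finally show ?thesis by simp
qed

text \<open>All use of canonical bases is confined to this lemma. It exports coordinate-free facts:
  a common kernel vector, solvability once poles are cleared, an additional kernel vector of
  \<open>B\<close> when infinity is an eigenvalue, and chains for finite blocks. Two equal blocks
  give chains with disjoint supports, whence the vanishing cross products.\<close>

lemma jk_structure:
  assumes jk: "has_jk_type n A B {#1#} T"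
  obtains bs z where
    "jordan_tuples bs = T" "\<And>e m. Jor e m \<in> set bs \<Longrightarrow> m \<ge> 1"
    "\<exists>i<n. z i \<noteq> 0" "\<And>i. i < n \<Longrightarrow> mv n A z i = 0" "\<And>i. i < n \<Longrightarrow> mv n B z i = 0"
    "\<And>M w. (\<And>e m. Jor (Some e) m \<in> set bs \<Longrightarrow> [:- e, 1:] ^ m dvd M) \<Longrightarrow> dp n (cvec z) w = 0 \<Longrightarrow>
      \<exists>x. \<forall>i<n. mv n (pencil A B) x i = M * w i"
    "\<And>m. Jor None m \<in> set bs \<Longrightarrow> \<exists>x. (\<forall>i<n. mv n (cmatp B) x i = 0) \<and> (\<exists>i<n. mv n (pencil A B) x i \<noteq> 0)"
    "\<And>e m. Jor (Some e) m \<in> set bs \<Longrightarrow> \<exists>E F u v. chain_pair n A B e m E F u v"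
    "\<And>bs1 bs2 bs3 e m. bs = bs1 @ Jor (Some e) m # bs2 @ Jor (Some e) m # bs3 \<Longrightarrow>
      \<exists>E F u v E' F' u' v'. chain_pair n A B e m E F u v \<and> chain_pair n A B e m E' F' u' v' \<and>
        dp n (cvec v') E = 0 \<and> dp n (cvec u) E' = 0 \<and> dp n (cvec v') F = 0 \<and> dp n (cvec v) E' = 0"
proof -
  from jk obtain bs where bs: "\<And>b. b \<in> set bs \<Longrightarrow> block_valid b" "total_size bs = n"
    "congruent_pair n A B (fst (canon_pair bs)) (snd (canon_pair bs))" "kron_sizes bs = {#1#}" "jordan_tuples bs = T"
    unfolding has_jk_type_def by blast
  from bs(3) obtain P Q where
    PQ: "\<And>i j. i < n \<Longrightarrow> j < n \<Longrightarrow> (\<Sum>k<n. P i k * Q k j) = (if i = j then 1 else 0)"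
    and QP: "\<And>i j. i < n \<Longrightarrow> j < n \<Longrightarrow> (\<Sum>k<n. Q i k * P k j) = (if i = j then 1 else 0)"
    and PA: "\<And>i j. i < n \<Longrightarrow> j < n \<Longrightarrow> (\<Sum>k<n. \<Sum>l<n. P k i * A k l * P l j) = fst (canon_pair bs) i j"
    and PB: "\<And>i j. i < n \<Longrightarrow> j < n \<Longrightarrow> (\<Sum>k<n. \<Sum>l<n. P k i * B k l * P l j) = snd (canon_pair bs) i j"
    unfolding congruent_pair_def
  proof (elim exE conjE, goal_cases)
    case (1 P Q)
    show ?case by (rule 1(1)[of P Q]) (simp_all only: 1(2-5))
  qed
  define L where "L = dsum_of block_pencil bs"
  define D where "D = dsum_of block_snd bs"
  let ?P = "cmatp P" and ?Q = "cmatp Q"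
  have PQ': "(\<Sum>k<n. ?P i k * ?Q k j) = (if i = j then 1 else 0)" if "i < n" "j < n" for i j
    unfolding const_poly_mult sum_const_poly PQ[OF that] by (simp add: one_pCons)
  have QP': "(\<Sum>k<n. ?Q i k * ?P k j) = (if i = j then 1 else 0)" if "i < n" "j < n" for i j
    unfolding const_poly_mult sum_const_poly QP[OF that] by (simp add: one_pCons)
  have L: "(\<Sum>k<n. \<Sum>l<n. ?P k i * pencil A B k l * ?P l j) = L i j" if "i < n" "j < n" for i j
    unfolding L_def pencil_canon_pair[symmetric] by (rule pencil_congruence, rule PA[OF that], rule PB[OF that])
  have D: "(\<Sum>k<n. \<Sum>l<n. ?P k i * cmatp B k l * ?P l j) = D i j" if "i < n" "j < n" for i j
    unfolding D_def cmatp_canon_pair[symmetric] const_poly_mult sum_const_poly PB[OF that] ..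
  have T1: "mv n (pencil A B) (mv n ?P x) i = (\<Sum>j<n. ?Q j i * mv n L x j)" if "i < n" for x i
    using L PQ' that by (rule mv_congruence)
  have T1D: "mv n (cmatp B) (mv n ?P x) i = (\<Sum>j<n. ?Q j i * mv n D x j)" if "i < n" for x i
    using D PQ' that by (rule mv_congruence)
  have T2: "dp n (\<lambda>i. \<Sum>j<n. ?Q j i * u j) (mv n ?P x) = dp n u x" for u x
    using QP' by (rule dp_congruence)
  have T3: "dp n (mv n ?P a) (mv n (cmatp B) (mv n ?P b)) = dp n a (mv n D b)" for a b
    using D by (rule dp_mv_congruence)
  obtain j0 where j0: "j0 < n" "\<And>j. j < n \<Longrightarrow> null_column bs j \<longleftrightarrow> j = j0"
    using unique_null_column[OF bs(4)] bs(2) by auto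
  define z where "z = (\<lambda>i. P i j0)"
  have z0: "mv n (pencil A B) (cvec z) i = 0" if i: "i < n" for i
  proof -
    have "mv n ?P (\<lambda>j. if j = j0 then 1 else 0) k = cvec z k" for k
      using j0(1) by (simp add: mv_def z_def if_distrib sum.delta cong: if_cong)
    then have "cvec z = mv n ?P (\<lambda>j. if j = j0 then 1 else 0)" by auto
    moreover have "mv n L (\<lambda>j. if j = j0 then 1 else 0) k = 0" if "k < n" for k
    proof -
      have "null_column bs j0" using j0 by simp
      then have "L k j0 = 0" using that bs(2) unfolding null_column_def L_def by auto
      then show ?thesis using j0(1) by (simp add: mv_def if_distrib sum.delta cong: if_cong)
    qed
    ultimately show ?thesis using T1[OF i] by simp
  qed
  define tq :: "(nat \<Rightarrow> complex) \<Rightarrow> nat \<Rightarrow> complex" where "tq = (\<lambda>u i. \<Sum>j<n. Q j i * u j)"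
  have tq: "cvec (tq u) = (\<lambda>i. \<Sum>j<n. ?Q j i * cvec u j)" for u
    by (auto simp: tq_def sum_const_poly mult.commute)
  let ?E = "\<lambda>bs1 e m. mv n ?P (embed (total_size bs1) (2 * m) (chain_upper m e))"
  let ?F = "\<lambda>bs1 e m. mv n ?P (embed (total_size bs1) (2 * m) (chain_lower m e))"
  let ?u = "\<lambda>bs1 m. tq (embed (total_size bs1) (2 * m) (\<lambda>i. if i = m then 1 else 0))"
  let ?v = "\<lambda>bs1 m. tq (embed (total_size bs1) (2 * m) (\<lambda>i. if i = m - 1 then - 1 else 0))"
  have chain: "chain_pair n A B e m (?E bs1 e m) (?F bs1 e m) (?u bs1 m) (?v bs1 m)"
    if split: "bs = bs1 @ Jor (Some e) m # bs2" for bs1 bs2 e m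
  proof -
    have m: "m \<ge> 1" using bs(1)[of "Jor (Some e) m"] split by simp
    note C = mv_dsum_chain[OF m split, folded L_def, unfolded bs(2)]
    have "mv n (pencil A B) (?E bs1 e m) i = [:- e, 1:] ^ m * [:?u bs1 m i:]" if i: "i < n" for i
    proof -
      have "mv n (pencil A B) (?E bs1 e m) i = (\<Sum>j<n. [:- e, 1:] ^ m * (?Q j i * [:embed (total_size bs1) (2 * m) (\<lambda>i. if i = m then 1 else 0) j:]))"
        unfolding T1[OF i] using C(1) by (intro sum.cong refl) (simp only: lessThan_iff mult.left_commute)
      then show ?thesis using fun_cong[OF tq, of _ i] by (simp only: sum_distrib_left)
    qed
    moreover have "mv n (pencil A B) (?F bs1 e m) i = [:- e, 1:] ^ m * [:?v bs1 m i:]" if i: "i < n" for i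
    proof -
      have "mv n (pencil A B) (?F bs1 e m) i = (\<Sum>j<n. [:- e, 1:] ^ m * (?Q j i * [:embed (total_size bs1) (2 * m) (\<lambda>i. if i = m - 1 then - 1 else 0) j:]))"
        unfolding T1[OF i] using C(2) by (intro sum.cong refl) (simp only: lessThan_iff mult.left_commute)
      then show ?thesis using fun_cong[OF tq, of _ i] by (simp only: sum_distrib_left)
    qed
    moreover have "dp n (cvec (?u bs1 m)) (?F bs1 e m) = 1"
    proof -
      have le: "total_size bs1 + 2 * m \<le> n" unfolding bs(2)[symmetric] split by simp
      have "dp n (cvec (?u bs1 m)) (?F bs1 e m) =
        dp n (embed (total_size bs1) (2 * m) (cvec (\<lambda>i. if i = m then 1 else 0))) (embed (total_size bs1) (2 * m) (chain_lower m e))"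
        unfolding tq T2 cvec_embed ..
      also have "\<dots> = (\<Sum>i<2 * m. if i = m then chain_lower m e m else 0)"
        unfolding dp_embed[OF le] by (intro sum.cong refl) (auto simp: embed_def one_pCons)
      also have "\<dots> = 1" using m by (simp add: chain_lower_def)
      finally show ?thesis .
    qed
    moreover have "dp n (?E bs1 e m) (mv n (cmatp B) (?F bs1 e m)) = of_nat m * [:- e, 1:] ^ (m - 1)"
      using dp_chain_snd[OF split] unfolding T3 bs(2) D_def .
    ultimately show ?thesis unfolding chain_pair_def by blast
  qed
  have cross: "dp n (cvec (tq (embed k s u))) (mv n ?P (embed l t x)) = 0" if "k + s \<le> l \<or> l + t \<le> k" for k l s t u x
    unfolding tq T2 cvec_embed by (rule dp_embed_disjoint[OF that])
  show thesis
  proof (rule that[of bs z])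
    show "jordan_tuples bs = T" by fact
    show "m \<ge> 1" if "Jor e m \<in> set bs" for e m using bs(1)[OF that] by simp
    show "\<exists>i<n. z i \<noteq> 0"
    proof (rule ccontr)
      assume "\<not> ?thesis"
      then have "(\<Sum>k<n. Q j0 k * P k j0) = 0" by (simp add: z_def)
      then show False using QP[OF j0(1) j0(1)] by simp
    qed
    show "mv n A z i = 0" "mv n B z i = 0" if "i < n" for i
      using z0[OF that] unfolding mv_pencil_const by simp_all
    show "\<exists>x. \<forall>i<n. mv n (pencil A B) x i = M * w i"
      if M: "\<And>e m. Jor (Some e) m \<in> set bs \<Longrightarrow> [:- e, 1:] ^ m dvd M" and w: "dp n (cvec z) w = 0" for M w
    proof -
      have k1: "k = 1" if "Kron k \<in> set bs" for k
      proof -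
        have "k \<in># kron_sizes bs" using that unfolding kron_sizes_def by (force split: jk_block.splits)
        then show ?thesis using bs(4) by simp
      qed
      have "\<exists>x. \<forall>i<n. mv n L x i = M * (\<Sum>k<n. ?P k i * w k)"
        unfolding L_def bs(2)[symmetric]
      proof (rule dsum_pencil_solvable)
        fix j assume "j < total_size bs" "null_column bs j"
        then have "j = j0" using j0 bs(2) by auto
        then show "(\<Sum>k<total_size bs. ?P k j * w k) = 0" using w bs(2) by (simp add: dp_def z_def)
      qed (use k1 M in auto)
      then obtain x where x: "\<And>i. i < n \<Longrightarrow> mv n L x i = M * (\<Sum>k<n. ?P k i * w k)" by blast
      have "mv n (pencil A B) (mv n ?P x) i = M * w i" if i: "i < n" for i
      proof -
        have "mv n (pencil A B) (mv n ?P x) i = (\<Sum>j<n. M * (?Q j i * (\<Sum>k<n. ?P k j * w k)))"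
          unfolding T1[OF i] using x by (intro sum.cong refl) (simp only: lessThan_iff mult.left_commute)
        also have "\<dots> = M * w i"
          unfolding sum_distrib_left[symmetric] by (subst sum_delta_product[of n ?P ?Q, OF PQ' i]) simp_all
        finally show ?thesis .
      qed
      then show ?thesis by blast
    qed
    show "\<exists>x. (\<forall>i<n. mv n (cmatp B) x i = 0) \<and> (\<exists>i<n. mv n (pencil A B) x i \<noteq> 0)"
      if J: "Jor None m \<in> set bs" for m
    proof -
      have m: "m \<ge> 1" using bs(1)[OF J] by simp
      from J obtain bs1 bs2 where split: "bs = bs1 @ Jor None m # bs2" by (auto simp: in_set_conv_decomp)
      have sz: "block_size (Jor None m) = m + m" by simp
      \<comment> \<open>The first basis vector of the lower half: the nilpotent corner of the second
        form kills it, while the unit diagonal of the pencil gives 1 in row 0.\<close>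
      let ?t = "\<lambda>i. if i = m then 1 else 0 :: complex poly"
      let ?x = "embed (total_size bs1) (m + m) ?t"
      have "mv (m + m) (block_snd (Jor None m)) ?t i = 0" if "i < m + m" for i
        unfolding block_snd_None mv_skew_of[OF that]
        using sum_bidiag_row[of i m "0::complex poly" 1 "\<lambda>q. ?t (m + q)"] by auto
      then have "mv n D ?x i = 0" if "i < n" for i
        using mv_dsum_embed[of i bs1 "Jor None m" bs2 block_snd ?t] that
        unfolding sz D_def split[symmetric] bs(2) by (auto simp: embed_def)
      then have "mv n (cmatp B) (mv n ?P ?x) i = 0" if "i < n" for i
        using T1D[OF that] by simp
      moreover have "\<exists>i<n. mv n (pencil A B) (mv n ?P ?x) i \<noteq> 0"
      proof (rule ccontr)
        assume "\<not> ?thesis"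
        moreover have lt: "total_size bs1 < n" unfolding bs(2)[symmetric] split using m by simp
        ultimately have "mv n L ?x (total_size bs1) = 0"
          using mv_congruence_transpose[of n ?P "pencil A B" L, OF L lt] by simp
        moreover have "mv n L ?x (total_size bs1) = mv (m + m) (block_pencil (Jor None m)) ?t 0"
          using mv_dsum_embed[of "total_size bs1" bs1 "Jor None m" bs2 block_pencil ?t] lt m
          unfolding sz L_def split[symmetric] bs(2) by (simp add: embed_def)
        moreover have "mv (m + m) (block_pencil (Jor None m)) ?t 0 = 1"
          unfolding block_pencil_None
          using sum_bidiag_row[of 0 m "1::complex poly" "[:0, -1:]" "\<lambda>q. ?t (m + q)"] m
          by (simp add: mv_skew_of)
        ultimately show False by simp
      qed
      ultimately show ?thesis by blast
    qed
    show "\<exists>E F u v. chain_pair n A B e m E F u v" if J: "Jor (Some e) m \<in> set bs" for e m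
    proof -
      from J obtain bs1 bs2 where "bs = bs1 @ Jor (Some e) m # bs2" by (auto simp: in_set_conv_decomp)
      from chain[OF this] show ?thesis by blast
    qed
    show "\<exists>E F u v E' F' u' v'. chain_pair n A B e m E F u v \<and> chain_pair n A B e m E' F' u' v' \<and>
        dp n (cvec v') E = 0 \<and> dp n (cvec u) E' = 0 \<and> dp n (cvec v') F = 0 \<and> dp n (cvec v) E' = 0"
      if split: "bs = bs1 @ Jor (Some e) m # bs2 @ Jor (Some e) m # bs3" for bs1 bs2 bs3 e m
    proof -
      define bs1' where "bs1' = bs1 @ Jor (Some e) m # bs2"
      have le: "total_size bs1 + 2 * m \<le> total_size bs1'" by (simp add: bs1'_def)
      have "chain_pair n A B e m (?E bs1 e m) (?F bs1 e m) (?u bs1 m) (?v bs1 m)"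
        by (rule chain[OF split])
      moreover have "chain_pair n A B e m (?E bs1' e m) (?F bs1' e m) (?u bs1' m) (?v bs1' m)"
        by (rule chain[of _ _ _ bs3]) (simp add: split bs1'_def)
      moreover have
        "dp n (cvec (?v bs1' m)) (?E bs1 e m) = 0" "dp n (cvec (?u bs1 m)) (?E bs1' e m) = 0"
        "dp n (cvec (?v bs1' m)) (?F bs1 e m) = 0" "dp n (cvec (?v bs1 m)) (?E bs1' e m) = 0"
        by (rule cross; use le in simp)+
      ultimately show ?thesis by blast
    qed
  qed
qed

section \<open>Pairs with a one-dimensional common kernel\<close>

lemma set_jordan_eigs: "set (jordan_eigs bs) = {e. \<exists>m. Jor e m \<in> set bs}"
  unfolding jordan_eigs_def by (force split: jk_block.splits)

lemma count_jordan_tuple: "count (jordan_tuple bs e) m = count_list bs (Jor e m)"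
  unfolding jordan_tuple_def by (induction bs) (auto split: jk_block.splits)

lemma set_mset_jordan_tuple: "set_mset (jordan_tuple bs e) = {m. Jor e m \<in> set bs}"
  by (simp add: set_eq_iff count_jordan_tuple flip: count_greater_zero_iff)
    (simp add: count_list_0_iff flip: neq0_conv)

lemma split_twice_of_count_list:
  assumes "count_list xs x \<ge> 2"
  obtains ys zs ws where "xs = ys @ x # zs @ x # ws"
proof -
  obtain n where "count_list xs x = 2 + n" using le_Suc_ex[OF assms] by blast
  then have "count_list xs x = Suc (Suc n)" by simp
  from count_list_Suc_split_first[OF this] obtain ys r where r: "xs = ys @ x # r" "count_list r x = Suc n"
    by blast
  from count_list_Suc_split_first[OF r(2)] obtain zs ws where "r = zs @ x # ws"
    by blast
  with r(1) show ?thesis using that[of ys zs ws] by simp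
qed

text \<open>Adding \<open>q q\<^sup>T\<close> with \<open>q \<bullet> z = 1\<close> makes a pencil whose common kernel is spanned by \<open>z\<close> invertible away
  from its eigenvalues, without changing its inverse on the annihilator of \<open>z\<close>.\<close>

definition bordered :: "nat \<Rightarrow> cmat \<Rightarrow> cmat \<Rightarrow> (nat \<Rightarrow> complex) \<Rightarrow> nat \<Rightarrow> nat \<Rightarrow> complex poly" where
  "bordered n A B q i j = pencil A B i j + [:q i * q j:]"

lemma mv_bordered: "mv n (bordered n A B q) x i = mv n (pencil A B) x i + [:q i:] * dp n (cvec q) x"
proof -
  have "mv n (bordered n A B q) x i = (\<Sum>j<n. pencil A B i j * x j + [:q i:] * ([:q j:] * x j))"
    unfolding mv_def bordered_def
    by (intro sum.cong refl) (simp only: distrib_right const_poly_mult[symmetric] mult.assoc)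
  then show ?thesis unfolding mv_def dp_def sum.distrib sum_distrib_left .
qed

definition border_chain ::
  "nat \<Rightarrow> cmat \<Rightarrow> cmat \<Rightarrow> (nat \<Rightarrow> complex) \<Rightarrow> (nat \<Rightarrow> complex) \<Rightarrow> complex \<Rightarrow> nat \<Rightarrow> (nat \<Rightarrow> complex poly) \<Rightarrow>
    (nat \<Rightarrow> complex poly) \<Rightarrow> (nat \<Rightarrow> complex) \<Rightarrow> (nat \<Rightarrow> complex) \<Rightarrow> bool" where
  "border_chain n A B q z e m E F u v \<longleftrightarrow> chain_pair n A B e m E F u v \<and>
    dp n (cvec q) E = 0 \<and> dp n (cvec q) F = 0 \<and> dp n (cvec z) (cvec u) = 0 \<and> dp n (cvec z) (cvec v) = 0"

text \<open>The four vanishing products, together with \<open>u \<bullet> F = 1\<close> and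
  \<open>u' \<bullet> F' = 1\<close>, make the leading form at the pole two orthogonal hyperbolic
  planes on \<open>u, v, u', v'\<close>, so its rank is at least 4.\<close>

definition double_chain ::
  "nat \<Rightarrow> cmat \<Rightarrow> cmat \<Rightarrow> (nat \<Rightarrow> complex) \<Rightarrow> (nat \<Rightarrow> complex) \<Rightarrow> complex \<Rightarrow> nat \<Rightarrow> bool" where
  "double_chain n A B q z e m \<longleftrightarrow> (\<exists>E F u v E' F' u' v'.
     border_chain n A B q z e m E F u v \<and> border_chain n A B q z e m E' F' u' v' \<and>
     dp n (cvec v') E = 0 \<and> dp n (cvec u) E' = 0 \<and> dp n (cvec v') F = 0 \<and> dp n (cvec v) E' = 0)"

locale skew_pair =
  fixes n :: nat and A B :: cmat and q z :: "nat \<Rightarrow> complex"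
  assumes skewA: "\<And>i j. i < n \<Longrightarrow> j < n \<Longrightarrow> A i j = - A j i"
    and skewB: "\<And>i j. i < n \<Longrightarrow> j < n \<Longrightarrow> B i j = - B j i"
    and kerA: "\<And>i. i < n \<Longrightarrow> mv n A z i = 0"
    and kerB: "\<And>i. i < n \<Longrightarrow> mv n B z i = 0"
    and qz: "dp n q z = 1"
begin

lemma skew_pencil: "i < n \<Longrightarrow> j < n \<Longrightarrow> pencil A B i j = - pencil A B j i"
  using skewA[of i j] skewB[of i j] by (simp add: pencil_def)

lemma mv_pencil_z: "i < n \<Longrightarrow> mv n (pencil A B) (cvec z) i = 0"
  by (simp add: mv_pencil_const kerA kerB)

lemma mv_pencil_shift: "i < n \<Longrightarrow> mv n (pencil A B) (\<lambda>i. x i - c * [:z i:]) i = mv n (pencil A B) x i"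
  by (simp only: mv_diff mv_scale mv_pencil_z) simp

lemma dp_z_pencil: "dp n (cvec z) (mv n (pencil A B) x) = 0"
proof -
  have "dp n (cvec z) (mv n (pencil A B) x) = - dp n (mv n (pencil A B) (cvec z)) x"
    by (rule dp_mv_skew) (rule skew_pencil)
  then show ?thesis by (simp add: dp_def mv_pencil_z)
qed

lemma dp_qz: "dp n (cvec q) (cvec z) = 1"
  by (simp add: dp_const qz one_pCons)

text \<open>A skew form takes values in the annihilator of its kernel, and the power of
  \<open>X - e\<close> cancels. So \<open>u\<close> and \<open>v\<close>, read as directions in
  which \<open>x\<close> may move, are tangent to the slice.\<close>

lemma chain_covector_z:
  assumes "\<And>i. i < n \<Longrightarrow> mv n (pencil A B) E i = [:- e, 1:] ^ m * [:u i:]"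
  shows "dp n (cvec z) (cvec u) = 0"
proof -
  have "[:- e, 1:] ^ m * dp n (cvec z) (cvec u) = dp n (cvec z) (mv n (pencil A B) E)"
    unfolding dp_scale_right[symmetric] by (rule dp_cong) (simp_all only: assms)
  then show ?thesis by (simp add: dp_z_pencil)
qed

text \<open>Projection along \<open>z\<close> onto the hyperplane where \<open>q\<close> vanishes.
  There the border term disappears, so chains of the pencil are chains of the bordered matrix as
  well.\<close>

definition border_shift :: "(nat \<Rightarrow> complex poly) \<Rightarrow> nat \<Rightarrow> complex poly" where
  "border_shift x = (\<lambda>i. x i - dp n (cvec q) x * [:z i:])"

lemma dp_border_shift:
  assumes "dp n (cvec z) (cvec u) = 0"
  shows "dp n (cvec u) (border_shift x) = dp n (cvec u) x"
  using assms unfolding border_shift_def dp_diff_right dp_scale_right by (simp add: dp_commute)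

lemma dp_q_border_shift: "dp n (cvec q) (border_shift x) = 0"
  unfolding border_shift_def dp_diff_right dp_scale_right dp_qz by simp

lemma mv_border_shift: "i < n \<Longrightarrow> mv n (pencil A B) (border_shift x) i = mv n (pencil A B) x i"
  unfolding border_shift_def by (rule mv_pencil_shift)

lemma mv_B_z: "i < n \<Longrightarrow> mv n (cmatp B) (cvec z) i = 0"
  by (simp add: mv_const kerB)

lemma dp_B_border_shift:
  "dp n (border_shift x) (mv n (cmatp B) (border_shift y)) = dp n x (mv n (cmatp B) y)"
proof -
  have sk: "cmatp B i j = - cmatp B j i" if "i < n" "j < n" for i j
    using skewB[OF that] by simp
  have "mv n (cmatp B) (border_shift y) i = mv n (cmatp B) y i" if "i < n" for i
    unfolding border_shift_def mv_diff mv_scale by (simp only: mv_B_z[OF that]) simp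
  then have "dp n (border_shift x) (mv n (cmatp B) (border_shift y)) = dp n (border_shift x) (mv n (cmatp B) y)"
    by (intro dp_cong) auto
  also have "\<dots> = dp n (mv n (cmatp B) y) x - dp n (cvec q) x * dp n (cvec z) (mv n (cmatp B) y)"
    unfolding dp_commute[of n "border_shift x"] unfolding border_shift_def dp_diff_right dp_scale_right
    by (simp add: dp_commute)
  also have "dp n (cvec z) (mv n (cmatp B) y) = - dp n (mv n (cmatp B) (cvec z)) y"
    using sk by (rule dp_mv_skew)
  also have "dp n (mv n (cmatp B) (cvec z)) y = 0"
    by (simp add: dp_def mv_B_z)
  finally show ?thesis by (simp add: dp_commute)
qed

lemma border_chain_shift:
  assumes "chain_pair n A B e m E F u v"
  shows "border_chain n A B q z e m (border_shift E) (border_shift F) u v"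
proof -
  have u: "dp n (cvec z) (cvec u) = 0" and v: "dp n (cvec z) (cvec v) = 0"
  proof -
    from assms have "\<And>i. i < n \<Longrightarrow> mv n (pencil A B) E i = [:- e, 1:] ^ m * [:u i:]"
      "\<And>i. i < n \<Longrightarrow> mv n (pencil A B) F i = [:- e, 1:] ^ m * [:v i:]"
      unfolding chain_pair_def by blast+
    then show "dp n (cvec z) (cvec u) = 0" "dp n (cvec z) (cvec v) = 0"
      by (blast intro: chain_covector_z)+
  qed
  show ?thesis
    using assms u v unfolding border_chain_def chain_pair_def
    by (simp add: mv_border_shift dp_q_border_shift dp_border_shift dp_B_border_shift)
qed

lemma border_chain_exists:
  "chain_pair n A B e m E F u v \<Longrightarrow> \<exists>E F u v. border_chain n A B q z e m E F u v"
  using border_chain_shift by blast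

lemma double_chain_exists:
  assumes "chain_pair n A B e m E F u v" "chain_pair n A B e m E' F' u' v'"
    "dp n (cvec v') E = 0" "dp n (cvec u) E' = 0" "dp n (cvec v') F = 0" "dp n (cvec v) E' = 0"
  shows "double_chain n A B q z e m"
proof -
  have "border_chain n A B q z e m (border_shift E) (border_shift F) u v"
    "border_chain n A B q z e m (border_shift E') (border_shift F') u' v'"
    by (rule border_chain_shift, fact)+
  moreover from this have "dp n (cvec z) (cvec u) = 0" "dp n (cvec z) (cvec v) = 0" "dp n (cvec z) (cvec v') = 0"
    by (simp_all add: border_chain_def)
  then have "dp n (cvec v') (border_shift E) = 0" "dp n (cvec u) (border_shift E') = 0"
    "dp n (cvec v') (border_shift F) = 0" "dp n (cvec v) (border_shift E') = 0"
    using assms(3-6) by (simp_all add: dp_border_shift)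
  ultimately show ?thesis unfolding double_chain_def by blast
qed

text \<open>Split \<open>w\<close> into a covector annihilating \<open>z\<close> and a multiple of
  \<open>q\<close>. The first part is solved by the pencil, the second by \<open>z\<close>, which
  the bordered matrix sends to \<open>q\<close>.\<close>

lemma bordered_solvable:
  assumes "\<And>w. dp n (cvec z) w = 0 \<Longrightarrow> \<exists>x. \<forall>i<n. mv n (pencil A B) x i = M * w i"
  shows "\<exists>x. \<forall>i<n. mv n (bordered n A B q) x i = M * w i"
proof -
  define \<alpha> where "\<alpha> = dp n (cvec z) w"
  have "dp n (cvec z) (\<lambda>i. w i - \<alpha> * [:q i:]) = 0"
    unfolding dp_diff_right dp_scale_right using dp_qz by (simp add: \<alpha>_def dp_commute)
  then obtain y where y: "\<And>i. i < n \<Longrightarrow> mv n (pencil A B) y i = M * (w i - \<alpha> * [:q i:])"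
    using assms by blast
  define x where "x = (\<lambda>i. y i - (dp n (cvec q) y - M * \<alpha>) * [:z i:])"
  have "dp n (cvec q) x = M * \<alpha>"
    unfolding x_def dp_diff_right dp_scale_right dp_qz by simp
  then have "mv n (bordered n A B q) x i = M * w i" if "i < n" for i
    unfolding mv_bordered x_def mv_pencil_shift[OF that] y[OF that] by (simp add: algebra_simps)
  then show ?thesis by blast
qed

text \<open>Clearing the pole at an eigenvalue costs only the power given by its largest block. This
  is why the sum of the maxima over \<open>T\<close> is the invariant to be followed, besides the
  number of eigenvalues.\<close>

lemma jk_regular_data:
  assumes jk: "has_jk_type n A B {#1#} T"
    and ker: "\<And>x. (\<And>i. i < n \<Longrightarrow> mv n B x i = 0) \<Longrightarrow> \<exists>t. \<forall>i<n. x i = t * z i"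
  obtains Eig nm where
    "finite Eig" "card Eig = size T" "(\<Sum>e\<in>Eig. nm e) = (\<Sum>t\<in>#T. Max (set_mset t))"
    "\<And>e. e \<in> Eig \<Longrightarrow> nm e \<ge> 1"
    "\<And>w. \<exists>x. \<forall>i<n. mv n (bordered n A B q) x i = (\<Prod>e\<in>Eig. [:- e, 1:] ^ nm e) * w i"
    "\<And>e. e \<in> Eig \<Longrightarrow> \<exists>E F u v. border_chain n A B q z e (nm e) E F u v"
    "size (filter_mset multiple_maxima T) \<ge> 2 \<Longrightarrow>
      \<exists>e1\<in>Eig. \<exists>e2\<in>Eig. e1 \<noteq> e2 \<and> double_chain n A B q z e1 (nm e1) \<and> double_chain n A B q z e2 (nm e2)"
proof -
  obtain bs z' where T: "jordan_tuples bs = T"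
    and valid: "\<And>e m. Jor e m \<in> set bs \<Longrightarrow> m \<ge> 1"
    and B0: "\<And>i. i < n \<Longrightarrow> mv n B z' i = 0"
    and solve: "\<And>M w. (\<And>e m. Jor (Some e) m \<in> set bs \<Longrightarrow> [:- e, 1:] ^ m dvd M) \<Longrightarrow> dp n (cvec z') w = 0 \<Longrightarrow>
      \<exists>x. \<forall>i<n. mv n (pencil A B) x i = M * w i"
    and none: "\<And>m. Jor None m \<in> set bs \<Longrightarrow> \<exists>x. (\<forall>i<n. mv n (cmatp B) x i = 0) \<and> (\<exists>i<n. mv n (pencil A B) x i \<noteq> 0)"
    and chain: "\<And>e m. Jor (Some e) m \<in> set bs \<Longrightarrow> \<exists>E F u v. chain_pair n A B e m E F u v"
    and two: "\<And>bs1 bs2 bs3 e m. bs = bs1 @ Jor (Some e) m # bs2 @ Jor (Some e) m # bs3 \<Longrightarrow>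
      \<exists>E F u v E' F' u' v'. chain_pair n A B e m E F u v \<and> chain_pair n A B e m E' F' u' v' \<and>
        dp n (cvec v') E = 0 \<and> dp n (cvec u) E' = 0 \<and> dp n (cvec v') F = 0 \<and> dp n (cvec v) E' = 0"
    by (rule jk_structure[OF jk]) blast
  \<comment> \<open>A block at infinity yields a polynomial vector killed by \<open>B\<close>. Each
    of its values is a multiple of \<open>z\<close>, hence killed by the whole pencil, against the
    choice of the vector.\<close>
  have no_inf: "Jor None m \<notin> set bs" for m
  proof
    assume "Jor None m \<in> set bs"
    from none[OF this] obtain x i where x: "\<And>i. i < n \<Longrightarrow> mv n (cmatp B) x i = 0"
      and i: "i < n" "mv n (pencil A B) x i \<noteq> 0" by blast
    have "poly (mv n (pencil A B) x i) a = 0" for a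
    proof -
      have "mv n B (\<lambda>j. poly (x j) a) i = 0" if "i < n" for i
        using arg_cong[OF x[OF that], of "\<lambda>p. poly p a"] by (simp add: poly_mv)
      then obtain t where t: "\<And>i. i < n \<Longrightarrow> poly (x i) a = t * z i" using ker by blast
      have "poly (mv n (pencil A B) x i) a = mv n (\<lambda>i j. poly (pencil A B i j) a) (\<lambda>j. t * z j) i"
        unfolding poly_mv by (rule mv_cong) (use i t in auto)
      also have "\<dots> = t * poly (mv n (pencil A B) (cvec z) i) a"
        unfolding mv_scale poly_mv by simp
      finally show ?thesis using i(1) by (simp add: mv_pencil_z)
    qed
    then have "mv n (pencil A B) x i = 0" using poly_all_0_iff_0 by blast
    with i show False by simp
  qed
  define Eig where "Eig = {e. \<exists>m. Jor (Some e) m \<in> set bs}"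
  define nm where "nm = (\<lambda>e. Max (set_mset (jordan_tuple bs (Some e))))"
  have eigs: "set (jordan_eigs bs) = Some ` Eig"
    unfolding set_jordan_eigs Eig_def using no_inf by (auto intro: not_None_eq[THEN iffD1] simp: image_iff) (metis not_None_eq)
  have fin: "finite Eig"
    using finite_imageD[of Some Eig] eigs by (metis List.finite_set inj_Some inj_on_subset subset_UNIV)
  have dist: "distinct (jordan_eigs bs)" by (simp add: jordan_eigs_def)
  have mem: "m \<in># jordan_tuple bs (Some e) \<longleftrightarrow> Jor (Some e) m \<in> set bs" for e m
    using set_mset_jordan_tuple[of bs "Some e"] by auto
  have nm_mem: "Jor (Some e) (nm e) \<in> set bs" if "e \<in> Eig" for e
  proof -
    have "set_mset (jordan_tuple bs (Some e)) \<noteq> {}"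
      using that by (auto simp: Eig_def set_mset_jordan_tuple)
    then have "nm e \<in># jordan_tuple bs (Some e)"
      unfolding nm_def by (intro Max_in) auto
    then show ?thesis by (simp add: mem)
  qed
  have nm_ge: "m \<le> nm e" if "Jor (Some e) m \<in> set bs" for e m
    unfolding nm_def using that by (intro Max_ge) (auto simp: mem)
  obtain t where t: "\<And>i. i < n \<Longrightarrow> z' i = t * z i" using ker B0 by blast
  show thesis
  proof (rule that[of Eig nm])
    show "finite Eig" by fact
    have "size T = card (set (jordan_eigs bs))"
      unfolding T[symmetric] jordan_tuples_def by (simp add: distinct_card[OF dist])
    then show "card Eig = size T" by (simp add: eigs card_image)
    have "(\<Sum>t\<in>#T. Max (set_mset t)) = (\<Sum>e\<leftarrow>jordan_eigs bs. Max (set_mset (jordan_tuple bs e)))"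
      unfolding T[symmetric] jordan_tuples_def by (simp add: comp_def flip: sum_mset_sum_list mset_map)
    also have "\<dots> = (\<Sum>e\<in>Some ` Eig. Max (set_mset (jordan_tuple bs e)))"
      using dist by (simp add: sum_list_distinct_conv_sum_set eigs)
    also have "\<dots> = (\<Sum>e\<in>Eig. nm e)" by (simp add: sum.reindex nm_def)
    finally show "(\<Sum>e\<in>Eig. nm e) = (\<Sum>t\<in>#T. Max (set_mset t))" by simp
    show "nm e \<ge> 1" if "e \<in> Eig" for e using valid nm_mem[OF that] by blast
    show "\<exists>x. \<forall>i<n. mv n (bordered n A B q) x i = (\<Prod>e\<in>Eig. [:- e, 1:] ^ nm e) * w i" for w
    proof (rule bordered_solvable, rule solve)
      fix e m assume *: "Jor (Some e) m \<in> set bs"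
      then have "[:- e, 1:] ^ m dvd [:- e, 1:] ^ nm e" by (intro le_imp_power_dvd nm_ge)
      also have "\<dots> dvd (\<Prod>e\<in>Eig. [:- e, 1:] ^ nm e)"
        using * fin by (intro dvd_prodI) (auto simp: Eig_def)
      finally show "[:- e, 1:] ^ m dvd (\<Prod>e\<in>Eig. [:- e, 1:] ^ nm e)" .
    next
      fix w :: "nat \<Rightarrow> complex poly" assume w: "dp n (cvec z) w = 0"
      have "dp n (cvec z') w = [:t:] * dp n (cvec z) w"
        unfolding dp_def sum_distrib_left by (intro sum.cong refl) (simp add: t mult.commute)
      then show "dp n (cvec z') w = 0" using w by simp
    qed
    show "\<exists>E F u v. border_chain n A B q z e (nm e) E F u v" if "e \<in> Eig" for e
      using chain[OF nm_mem[OF that]] border_chain_exists by blast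
    assume two_max: "size (filter_mset multiple_maxima T) \<ge> 2"
    \<comment> \<open>\<open>jordan_eigs\<close> has no repetitions, so counting tuples with
      multiplicity in \<open>T\<close> is the same as counting eigenvalues, and two such tuples give
      two distinct eigenvalues.\<close>
    define G where "G = {e \<in> Eig. multiple_maxima (jordan_tuple bs (Some e))}"
    have "size (filter_mset multiple_maxima T) =
        length (filter (\<lambda>e. multiple_maxima (jordan_tuple bs e)) (jordan_eigs bs))"
      unfolding T[symmetric] jordan_tuples_def mset_filter[symmetric] filter_map
        size_mset length_map comp_def ..
    also have "\<dots> = card (set (filter (\<lambda>e. multiple_maxima (jordan_tuple bs e)) (jordan_eigs bs)))"
      by (rule distinct_card[OF distinct_filter[OF dist], symmetric])
    also have "set (filter (\<lambda>e. multiple_maxima (jordan_tuple bs e)) (jordan_eigs bs)) = Some ` G"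
      unfolding set_filter eigs G_def by auto
    also have "card (Some ` G) = card G" by (simp add: card_image)
    finally have "\<not> card G \<le> Suc 0" using two_max by simp
    then obtain e1 e2 where e: "e1 \<in> G" "e2 \<in> G" "e1 \<noteq> e2"
      using card_le_Suc0_iff_eq[of G] fin by (auto simp: G_def)
    have "double_chain n A B q z e (nm e)" if "e \<in> G" for e
    proof -
      have "count_list bs (Jor (Some e) (nm e)) \<ge> 2"
        using that unfolding G_def multiple_maxima_def by (simp add: nm_def count_jordan_tuple)
      then obtain bs1 bs2 bs3 where "bs = bs1 @ Jor (Some e) (nm e) # bs2 @ Jor (Some e) (nm e) # bs3"
        by (rule split_twice_of_count_list)
      from two[OF this] show ?thesis using double_chain_exists by blast
    qed
    with e show "\<exists>e1\<in>Eig. \<exists>e2\<in>Eig. e1 \<noteq> e2 \<and> double_chain n A B q z e1 (nm e1) \<and> double_chain n A B q z e2 (nm e2)"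
      unfolding G_def by blast
  qed
qed

end

lemma border_chain_mv:
  assumes "border_chain n A B q z e m E F u v" "i < n"
  shows "mv n (bordered n A B q) E i = [:- e, 1:] ^ m * [:u i:]"
    "mv n (bordered n A B q) F i = [:- e, 1:] ^ m * [:v i:]"
  using assms unfolding mv_bordered border_chain_def chain_pair_def by auto

section \<open>Determinants, adjugates and pole orders\<close>

lemma sum_order_eq_degree:
  fixes p :: "complex poly"
  assumes "p \<noteq> 0"
  shows "(\<Sum>x | poly p x = 0. Polynomial.order x p) = degree p"
proof -
  have "set_mset (proots p) = {x. poly p x = 0}"
    using assms by (simp add: set_eq_iff order_root flip: count_greater_zero_iff)
  then show ?thesis
    unfolding size_proots_complex[symmetric] size_multiset_overloaded_eq using assms by simp
qed

lemma pconv_degree_le: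
  assumes "pconv D p" "p \<noteq> 0"
  shows "\<forall>\<^sub>F k in sequentially. degree p \<le> degree (D k)"
proof -
  have "coeff p (degree p) \<noteq> 0" using assms(2) by simp
  from tendsto_imp_eventually_ne[OF pconv_coeff[OF assms(1)] this]
  show ?thesis by eventually_elim (rule le_degree)
qed

text \<open>The roots and pole orders are matched by counting: near every root of the limit there is a root
  of the perturbed polynomial, and the number of roots, the total multiplicity and the total pole
  order do not change.\<close>

lemma root_matching:
  fixes D :: "nat \<Rightarrow> complex poly" and a :: "nat \<Rightarrow> 'i \<Rightarrow> complex poly" and nm :: "nat \<Rightarrow> complex \<Rightarrow> nat"
  assumes D: "pconv D D0" and a: "\<And>i. i \<in> I \<Longrightarrow> pconv (\<lambda>k. a k i) (a_lim i)"
    and D0: "D0 \<noteq> 0" and Dk: "\<And>k. D k \<noteq> 0" and I: "finite I"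
    and card: "\<And>k. card {x. poly (D k) x = 0} = card {x. poly D0 x = 0}"
    and sum_nm: "\<And>k. (\<Sum>x | poly (D k) x = 0. nm k x) = (\<Sum>x | poly D0 x = 0. nm0 x)"
    and pole: "\<And>k x i. poly (D k) x = 0 \<Longrightarrow> i \<in> I \<Longrightarrow> [:- x, 1:] ^ (Polynomial.order x (D k) - nm k x) dvd a k i"
    and pole0: "\<And>x r. poly D0 x = 0 \<Longrightarrow> (\<And>i. i \<in> I \<Longrightarrow> [:- x, 1:] ^ (Polynomial.order x D0 - r) dvd a_lim i) \<Longrightarrow> nm0 x \<le> r"
    and x0: "poly D0 x0 = 0"
  shows "\<exists>e. e \<longlonglongrightarrow> x0 \<and> (\<forall>\<^sub>F k in sequentially. [:- e k, 1:] ^ Polynomial.order x0 D0 dvd D k \<and>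
    (\<forall>i\<in>I. [:- e k, 1:] ^ (Polynomial.order x0 D0 - nm0 x0) dvd a k i))"
proof -
  define R where "R = (\<lambda>k. {x. poly (D k) x = 0})"
  define R0 where "R0 = {x. poly D0 x = 0}"
  have fin: "finite (R k)" "finite R0" for k
    unfolding R_def R0_def using poly_roots_finite[OF Dk] poly_roots_finite[OF D0] by auto
  have cardR: "card (R k) = card R0" for k unfolding R_def R0_def by (rule card)
  have x0R: "x0 \<in> R0" using x0 by (simp add: R0_def)
  have ne: "R k \<noteq> {}" for k
  proof
    assume "R k = {}"
    then have "card R0 = 0" using cardR[of k] by simp
    then show False using fin(2) x0R by auto
  qed
  \<comment> \<open>The root of \<open>D k\<close> nearest to \<open>x\<close>. Different limits
    make \<open>b k\<close> eventually injective on \<open>R0\<close>, and equal cardinalities then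
    make it a bijection.\<close>
  define b where "b = (\<lambda>k x. arg_min_on (\<lambda>y. dist y x) (R k))"
  have bR: "b k x \<in> R k" for k x unfolding b_def by (rule arg_min_if_finite(1)[OF fin(1) ne])
  have blim: "(\<lambda>k. b k x) \<longlonglongrightarrow> x" if "x \<in> R0" for x
    unfolding tendsto_iff
  proof (intro allI impI)
    fix r :: real assume "r > 0"
    have "poly D0 x = 0" using that by (simp add: R0_def)
    from eventually_root_near[OF D D0 this \<open>r > 0\<close>]
    show "\<forall>\<^sub>F k in sequentially. dist (b k x) x < r"
    proof eventually_elim
      case (elim k)
      then obtain y where "y \<in> R k" "dist y x < r" by (auto simp: R_def)
      then show ?case using arg_min_least[OF fin(1) ne, of y k "\<lambda>y. dist y x"] by (simp add: b_def)
    qed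
  qed
  have "\<forall>\<^sub>F k in sequentially. \<forall>x\<in>R0. \<forall>y\<in>R0. x \<noteq> y \<longrightarrow> b k x \<noteq> b k y"
  proof (intro eventually_ball_finite fin ballI)
    fix x y assume xy: "x \<in> R0" "y \<in> R0"
    show "\<forall>\<^sub>F k in sequentially. x \<noteq> y \<longrightarrow> b k x \<noteq> b k y"
    proof (cases "x = y")
      case False
      have "(\<lambda>k. b k x - b k y) \<longlonglongrightarrow> x - y" by (intro tendsto_diff blim xy)
      from tendsto_imp_eventually_ne[OF this, of 0] show ?thesis using False by simp
    qed simp
  qed
  then have bij: "\<forall>\<^sub>F k in sequentially. bij_betw (b k) R0 (R k)"
  proof eventually_elim
    case (elim k)
    then have inj: "inj_on (b k) R0" by (auto simp: inj_on_def)
    have "b k ` R0 = R k"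
      using bR by (intro card_subset_eq fin) (auto simp: card_image[OF inj] cardR)
    with inj show ?case by (simp add: bij_betw_def)
  qed
  let ?m = "\<lambda>k x. Polynomial.order (b k x) (D k)" and ?l = "\<lambda>x. Polynomial.order x D0"
  have "\<forall>\<^sub>F k in sequentially. \<forall>x\<in>R0. ?m k x \<le> ?l x"
  proof (intro eventually_ball_finite fin ballI, rule ccontr)
    fix x assume x: "x \<in> R0" and "\<not> (\<forall>\<^sub>F k in sequentially. ?m k x \<le> ?l x)"
    then have "\<exists>\<^sub>F k in sequentially. \<not> ?m k x \<le> ?l x" by (simp add: not_eventually)
    then have "\<exists>\<^sub>F k in sequentially. [:- b k x, 1:] ^ Suc (?l x) dvd D k"
      by (rule frequently_elim1) (simp add: order_divides del: power_Suc)
    from pconv_dvd_frequently[OF D blim[OF x] this] show False using order_2[OF D0] by blast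
  qed
  \<comment> \<open>No multiplicity exceeds its limit, while their sum, the degree, is not below the
    limit degree; hence all multiplicities agree.\<close>
  from this bij pconv_degree_le[OF D D0]
  have m_eq: "\<forall>\<^sub>F k in sequentially. \<forall>x\<in>R0. ?m k x = ?l x"
  proof eventually_elim
    case (elim k)
    have "(\<Sum>x\<in>R0. ?m k x) = (\<Sum>x\<in>R k. Polynomial.order x (D k))"
      by (rule sum.reindex_bij_betw[OF elim(2)])
    also have "\<dots> = degree (D k)" unfolding R_def by (rule sum_order_eq_degree[OF Dk])
    finally have "(\<Sum>x\<in>R0. ?l x) \<le> (\<Sum>x\<in>R0. ?m k x)"
      using elim(3) sum_order_eq_degree[OF D0] by (simp add: R0_def)
    moreover have "(\<Sum>x\<in>R0. ?m k x) \<le> (\<Sum>x\<in>R0. ?l x)" using elim(1) by (intro sum_mono) auto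
    ultimately have "(\<Sum>x\<in>R0. ?m k x) = (\<Sum>x\<in>R0. ?l x)" by simp
    from sum_mono_inv[OF this _ _ fin(2)] elim(1) show ?case by auto
  qed
  have "\<forall>\<^sub>F k in sequentially. \<forall>x\<in>R0. nm0 x \<le> nm k (b k x)"
  proof (intro eventually_ball_finite fin ballI, rule ccontr)
    fix x assume x: "x \<in> R0" and "\<not> (\<forall>\<^sub>F k in sequentially. nm0 x \<le> nm k (b k x))"
    then have fr: "\<exists>\<^sub>F k in sequentially. nm k (b k x) < nm0 x" by (simp add: not_eventually not_le)
    from m_eq have m_eq': "\<forall>\<^sub>F k in sequentially. ?m k x = ?l x"
      by eventually_elim (use x in auto)
    \<comment> \<open>A pole order below \<open>nm0 x\<close> for infinitely many \<open>k\<close>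
      would make the limit adjugate divisible as if the pole order were at most
      \<open>nm0 x - 1\<close>, against minimality of \<open>nm0 x\<close>.\<close>
    have "nm0 x \<le> nm0 x - 1"
    proof (rule pole0)
      show "poly D0 x = 0" using x by (simp add: R0_def)
      fix i assume i: "i \<in> I"
      have "\<exists>\<^sub>F k in sequentially. nm k (b k x) < nm0 x \<and> ?m k x = ?l x"
        by (rule frequently_eventually_frequently[OF fr m_eq'])
      then have "\<exists>\<^sub>F k in sequentially. [:- b k x, 1:] ^ (?l x - (nm0 x - 1)) dvd a k i"
      proof (rule frequently_elim1)
        fix k assume k: "nm k (b k x) < nm0 x \<and> ?m k x = ?l x"
        have "poly (D k) (b k x) = 0" using bR[of k x] by (simp add: R_def)
        from pole[OF this i] have "[:- b k x, 1:] ^ (?m k x - nm k (b k x)) dvd a k i" .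
        moreover have "?l x - (nm0 x - 1) \<le> ?l x - nm k (b k x)"
          by (rule diff_le_mono2) (use k in linarith)
        then have "?l x - (nm0 x - 1) \<le> ?m k x - nm k (b k x)" using k by (simp only:)
        ultimately show "[:- b k x, 1:] ^ (?l x - (nm0 x - 1)) dvd a k i"
          using le_imp_power_dvd dvd_trans by blast
      qed
      from pconv_dvd_frequently[OF a[OF i] blim[OF x] this]
      show "[:- x, 1:] ^ (?l x - (nm0 x - 1)) dvd a_lim i" .
    qed
    then have "nm0 x = 0" by simp
    with fr show False by simp
  qed
  from this bij have nm_eq: "\<forall>\<^sub>F k in sequentially. \<forall>x\<in>R0. nm0 x = nm k (b k x)"
  proof eventually_elim
    case (elim k)
    have "(\<Sum>x\<in>R0. nm0 x) = (\<Sum>x\<in>R k. nm k x)" using sum_nm[of k] by (simp add: R_def R0_def)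
    also have "\<dots> = (\<Sum>x\<in>R0. nm k (b k x))" by (rule sum.reindex_bij_betw[OF elim(2), symmetric])
    finally have "(\<Sum>x\<in>R0. nm0 x) = (\<Sum>x\<in>R0. nm k (b k x))" .
    from sum_mono_inv[OF this _ _ fin(2)] elim(1) show ?case by auto
  qed
  from m_eq nm_eq have "\<forall>\<^sub>F k in sequentially. [:- b k x0, 1:] ^ ?l x0 dvd D k \<and>
    (\<forall>i\<in>I. [:- b k x0, 1:] ^ (?l x0 - nm0 x0) dvd a k i)"
  proof eventually_elim
    case (elim k)
    have "poly (D k) (b k x0) = 0" using bR[of k x0] by (simp add: R_def)
    from pole[OF this] show ?case using elim x0R order_1[of "b k x0" "D k"] by auto
  qed
  with blim[OF x0R] show ?thesis by blast
qed

section \<open>Determinant and adjugate of a matrix given as a function\<close>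

definition det_of :: "nat \<Rightarrow> (nat \<Rightarrow> nat \<Rightarrow> 'a::comm_ring_1) \<Rightarrow> 'a" where
  "det_of n S = det (mat n n (\<lambda>(i,j). S i j))"

definition adj_of :: "nat \<Rightarrow> (nat \<Rightarrow> nat \<Rightarrow> 'a::comm_ring_1) \<Rightarrow> nat \<Rightarrow> nat \<Rightarrow> 'a" where
  "adj_of n S i j = adj_mat (mat n n (\<lambda>(i,j). S i j)) $$ (i,j)"

lemma mat_times_entry:
  assumes "i < n" "j < n" "A \<in> carrier_mat n n" "B \<in> carrier_mat n n"
  shows "(A * B) $$ (i,j) = (\<Sum>k<n. A $$ (i,k) * B $$ (k,j))"
  using assms by (auto simp: times_mat_def scalar_prod_def atLeast0LessThan intro!: sum.cong)

lemma adj_of_mult: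
  assumes "i < n" "j < n"
  shows "(\<Sum>k<n. S i k * adj_of n S k j) = (if i = j then det_of n S else 0)"
    "(\<Sum>k<n. adj_of n S i k * S k j) = (if i = j then det_of n S else 0)"
proof -
  let ?S = "mat n n (\<lambda>(i,j). S i j)"
  have S: "?S \<in> carrier_mat n n" by simp
  have "(?S * adj_mat ?S) $$ (i,j) = (if i = j then det_of n S else 0)"
    unfolding adj_mat(2)[OF S] using assms by (simp add: det_of_def)
  moreover have "(?S * adj_mat ?S) $$ (i,j) = (\<Sum>k<n. S i k * adj_of n S k j)"
    unfolding mat_times_entry[OF assms S adj_mat(1)[OF S]] adj_of_def using assms by (intro sum.cong) auto
  ultimately show "(\<Sum>k<n. S i k * adj_of n S k j) = (if i = j then det_of n S else 0)" by simp
  have "(adj_mat ?S * ?S) $$ (i,j) = (if i = j then det_of n S else 0)"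
    unfolding adj_mat(3)[OF S] using assms by (simp add: det_of_def)
  moreover have "(adj_mat ?S * ?S) $$ (i,j) = (\<Sum>k<n. adj_of n S i k * S k j)"
    unfolding mat_times_entry[OF assms adj_mat(1)[OF S] S] adj_of_def using assms by (intro sum.cong) auto
  ultimately show "(\<Sum>k<n. adj_of n S i k * S k j) = (if i = j then det_of n S else 0)" by simp
qed

lemma mv_mv_scalar:
  fixes S T :: "nat \<Rightarrow> nat \<Rightarrow> 'a::comm_ring_1"
  assumes "\<And>i j. i < n \<Longrightarrow> j < n \<Longrightarrow> (\<Sum>k<n. T i k * S k j) = (if i = j then d else 0)" "i < n"
  shows "mv n T (mv n S x) i = d * x i"
proof -
  have "mv n T (mv n S x) i = (\<Sum>k<n. \<Sum>j<n. T i k * S k j * x j)"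
    unfolding mv_def by (simp add: sum_distrib_left mult.assoc)
  also have "\<dots> = (\<Sum>j<n. (\<Sum>k<n. T i k * S k j) * x j)"
    unfolding sum_distrib_right by (rule sum.swap)
  also have "\<dots> = (\<Sum>j<n. if j = i then d * x j else 0)"
    using assms by (intro sum.cong refl) auto
  also have "\<dots> = d * x i" using assms(2) by simp
  finally show ?thesis .
qed

lemma mv_adj_of: "i < n \<Longrightarrow> mv n (adj_of n S) (mv n S x) i = det_of n S * x i"
  by (rule mv_mv_scalar) (simp_all add: adj_of_mult(2))

lemma pconv_det_of:
  assumes "\<And>i j. i < n \<Longrightarrow> j < n \<Longrightarrow> pconv (\<lambda>k. S k i j) (S0 i j)"
  shows "pconv (\<lambda>k. det_of n (S k)) (det_of n S0)"
  unfolding det_of_def by (rule pconv_det[where n = n]) (simp_all add: assms)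

lemma pconv_adj_of:
  assumes "\<And>i j. i < n \<Longrightarrow> j < n \<Longrightarrow> pconv (\<lambda>k. S k i j) (S0 i j)" "i < n" "j < n"
  shows "pconv (\<lambda>k. adj_of n (S k) i j) (adj_of n S0 i j)"
  unfolding adj_of_def by (rule pconv_adj_mat[where n = n]) (simp_all add: assms)

text \<open>Solvability for every \<open>w\<close> says that \<open>M\<close> times the inverse of
  \<open>S\<close> is polynomial. Multiplying by the adjugate gives the first claim; taking
  determinants of \<open>S X = M\<close> gives the second.\<close>

lemma det_of_dvd_of_solvable:
  assumes sol: "\<And>w. \<exists>x. \<forall>i<n. mv n S x i = M * w i"
  shows "i < n \<Longrightarrow> j < n \<Longrightarrow> det_of n S dvd M * adj_of n S i j" "det_of n S dvd M ^ n"
proof -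
  show "det_of n S dvd M * adj_of n S i j" if ij: "i < n" "j < n"
  proof -
    obtain x where x: "\<And>k. k < n \<Longrightarrow> mv n S x k = M * (if k = j then 1 else 0)"
      using sol[of "\<lambda>k. if k = j then 1 else 0"] by blast
    have "det_of n S * x i = mv n (adj_of n S) (mv n S x) i" using ij by (simp add: mv_adj_of)
    also have "\<dots> = mv n (adj_of n S) (\<lambda>k. M * (if k = j then 1 else 0)) i"
      by (rule mv_cong) (use x ij in auto)
    also have "\<dots> = M * (\<Sum>k<n. if k = j then adj_of n S i k else 0)"
      unfolding mv_scale unfolding mv_def by (intro arg_cong[of _ _ "\<lambda>t. M * t"] sum.cong refl) simp
    also have "\<dots> = M * adj_of n S i j" using ij by simp
    finally show ?thesis by (metis dvd_triv_left)
  qed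
  have "\<exists>x. \<forall>i<n. mv n S x i = M * (if i = j then 1 else 0)" for j by (rule sol)
  then obtain X where X: "\<And>i j. i < n \<Longrightarrow> mv n S (X j) i = M * (if i = j then 1 else 0)" by metis
  let ?S = "mat n n (\<lambda>(i,j). S i j)" and ?X = "mat n n (\<lambda>(i,j). X j i)"
  have SX: "?S * ?X = M \<cdot>\<^sub>m 1\<^sub>m n"
  proof (rule eq_matI)
    fix i j assume ij: "i < dim_row (M \<cdot>\<^sub>m 1\<^sub>m n)" "j < dim_col (M \<cdot>\<^sub>m 1\<^sub>m n)"
    then have "(?S * ?X) $$ (i,j) = mv n S (X j) i"
      by (subst mat_times_entry[of _ n]) (auto simp: mv_def)
    then show "(?S * ?X) $$ (i,j) = (M \<cdot>\<^sub>m 1\<^sub>m n) $$ (i,j)" using ij X by simp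
  qed auto
  have "det ?S * det ?X = det (?S * ?X)" by (rule det_mult[symmetric]) auto
  also have "\<dots> = M ^ n" unfolding SX by simp
  finally show "det_of n S dvd M ^ n" unfolding det_of_def by (metis dvd_triv_left)
qed

lemma order_linear_power_mult:
  fixes p :: "complex poly"
  assumes "[:- e, 1:] ^ m dvd [:- e, 1:] ^ k * g * p" "poly g e \<noteq> 0"
  shows "[:- e, 1:] ^ (m - k) dvd p"
proof (cases "p = 0")
  case False
  have g: "g \<noteq> 0" "Polynomial.order e g = 0" using assms(2) by (auto simp: order_0I)
  have "m \<le> Polynomial.order e ([:- e, 1:] ^ k * g * p)"
    using assms(1) False g by (simp add: order_divides)
  also have "\<dots> = k + Polynomial.order e p"
    using False g by (simp add: order_mult order_power_n_n)
  finally show ?thesis using False by (simp add: order_divides)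
qed simp

text \<open>The last conjunct says that the pole of the inverse at \<open>x\<close> has order exactly \<open>nm x\<close>.\<close>

definition pole_data :: "nat \<Rightarrow> (nat \<Rightarrow> nat \<Rightarrow> complex poly) \<Rightarrow> nat multiset multiset \<Rightarrow> (complex \<Rightarrow> nat) \<Rightarrow> bool" where
  "pole_data n S T nm \<longleftrightarrow> det_of n S \<noteq> 0 \<and> card {x. poly (det_of n S) x = 0} = size T \<and>
    (\<Sum>x | poly (det_of n S) x = 0. nm x) = (\<Sum>t\<in>#T. Max (set_mset t)) \<and>
    (\<forall>x. poly (det_of n S) x = 0 \<longrightarrow> 1 \<le> nm x \<and> nm x \<le> Polynomial.order x (det_of n S) \<and>
      (\<forall>i<n. \<forall>j<n. [:- x, 1:] ^ (Polynomial.order x (det_of n S) - nm x) dvd adj_of n S i j) \<and>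
      (\<forall>r. (\<forall>i<n. \<forall>j<n. [:- x, 1:] ^ (Polynomial.order x (det_of n S) - r) dvd adj_of n S i j) \<longrightarrow> nm x \<le> r))"

context skew_pair
begin

text \<open>\<open>u \<bullet> F = 1\<close> keeps some entry of \<open>F\<close> from vanishing at
  \<open>e\<close>, so the inverse applied to \<open>v\<close> really has a pole of order
  \<open>m\<close>: the lower bound matching the upper bound from solvability.\<close>

lemma border_chain_pole:
  assumes ch: "border_chain n A B q z e m E F u v"
  defines "D \<equiv> det_of n (bordered n A B q)"
  obtains i where "i < n" "poly (F i) e \<noteq> 0"
    "D * F i = [:- e, 1:] ^ m * mv n (adj_of n (bordered n A B q)) (cvec v) i"
proof -
  have "dp n u (\<lambda>i. poly (F i) e) = 1"
  proof -
    have "dp n (cvec u) F = 1" using ch unfolding border_chain_def chain_pair_def by blast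
    from arg_cong[OF this, of "\<lambda>p. poly p e"] show ?thesis by (simp add: poly_dp)
  qed
  then obtain i where i: "i < n" "poly (F i) e \<noteq> 0"
    unfolding dp_def by (metis (no_types, lifting) lessThan_iff mult_zero_right sum.neutral zero_neq_one)
  have "D * F i = mv n (adj_of n (bordered n A B q)) (mv n (bordered n A B q) F) i"
    unfolding D_def using i by (simp add: mv_adj_of)
  also have "\<dots> = mv n (adj_of n (bordered n A B q)) (\<lambda>i. [:- e, 1:] ^ m * cvec v i) i"
    by (rule mv_cong) (use border_chain_mv[OF ch] i in auto)
  also have "\<dots> = [:- e, 1:] ^ m * mv n (adj_of n (bordered n A B q)) (cvec v) i"
    by (rule mv_scale)
  finally show ?thesis using i that by blast
qed

text \<open>Translates the type into data of the determinant and the adjugate alone. These depend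
  continuously on the pair, unlike canonical bases, and can be compared along a
  perturbation.\<close>

lemma jk_pole_data:
  assumes jk: "has_jk_type n A B {#1#} T"
    and ker: "\<And>x. (\<And>i. i < n \<Longrightarrow> mv n B x i = 0) \<Longrightarrow> \<exists>t. \<forall>i<n. x i = t * z i"
  obtains nm where "pole_data n (bordered n A B q) T nm"
    "size (filter_mset multiple_maxima T) \<ge> 2 \<Longrightarrow>
      \<exists>e1 e2. e1 \<noteq> e2 \<and> poly (det_of n (bordered n A B q)) e1 = 0 \<and> poly (det_of n (bordered n A B q)) e2 = 0 \<and>
        double_chain n A B q z e1 (nm e1) \<and> double_chain n A B q z e2 (nm e2)"
proof -
  obtain Eig nm where fin: "finite Eig" and card: "card Eig = size T"
    and sum: "(\<Sum>e\<in>Eig. nm e) = (\<Sum>t\<in>#T. Max (set_mset t))"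
    and nm1: "\<And>e. e \<in> Eig \<Longrightarrow> nm e \<ge> 1"
    and sol: "\<And>w. \<exists>x. \<forall>i<n. mv n (bordered n A B q) x i = (\<Prod>e\<in>Eig. [:- e, 1:] ^ nm e) * w i"
    and chain: "\<And>e. e \<in> Eig \<Longrightarrow> \<exists>E F u v. border_chain n A B q z e (nm e) E F u v"
    and two: "size (filter_mset multiple_maxima T) \<ge> 2 \<Longrightarrow>
      \<exists>e1\<in>Eig. \<exists>e2\<in>Eig. e1 \<noteq> e2 \<and> double_chain n A B q z e1 (nm e1) \<and> double_chain n A B q z e2 (nm e2)"
    using jk ker
  proof (rule jk_regular_data, goal_cases)
    case 1
    then show ?case by simp
  next
    case prems: 2
    show ?case by (rule prems(1)) (fact prems)+
  qed
  let ?S = "bordered n A B q"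
  define M where "M = (\<Prod>e\<in>Eig. [:- e, 1:] ^ nm e)"
  define D where "D = det_of n ?S"
  have M0: "M \<noteq> 0" unfolding M_def using fin by (simp add: prod_zero_iff)
  note dvd = det_of_dvd_of_solvable[where S = ?S and M = M and n = n, OF sol[folded M_def], folded D_def]
  have D0: "D \<noteq> 0" using dvd(2) M0 by auto
  \<comment> \<open>A root of \<open>D\<close> is a root of \<open>M\<close> since \<open>D\<close>
    divides \<open>M ^ n\<close>. Conversely, at an eigenvalue a chain makes \<open>D * F i\<close>
    vanish with \<open>F i\<close> nonzero there.\<close>
  have roots: "{x. poly D x = 0} = Eig"
  proof (intro equalityI subsetI)
    fix x assume "x \<in> {x. poly D x = 0}"
    then have Dx: "poly D x = 0" by simp
    obtain g where g: "M ^ n = D * g" using dvd(2) by (elim dvdE)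
    have "poly M x ^ n = 0" unfolding poly_power[symmetric] g using Dx by simp
    then have "poly M x = 0" by simp
    then show "x \<in> Eig" unfolding M_def using fin by (auto simp: poly_prod poly_power)
  next
    fix x assume x: "x \<in> Eig"
    from chain[OF x] obtain E F u v where ch: "border_chain n A B q z x (nm x) E F u v" by blast
    from border_chain_pole[OF ch, folded D_def] obtain i where
      i: "poly (F i) x \<noteq> 0" "D * F i = [:- x, 1:] ^ nm x * mv n (adj_of n ?S) (cvec v) i" by blast
    have "poly D x * poly (F i) x = 0"
      using arg_cong[OF i(2), of "\<lambda>p. poly p x"] nm1[OF x] by (simp add: poly_power zero_power)
    then show "x \<in> {x. poly D x = 0}" using i(1) by simp
  qed
  have main: "nm x \<le> Polynomial.order x D \<and>
      (\<forall>i<n. \<forall>j<n. [:- x, 1:] ^ (Polynomial.order x D - nm x) dvd adj_of n ?S i j) \<and>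
      (\<forall>r. (\<forall>i<n. \<forall>j<n. [:- x, 1:] ^ (Polynomial.order x D - r) dvd adj_of n ?S i j) \<longrightarrow> nm x \<le> r)"
    if x: "x \<in> Eig" for x
  proof -
    let ?o = "Polynomial.order x D"
    from chain[OF x] obtain E F u v where ch: "border_chain n A B q z x (nm x) E F u v" by blast
    from border_chain_pole[OF ch, folded D_def] obtain i where
      i: "i < n" "poly (F i) x \<noteq> 0" "D * F i = [:- x, 1:] ^ nm x * mv n (adj_of n ?S) (cvec v) i" by blast
    have F0: "F i \<noteq> 0" using i(2) by auto
    have ordF: "Polynomial.order x (F i) = 0" using i(2) by (rule order_0I)
    have le: "l \<le> ?o" if "[:- x, 1:] ^ l dvd D * F i" for l
      using that D0 F0 ordF by (simp add: order_divides order_mult)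
    have nm_le: "nm x \<le> ?o" by (rule le) (simp only: i(3) dvd_triv_left)
    have "[:- x, 1:] ^ (?o - nm x) dvd adj_of n ?S k j" if kj: "k < n" "j < n" for k j
    proof (rule order_linear_power_mult)
      have "M = [:- x, 1:] ^ nm x * (\<Prod>e\<in>Eig - {x}. [:- e, 1:] ^ nm e)"
        unfolding M_def using fin x by (rule prod.remove)
      then show "[:- x, 1:] ^ ?o dvd [:- x, 1:] ^ nm x * (\<Prod>e\<in>Eig - {x}. [:- e, 1:] ^ nm e) * adj_of n ?S k j"
        using dvd_trans[OF order_1[of x D] dvd(1)[OF kj]] by simp
      show "poly (\<Prod>e\<in>Eig - {x}. [:- e, 1:] ^ nm e) x \<noteq> 0"
        using fin by (simp add: poly_prod poly_power)
    qed
    moreover have "nm x \<le> r" if r: "\<And>k j. k < n \<Longrightarrow> j < n \<Longrightarrow> [:- x, 1:] ^ (?o - r) dvd adj_of n ?S k j" for r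
    proof (rule ccontr)
      assume "\<not> nm x \<le> r"
      have "[:- x, 1:] ^ (?o - r) dvd mv n (adj_of n ?S) (cvec v) i"
        unfolding mv_def using r i(1) by (intro dvd_sum dvd_mult2) auto
      then have "[:- x, 1:] ^ (nm x + (?o - r)) dvd D * F i"
        unfolding i(3) power_add by (intro mult_dvd_mono dvd_refl)
      then have "nm x + (?o - r) \<le> ?o" by (rule le)
      then show False using \<open>\<not> nm x \<le> r\<close> nm_le by linarith
    qed
    ultimately show ?thesis using nm_le by blast
  qed
  show thesis
  proof (rule that[of nm])
    show "pole_data n ?S T nm"
      unfolding pole_data_def D_def[symmetric] roots using D0 card sum
    proof (intro conjI allI impI; (elim exE)?)
      fix x assume "poly D x = 0"
      then have "x \<in> Eig" using roots by blast
      from main[OF this] nm1[OF this] show "1 \<le> nm x" "nm x \<le> Polynomial.order x D"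
        "\<And>i j. i < n \<Longrightarrow> j < n \<Longrightarrow> [:- x, 1:] ^ (Polynomial.order x D - nm x) dvd adj_of n ?S i j"
        "\<And>r. \<forall>i<n. \<forall>j<n. [:- x, 1:] ^ (Polynomial.order x D - r) dvd adj_of n ?S i j \<Longrightarrow> nm x \<le> r"
        by auto
    qed auto
    show "\<exists>e1 e2. e1 \<noteq> e2 \<and> poly (det_of n ?S) e1 = 0 \<and> poly (det_of n ?S) e2 = 0 \<and>
        double_chain n A B q z e1 (nm e1) \<and> double_chain n A B q z e2 (nm e2)"
      if "size (filter_mset multiple_maxima T) \<ge> 2"
      using two[OF that] roots unfolding D_def by blast
  qed
qed

end

section \<open>First-order variation of the inverse under a perturbation\<close>

lemma mv_mult_left: "mv n S (mv n U x) i = (\<Sum>j<n. mv n S (\<lambda>a. U a j) i * x j)"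
proof -
  have "mv n S (mv n U x) i = (\<Sum>a<n. \<Sum>j<n. S i a * U a j * x j)"
    unfolding mv_def by (simp add: sum_distrib_left mult.assoc)
  also have "\<dots> = (\<Sum>j<n. mv n S (\<lambda>a. U a j) i * x j)"
    unfolding mv_def sum_distrib_right by (rule sum.swap)
  finally show ?thesis .
qed

lemma adjoint_quotient:
  fixes S :: "nat \<Rightarrow> nat \<Rightarrow> complex poly"
  assumes d: "det_of n S = [:- x, 1:] ^ m * d"
    and C: "\<And>i j. i < n \<Longrightarrow> j < n \<Longrightarrow> adj_of n S i j = [:- x, 1:] ^ (m - N) * C i j"
    and N: "N \<le> m" and ij: "i < n" "j < n"
  shows "(\<Sum>k<n. S i k * C k j) = (if i = j then [:- x, 1:] ^ N * d else 0)"
    "(\<Sum>k<n. C i k * S k j) = (if i = j then [:- x, 1:] ^ N * d else 0)"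
proof -
  have split: "det_of n S = [:- x, 1:] ^ (m - N) * ([:- x, 1:] ^ N * d)"
    using N by (simp add: d flip: mult.assoc power_add)
  have "[:- x, 1:] ^ (m - N) * (\<Sum>k<n. S i k * C k j) = (\<Sum>k<n. S i k * adj_of n S k j)"
    unfolding sum_distrib_left using C ij by (intro sum.cong refl) (simp add: mult_ac)
  also have "\<dots> = [:- x, 1:] ^ (m - N) * (if i = j then [:- x, 1:] ^ N * d else 0)"
    unfolding adj_of_mult(1)[OF ij] split by simp
  finally show "(\<Sum>k<n. S i k * C k j) = (if i = j then [:- x, 1:] ^ N * d else 0)" by simp
  have "[:- x, 1:] ^ (m - N) * (\<Sum>k<n. C i k * S k j) = (\<Sum>k<n. adj_of n S i k * S k j)"
    unfolding sum_distrib_left using C ij by (intro sum.cong refl) (simp add: mult_ac)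
  also have "\<dots> = [:- x, 1:] ^ (m - N) * (if i = j then [:- x, 1:] ^ N * d else 0)"
    unfolding adj_of_mult(2)[OF ij] split by simp
  finally show "(\<Sum>k<n. C i k * S k j) = (if i = j then [:- x, 1:] ^ N * d else 0)" by simp
qed

text \<open>The derivative of the inverse in the direction \<open>V\<close> is dominated by the
  motion of its pole: \<tau> is minus the pole order times the velocity of the root. It is the same
  for all entries because they share the root.\<close>

lemma perturbed_adjoint_congruence:
  fixes S0 :: "nat \<Rightarrow> nat \<Rightarrow> complex poly" and V :: cmat
  assumes pd0: "pole_data n S0 T nm0" and pd: "\<And>k. pole_data n (\<lambda>i j. S0 i j + [:\<epsilon> k * V i j:]) T (nm k)"
    and \<epsilon>: "\<epsilon> \<longlonglongrightarrow> 0" "\<And>k. \<epsilon> k \<noteq> 0"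
    and x: "poly (det_of n S0) x = 0"
    and d: "det_of n S0 = [:- x, 1:] ^ Polynomial.order x (det_of n S0) * d"
    and C: "\<And>i j. i < n \<Longrightarrow> j < n \<Longrightarrow> adj_of n S0 i j = [:- x, 1:] ^ (Polynomial.order x (det_of n S0) - nm0 x) * C i j"
  shows "\<exists>\<tau>. \<forall>i<n. \<forall>j<n. [:- x, 1:] ^ nm0 x dvd
    mv n C (mv n (cmatp V) (\<lambda>a. C a j)) i - smult \<tau> ([:- x, 1:] ^ (nm0 x - 1) * (d * C i j))"
proof -
  define S where "S = (\<lambda>k i j. S0 i j + [:\<epsilon> k * V i j:])"
  define D0 where "D0 = det_of n S0"
  define m where "m = Polynomial.order x D0"
  define N where "N = nm0 x"
  let ?L = "[:- x, 1:]"
  have pdS: "pole_data n (S k) T (nm k)" for k unfolding S_def by (rule pd)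
  have D0: "D0 \<noteq> 0" using pd0 by (simp add: pole_data_def D0_def)
  have N: "1 \<le> N" "N \<le> m" using pd0 x by (auto simp: pole_data_def N_def m_def D0_def)
  have Sconv: "pconv (\<lambda>k. S k i j) (S0 i j)" for i j
  proof -
    have "pconv (\<lambda>k. S k i j) (S0 i j + [:0 * V i j:])"
      unfolding S_def by (intro pconv_add pconv_const pconv_const_poly tendsto_mult \<epsilon> tendsto_const)
    then show ?thesis by simp
  qed
  have Dconv: "pconv (\<lambda>k. det_of n (S k)) D0" unfolding D0_def by (intro pconv_det_of Sconv)
  have Aconv: "pconv (\<lambda>k. adj_of n (S k) i j) (adj_of n S0 i j)" if "i < n" "j < n" for i j
    by (intro pconv_adj_of Sconv that)
  have "\<exists>e. e \<longlonglongrightarrow> x \<and> (\<forall>\<^sub>F k in sequentially. [:- e k, 1:] ^ m dvd det_of n (S k) \<and>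
    (\<forall>i\<in>{..<n} \<times> {..<n}. [:- e k, 1:] ^ (m - N) dvd (\<lambda>(i,j). adj_of n (S k) i j) i))"
    unfolding m_def N_def
  proof (rule root_matching[where D = "\<lambda>k. det_of n (S k)" and nm = nm
        and a = "\<lambda>k (i,j). adj_of n (S k) i j" and a_lim = "\<lambda>(i,j). adj_of n S0 i j"])
    fix p assume "p \<in> {..<n} \<times> {..<n}"
    then show "pconv (\<lambda>k. (\<lambda>(i,j). adj_of n (S k) i j) p) ((\<lambda>(i,j). adj_of n S0 i j) p)"
      using Aconv by auto
  next
    show "card {x. poly (det_of n (S k)) x = 0} = card {x. poly D0 x = 0}"
      "(\<Sum>x | poly (det_of n (S k)) x = 0. nm k x) = (\<Sum>x | poly D0 x = 0. nm0 x)"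
      "det_of n (S k) \<noteq> 0" for k
      using pdS[of k] pd0 by (simp_all add: pole_data_def D0_def)
  next
    fix k y p assume "poly (det_of n (S k)) y = 0" "p \<in> {..<n} \<times> {..<n}"
    then show "[:- y, 1:] ^ (Polynomial.order y (det_of n (S k)) - nm k y) dvd (\<lambda>(i,j). adj_of n (S k) i j) p"
      using pdS[of k] unfolding pole_data_def by force
  next
    fix y r assume "poly D0 y = 0"
      "\<And>p. p \<in> {..<n} \<times> {..<n} \<Longrightarrow> [:- y, 1:] ^ (Polynomial.order y D0 - r) dvd (\<lambda>(i,j). adj_of n S0 i j) p"
    then show "nm0 y \<le> r" using pd0 unfolding pole_data_def D0_def by fastforce
  qed (use Dconv D0 x in \<open>auto simp: D0_def\<close>)
  then obtain e0 k0 where e0: "e0 \<longlonglongrightarrow> x" and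
    k0: "\<And>k. k \<ge> k0 \<Longrightarrow> [:- e0 k, 1:] ^ m dvd det_of n (S k)"
    "\<And>k i j. k \<ge> k0 \<Longrightarrow> i < n \<Longrightarrow> j < n \<Longrightarrow> [:- e0 k, 1:] ^ (m - N) dvd adj_of n (S k) i j"
    unfolding eventually_sequentially by fastforce
  \<comment> \<open>Passing to a tail makes the factorizations hold for every index, as the drift
    lemmas demand.\<close>
  define s where "s = (\<lambda>k. k + k0)"
  have s: "strict_mono s" by (auto simp: s_def strict_mono_def)
  define e where "e = (\<lambda>k. e0 (s k))"
  have e: "e \<longlonglongrightarrow> x" using LIMSEQ_subseq_LIMSEQ[OF e0 s] by (simp add: e_def comp_def)
  have "\<exists>p. det_of n (S (s k)) = [:- e k, 1:] ^ m * p" for k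
    using k0(1)[of "s k"] by (simp add: e_def s_def dvd_def)
  then obtain dk where dk: "\<And>k. det_of n (S (s k)) = [:- e k, 1:] ^ m * dk k" by metis
  have "\<exists>c. \<forall>i<n. \<forall>j<n. adj_of n (S (s k)) i j = [:- e k, 1:] ^ (m - N) * c i j" for k
  proof -
    have "\<exists>p. adj_of n (S (s k)) i j = [:- e k, 1:] ^ (m - N) * p" if "i < n" "j < n" for i j
      using k0(2)[of "s k", OF _ that] by (simp add: e_def s_def dvd_def)
    then show ?thesis by metis
  qed
  then obtain Ck where Ck: "\<And>k i j. i < n \<Longrightarrow> j < n \<Longrightarrow> adj_of n (S (s k)) i j = [:- e k, 1:] ^ (m - N) * Ck k i j"
    by metis
  have d': "D0 = ?L ^ m * d" using d by (simp add: D0_def m_def)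
  have C': "adj_of n S0 i j = ?L ^ (m - N) * C i j" if "i < n" "j < n" for i j
    using C[OF that] by (simp add: D0_def m_def N_def)
  have d0: "poly d x \<noteq> 0"
  proof
    assume "poly d x = 0"
    then have "?L dvd d" by (simp add: poly_eq_0_iff_dvd)
    then have "?L ^ Suc m dvd D0" unfolding d' by (metis dvd_refl mult_dvd_mono power_Suc2)
    then show False using order_2[OF D0] unfolding m_def by blast
  qed
  have dconv: "pconv dk d"
  proof -
    obtain p where "pconv dk p" "D0 = ?L ^ m * p"
      using pconv_div_power[OF pconv_subseq[OF Dconv s] e dk] by blast
    then show ?thesis using d' by simp
  qed
  have Cconv: "pconv (\<lambda>k. Ck k i j) (C i j)" if ij: "i < n" "j < n" for i j
  proof -
    obtain p where "pconv (\<lambda>k. Ck k i j) p" "adj_of n S0 i j = ?L ^ (m - N) * p"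
      using pconv_div_power[OF pconv_subseq[OF Aconv[OF ij] s] e Ck[OF ij]] by blast
    then show ?thesis using C'[OF ij] by simp
  qed
  have C_S0: "mv n C (mv n S0 y) i = ?L ^ N * d * y i" if i: "i < n" for i y
    by (rule mv_mv_scalar[OF _ i]) (rule adjoint_quotient(2)[OF _ C'], use d' N in \<open>auto simp: D0_def\<close>)
  have Sk_C: "mv n (S (s k)) (\<lambda>a. Ck k a j) i = (if i = j then [:- e k, 1:] ^ N * dk k else 0)"
    if ij: "i < n" "j < n" for i j k
    unfolding mv_def by (rule adjoint_quotient(1)[OF dk Ck]) (use ij N in auto)
  define G where "G = (\<lambda>i j k. mv n C (mv n (cmatp V) (\<lambda>a. Ck k a j)) i)"
  define G0 where "G0 = (\<lambda>i j. mv n C (mv n (cmatp V) (\<lambda>a. C a j)) i)"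
  \<comment> \<open>Resolvent identity: the product of \<open>C\<close>, \<open>S (s k)\<close> and
    \<open>Ck k\<close> is evaluated once by contracting the right pair and once by splitting off
    \<open>S0\<close> and contracting the left pair.\<close>
  have key: "smult (\<epsilon> (s k)) (G i j k) = [:- e k, 1:] ^ N * (dk k * C i j) - ?L ^ N * (d * Ck k i j)"
    if ij: "i < n" "j < n" for i j k
  proof -
    have expand: "mv n (S (s k)) (\<lambda>a. Ck k a j) a = mv n S0 (\<lambda>a. Ck k a j) a + [:\<epsilon> (s k):] * mv n (cmatp V) (\<lambda>a. Ck k a j) a" for a
    proof -
      have "mv n (S (s k)) (\<lambda>a. Ck k a j) a = (\<Sum>b<n. S0 a b * Ck k b j + [:\<epsilon> (s k):] * ([:V a b:] * Ck k b j))"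
        unfolding mv_def S_def
        by (intro sum.cong refl) (simp only: distrib_right const_poly_mult[symmetric] mult.assoc)
      then show ?thesis unfolding mv_def sum.distrib sum_distrib_left .
    qed
    have "mv n C (mv n (S (s k)) (\<lambda>a. Ck k a j)) i = mv n C (\<lambda>a. mv n S0 (\<lambda>a. Ck k a j) a + [:\<epsilon> (s k):] * mv n (cmatp V) (\<lambda>a. Ck k a j) a) i"
      by (rule mv_cong) (simp_all only: expand ij)
    also have "\<dots> = ?L ^ N * d * Ck k i j + [:\<epsilon> (s k):] * G i j k"
      unfolding mv_add mv_scale C_S0[OF ij(1)] G_def ..
    also have "mv n C (mv n (S (s k)) (\<lambda>a. Ck k a j)) i = mv n C (\<lambda>a. [:- e k, 1:] ^ N * dk k * (if a = j then 1 else 0)) i"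
      by (rule mv_cong) (use Sk_C ij in auto)
    also have "\<dots> = [:- e k, 1:] ^ N * dk k * C i j"
    proof -
      have "mv n C (\<lambda>a. if a = j then 1 else 0) i = (\<Sum>a<n. if a = j then C i a else 0)"
        unfolding mv_def by (intro sum.cong refl) simp
      then show ?thesis unfolding mv_scale using ij by simp
    qed
    finally show ?thesis by (simp add: algebra_simps)
  qed
  have Gconv: "pconv (G i j) (G0 i j)" if "i < n" "j < n" for i j
    unfolding G_def G0_def mv_def using that by (intro pconv_sum pconv_mult pconv_const Cconv) auto
  have fconv: "pconv (\<lambda>k. dk k * C i j) (d * C i j)" for i j
    by (intro pconv_mult pconv_const dconv)
  \<comment> \<open>The velocity is read off from an entry that does not vanish at \<open>x\<close>.
    Such an entry exists because the pole order is exactly \<open>N\<close>.\<close>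
  have "\<exists>i<n. \<exists>j<n. poly (C i j) x \<noteq> 0"
  proof (rule ccontr)
    assume no: "\<not> ?thesis"
    have "[:- x, 1:] ^ (m - (N - 1)) dvd adj_of n S0 i j" if ij: "i < n" "j < n" for i j
    proof -
      have "?L dvd C i j" using no ij by (auto simp: poly_eq_0_iff_dvd)
      then have "?L ^ (m - N) * ?L dvd adj_of n S0 i j" unfolding C'[OF ij] by (intro mult_dvd_mono dvd_refl)
      moreover have "m - (N - 1) = Suc (m - N)" using N by simp
      ultimately show ?thesis by (simp only: power_Suc2)
    qed
    then have "N \<le> N - 1"
      using pd0 x unfolding pole_data_def m_def N_def D0_def by blast
    then show False using N by simp
  qed
  then obtain i0 j0 where ij0: "i0 < n" "j0 < n" "poly (C i0 j0) x \<noteq> 0" by blast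
  have "\<exists>\<sigma>. (\<lambda>k. (e k - x) / \<epsilon> (s k)) \<longlonglongrightarrow> \<sigma>"
    by (rule root_drift_converges[OF N(1) \<epsilon>(2) fconv _ Gconv[OF ij0(1,2)] e key[OF ij0(1,2)]])
      (use d0 ij0 in simp)
  then obtain \<sigma> where \<sigma>: "(\<lambda>k. (e k - x) / \<epsilon> (s k)) \<longlonglongrightarrow> \<sigma>" by blast
  have "?L ^ N dvd G0 i j - smult (- of_nat N * \<sigma>) (?L ^ (N - 1) * (d * C i j))" if ij: "i < n" "j < n" for i j
    by (rule root_drift_limit[OF N(1) \<epsilon>(2) fconv Gconv[OF ij] e key[OF ij] \<sigma>])
  then show ?thesis unfolding G0_def N_def by blast
qed

section \<open>The Lie-Poisson pencil\<close>

text \<open>For \<open>R i j l = \<langle>y, [[e_i, e_j], e_l]\<rangle>\<close> this is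
  \<open>\<langle>y, [[\<eta>, \<zeta>], \<xi>]\<rangle>\<close>, the expression to which the Jacobi
  identity applies.\<close>

definition cubic_form :: "nat \<Rightarrow> (nat \<Rightarrow> nat \<Rightarrow> nat \<Rightarrow> 'a::comm_ring_1) \<Rightarrow> (nat \<Rightarrow> 'a) \<Rightarrow> (nat \<Rightarrow> 'a) \<Rightarrow> (nat \<Rightarrow> 'a) \<Rightarrow> 'a" where
  "cubic_form n R \<xi> \<eta> \<zeta> = (\<Sum>l<n. \<Sum>i<n. \<Sum>j<n. \<xi> l * \<eta> i * \<zeta> j * R i j l)"

lemma cubic_form_cyclic:
  fixes R :: "nat \<Rightarrow> nat \<Rightarrow> nat \<Rightarrow> 'a::comm_ring_1"
  assumes "\<And>i j l. i < n \<Longrightarrow> j < n \<Longrightarrow> l < n \<Longrightarrow> R i j l + R j l i + R l i j = 0"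
  shows "cubic_form n R \<xi> \<eta> \<zeta> + cubic_form n R \<eta> \<zeta> \<xi> + cubic_form n R \<zeta> \<xi> \<eta> = 0"
proof -
  have 2: "cubic_form n R \<eta> \<zeta> \<xi> = (\<Sum>l<n. \<Sum>i<n. \<Sum>j<n. \<xi> l * \<eta> i * \<zeta> j * R j l i)"
  proof -
    have "cubic_form n R \<eta> \<zeta> \<xi> = (\<Sum>i<n. \<Sum>j<n. \<Sum>l<n. \<xi> l * \<eta> i * \<zeta> j * R j l i)"
      unfolding cubic_form_def by (intro sum.cong refl) (simp add: mult_ac)
    also have "\<dots> = (\<Sum>i<n. \<Sum>l<n. \<Sum>j<n. \<xi> l * \<eta> i * \<zeta> j * R j l i)"
      by (intro sum.cong refl sum.swap)
    also have "\<dots> = (\<Sum>l<n. \<Sum>i<n. \<Sum>j<n. \<xi> l * \<eta> i * \<zeta> j * R j l i)"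
      by (rule sum.swap)
    finally show ?thesis .
  qed
  have 3: "cubic_form n R \<zeta> \<xi> \<eta> = (\<Sum>l<n. \<Sum>i<n. \<Sum>j<n. \<xi> l * \<eta> i * \<zeta> j * R l i j)"
  proof -
    have "cubic_form n R \<zeta> \<xi> \<eta> = (\<Sum>j<n. \<Sum>l<n. \<Sum>i<n. \<xi> l * \<eta> i * \<zeta> j * R l i j)"
      unfolding cubic_form_def by (intro sum.cong refl) (simp add: mult_ac)
    also have "\<dots> = (\<Sum>l<n. \<Sum>j<n. \<Sum>i<n. \<xi> l * \<eta> i * \<zeta> j * R l i j)"
      by (rule sum.swap)
    also have "\<dots> = (\<Sum>l<n. \<Sum>i<n. \<Sum>j<n. \<xi> l * \<eta> i * \<zeta> j * R l i j)"
      by (intro sum.cong refl sum.swap)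
    finally show ?thesis .
  qed
  have "cubic_form n R \<xi> \<eta> \<zeta> + cubic_form n R \<eta> \<zeta> \<xi> + cubic_form n R \<zeta> \<xi> \<eta> =
      (\<Sum>l<n. \<Sum>i<n. \<Sum>j<n. \<xi> l * \<eta> i * \<zeta> j * (R i j l + R j l i + R l i j))"
    unfolding 2 3 unfolding cubic_form_def by (simp add: distrib_left sum.distrib)
  also have "\<dots> = 0" using assms by (intro sum.neutral ballI) simp
  finally show ?thesis .
qed

lemma lie_form_skew:
  assumes "is_lie_algebra n c" "i < n" "j < n"
  shows "lie_form n c x i j = - lie_form n c x j i"
proof -
  have "x k * c i j k = - (x k * c j i k)" if "k < n" for k
    using assms that unfolding is_lie_algebra_def by (metis mult_minus_right)
  then show ?thesis unfolding lie_form_def by (simp add: sum_negf[symmetric])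
qed

lemma lie_form_add_scale: "lie_form n c (\<lambda>i. x i + t * v i) i j = lie_form n c x i j + t * lie_form n c v i j"
  unfolding lie_form_def by (simp add: distrib_right sum.distrib sum_distrib_left mult.assoc)

lemma mv_add_scale_matrix: "mv n (\<lambda>i j. A i j + t * B i j) x i = mv n A x i + t * mv n B x i"
  unfolding mv_def by (simp add: distrib_right sum.distrib sum_distrib_left mult.assoc)

text \<open>This is the closedness of the form inverse to the Lie-Poisson bivector: the derivative of
  \<open>(v, w) \<mapsto> v \<bullet> A\<^sup>-\<^sup>1 w\<close> in the direction \<open>u\<close> is, up to sign, \<open>\<xi>\<^sub>v \<bullet> A\<^sub>u \<xi>\<^sub>w\<close>.\<close>

lemma lie_form_closed:
  assumes lie: "is_lie_algebra n c"
    and sol: "\<And>k. k < n \<Longrightarrow> mv n (pencil (lie_form n c x) (lie_form n c a)) \<xi> k = f * [:u k:]"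
      "\<And>k. k < n \<Longrightarrow> mv n (pencil (lie_form n c x) (lie_form n c a)) \<eta> k = f * [:v k:]"
      "\<And>k. k < n \<Longrightarrow> mv n (pencil (lie_form n c x) (lie_form n c a)) \<zeta> k = f * [:w k:]"
    and f: "f \<noteq> 0"
  shows "dp n \<eta> (mv n (cmatp (lie_form n c u)) \<zeta>) + dp n \<zeta> (mv n (cmatp (lie_form n c v)) \<xi>) +
    dp n \<xi> (mv n (cmatp (lie_form n c w)) \<eta>) = 0"
proof -
  define y where "y = (\<lambda>p. [:x p, - a p:])"
  define R where "R = (\<lambda>i j l. \<Sum>p<n. y p * (\<Sum>k<n. [:c i j k * c k l p:]))"
  have pencil: "pencil (lie_form n c x) (lie_form n c a) k l = (\<Sum>p<n. y p * [:c k l p:])" for k l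
  proof -
    have "(\<Sum>p<n. y p * [:c k l p:]) = (\<Sum>p<n. [:x p * c k l p:] + [:0, -1:] * [:a p * c k l p:])"
      unfolding y_def by (intro sum.cong refl) (simp add: mult.commute)
    also have "\<dots> = [:lie_form n c x k l:] + [:0, -1:] * [:lie_form n c a k l:]"
      unfolding sum.distrib sum_distrib_left[symmetric] sum_const_poly lie_form_def ..
    finally show ?thesis by (simp add: pencil_def)
  qed
  have summand: "f * dp n \<eta> (mv n (cmatp (lie_form n c u)) \<zeta>) = cubic_form n R \<xi> \<eta> \<zeta>"
    if sol: "\<And>k. k < n \<Longrightarrow> mv n (pencil (lie_form n c x) (lie_form n c a)) \<xi> k = f * [:u k:]" for \<xi> \<eta> \<zeta> u
  proof -
    \<comment> \<open>Replacing \<open>f\<close> times \<open>u\<close> by the pencil applied to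
      \<xi> turns the Lie form at \<open>u\<close> into a double bracket paired with
      \<open>x - X a\<close>.\<close>
    have entry: "f * [:lie_form n c u i j:] = (\<Sum>l<n. \<xi> l * R i j l)" for i j
    proof -
      have "f * [:lie_form n c u i j:] = (\<Sum>k<n. f * [:u k:] * [:c i j k:])"
        unfolding lie_form_def sum_const_poly[symmetric] sum_distrib_left const_poly_mult[symmetric] mult.assoc ..
      also have "\<dots> = (\<Sum>k<n. mv n (pencil (lie_form n c x) (lie_form n c a)) \<xi> k * [:c i j k:])"
        by (intro sum.cong refl) (simp only: sol lessThan_iff)
      also have "\<dots> = (\<Sum>k<n. \<Sum>l<n. \<Sum>p<n. \<xi> l * (y p * [:c i j k * c k l p:]))"
        unfolding mv_def pencil sum_distrib_right
        by (intro sum.cong refl) (simp only: const_poly_mult[symmetric] mult_ac)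
      also have "\<dots> = (\<Sum>l<n. \<Sum>k<n. \<Sum>p<n. \<xi> l * (y p * [:c i j k * c k l p:]))"
        by (rule sum.swap)
      also have "\<dots> = (\<Sum>l<n. \<Sum>p<n. \<Sum>k<n. \<xi> l * (y p * [:c i j k * c k l p:]))"
        by (intro sum.cong refl sum.swap)
      finally show ?thesis unfolding R_def sum_distrib_left .
    qed
    have "f * dp n \<eta> (mv n (cmatp (lie_form n c u)) \<zeta>) = (\<Sum>i<n. \<Sum>j<n. \<eta> i * \<zeta> j * (f * [:lie_form n c u i j:]))"
      unfolding dp_def mv_def sum_distrib_left by (intro sum.cong refl) (simp only: mult_ac)
    also have "\<dots> = (\<Sum>i<n. \<Sum>j<n. \<Sum>l<n. \<xi> l * \<eta> i * \<zeta> j * R i j l)"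
      unfolding entry sum_distrib_left by (intro sum.cong refl) (simp only: mult_ac)
    also have "\<dots> = (\<Sum>i<n. \<Sum>l<n. \<Sum>j<n. \<xi> l * \<eta> i * \<zeta> j * R i j l)"
      by (intro sum.cong refl sum.swap)
    also have "\<dots> = cubic_form n R \<xi> \<eta> \<zeta>"
      unfolding cubic_form_def by (rule sum.swap)
    finally show ?thesis .
  qed
  have jacobi: "R i j l + R j l i + R l i j = 0" if "i < n" "j < n" "l < n" for i j l
  proof -
    have "R i j l + R j l i + R l i j = (\<Sum>p<n. y p * ((\<Sum>k<n. [:c i j k * c k l p:]) +
        (\<Sum>k<n. [:c j l k * c k i p:]) + (\<Sum>k<n. [:c l i k * c k j p:])))"
      unfolding R_def distrib_left sum.distrib ..
    also have "\<dots> = 0"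
    proof (intro sum.neutral ballI)
      fix p assume "p \<in> {..<n}"
      then have "(\<Sum>k<n. c i j k * c k l p + c j l k * c k i p + c l i k * c k j p) = 0"
        using lie that unfolding is_lie_algebra_def by blast
      then show "y p * ((\<Sum>k<n. [:c i j k * c k l p:]) + (\<Sum>k<n. [:c j l k * c k i p:]) +
          (\<Sum>k<n. [:c l i k * c k j p:])) = 0"
        unfolding sum_const_poly sum.distrib by simp
    qed
    finally show ?thesis .
  qed
  have "cubic_form n R \<xi> \<eta> \<zeta> + cubic_form n R \<eta> \<zeta> \<xi> + cubic_form n R \<zeta> \<xi> \<eta> = 0"
    by (rule cubic_form_cyclic) (rule jacobi)
  moreover have "f * dp n \<eta> (mv n (cmatp (lie_form n c u)) \<zeta>) = cubic_form n R \<xi> \<eta> \<zeta>"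
    "f * dp n \<zeta> (mv n (cmatp (lie_form n c v)) \<xi>) = cubic_form n R \<eta> \<zeta> \<xi>"
    "f * dp n \<xi> (mv n (cmatp (lie_form n c w)) \<eta>) = cubic_form n R \<zeta> \<xi> \<eta>"
    by (rule summand, erule sol)+
  ultimately have "f * (dp n \<eta> (mv n (cmatp (lie_form n c u)) \<zeta>) + dp n \<zeta> (mv n (cmatp (lie_form n c v)) \<xi>) +
    dp n \<xi> (mv n (cmatp (lie_form n c w)) \<eta>)) = 0"
    by (simp only: distrib_left)
  then show ?thesis using f by simp
qed

lemma no_double_chain:
  assumes lie: "is_lie_algebra n c"
    and pair: "skew_pair n (lie_form n c x) (lie_form n c a) q z"
    and double: "double_chain n (lie_form n c x) (lie_form n c a) q z e m"
    and m: "m \<ge> 1" and d: "poly d e \<noteq> 0"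
    and SC: "\<And>i j. i < n \<Longrightarrow> j < n \<Longrightarrow>
      (\<Sum>k<n. bordered n (lie_form n c x) (lie_form n c a) q i k * C k j) = (if i = j then [:- e, 1:] ^ m * d else 0)"
    and CS: "\<And>i j. i < n \<Longrightarrow> j < n \<Longrightarrow>
      (\<Sum>k<n. C i k * bordered n (lie_form n c x) (lie_form n c a) q k j) = (if i = j then [:- e, 1:] ^ m * d else 0)"
    and drift: "\<And>v. \<exists>\<tau>. \<forall>i<n. \<forall>j<n. [:- e, 1:] ^ m dvd
      mv n C (mv n (cmatp (lie_form n c v)) (\<lambda>b. C b j)) i - smult \<tau> ([:- e, 1:] ^ (m - 1) * (d * C i j))"
    and zp: "dp n z x - e * dp n z a \<noteq> 0"
  shows False
proof -
  define A where "A = lie_form n c x"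
  define B where "B = lie_form n c a"
  let ?L = "[:- e, 1:]"
  let ?S = "bordered n A B q"
  interpret skew_pair n A B q z using pair by (simp add: A_def B_def)
  define f where "f = ?L ^ m * d"
  have f0: "f \<noteq> 0" using d by (auto simp: f_def)
  have S_C: "mv n ?S (mv n C y) i = f * y i" if "i < n" for i y
    by (rule mv_mv_scalar[OF _ that]) (simp add: SC A_def B_def f_def)
  have C_S: "mv n C (mv n ?S y) i = f * y i" if "i < n" for i y
    by (rule mv_mv_scalar[OF _ that]) (simp add: CS A_def B_def f_def)
  have zq: "dp n (cvec z) (cvec q) = 1" using dp_qz unfolding dp_commute[of n "cvec q"] .
  \<comment> \<open>All solutions are scaled by \<open>f\<close> to stay polynomial:
    \<open>\<xi> w\<close> is \<open>f\<close> times the solution for \<open>w\<close>, and \<omega>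
    below is the leading coefficient at the pole, up to the common factor \<open>d\<close>.\<close>
  define \<xi> where "\<xi> = (\<lambda>w :: nat \<Rightarrow> complex. mv n C (cvec w))"
  have q_C: "dp n (cvec q) (mv n C y) = f * dp n (cvec z) y" for y
  proof -
    have "f * dp n (cvec z) y = dp n (cvec z) (mv n ?S (mv n C y))"
      unfolding dp_scale_right[symmetric] by (rule dp_cong) (simp_all add: S_C)
    also have "\<dots> = dp n (cvec z) (\<lambda>i. mv n (pencil A B) (mv n C y) i + dp n (cvec q) (mv n C y) * [:q i:])"
      by (rule dp_cong) (simp_all only: mv_bordered mult.commute)
    also have "\<dots> = dp n (cvec q) (mv n C y)"
      unfolding dp_add_right dp_scale_right dp_z_pencil zq by simp
    finally show ?thesis by simp
  qed
  have q_\<xi>: "dp n (cvec q) (\<xi> w) = 0" if "dp n z w = 0" for w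
    unfolding \<xi>_def q_C dp_const that by simp
  have P_C: "mv n (pencil A B) (mv n C y) i = f * y i - [:q i:] * (f * dp n (cvec z) y)" if "i < n" for i y
    using S_C[OF that, of y] unfolding mv_bordered q_C by (simp add: algebra_simps)
  have P_\<xi>: "mv n (pencil A B) (\<xi> w) i = f * [:w i:]" if "dp n z w = 0" "i < n" for i w
    unfolding \<xi>_def P_C[OF that(2)] dp_const that(1) by simp
  \<comment> \<open>The border \<open>q q^T\<close> is symmetric, so antisymmetry of the inverse is
    claimed only when one of the paired covectors annihilates \<open>z\<close>.\<close>
  have C_anti: "dp n (cvec w) (mv n C y) = - dp n (\<xi> w) y" if w: "dp n z w = 0" for w y
  proof -
    have "f * dp n (cvec w) (mv n C y) = dp n (mv n C y) (\<lambda>i. f * [:w i:])"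
      unfolding dp_scale_right by (simp only: dp_commute)
    also have "\<dots> = dp n (mv n C y) (mv n (pencil A B) (\<xi> w))"
      by (rule dp_cong) (simp_all only: P_\<xi>[OF w])
    also have "\<dots> = - dp n (mv n (pencil A B) (mv n C y)) (\<xi> w)"
      by (rule dp_mv_skew) (rule skew_pencil)
    also have "dp n (mv n (pencil A B) (mv n C y)) (\<xi> w) = dp n (\<xi> w) (\<lambda>i. f * y i - (f * dp n (cvec z) y) * [:q i:])"
      unfolding dp_commute[of n _ "\<xi> w"] by (rule dp_cong) (simp_all only: P_C mult.commute)
    also have "\<dots> = f * dp n (\<xi> w) y"
      unfolding dp_diff_right dp_scale_right dp_commute[of n "\<xi> w" "cvec q"] q_\<xi>[OF w] by simp
    finally have "f * (dp n (cvec w) (mv n C y)) = f * (- dp n (\<xi> w) y)" by simp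
    then show ?thesis using f0 by (simp only: mult_left_cancel not_False_eq_True)
  qed
  obtain \<tau> where \<tau>: "\<And>v i j. i < n \<Longrightarrow> j < n \<Longrightarrow> ?L ^ m dvd
      mv n C (mv n (cmatp (lie_form n c v)) (\<lambda>b. C b j)) i - smult (\<tau> v) (?L ^ (m - 1) * (d * C i j))"
    using drift by metis
  have deriv: "?L ^ m dvd dp n (\<xi> v) (mv n (cmatp (lie_form n c u)) (\<xi> w)) +
      [:\<tau> u:] * (?L ^ (m - 1) * d) * dp n (cvec v) (\<xi> w)" if v: "dp n z v = 0" for u v w
  proof -
    let ?V = "cmatp (lie_form n c u)"
    let ?t = "[:\<tau> u:] * (?L ^ (m - 1) * d)"
    have entry: "?L ^ m dvd mv n C (mv n ?V (\<xi> w)) i - ?t * \<xi> w i" if i: "i < n" for i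
    proof -
      have "mv n C (mv n ?V (\<xi> w)) i = (\<Sum>b<n. mv n C (\<lambda>a. ?V a b) i * \<xi> w b)"
        by (rule mv_mult_left)
      also have "\<dots> = mv n (\<lambda>i b. mv n C (\<lambda>a. ?V a b) i) (mv n C (cvec w)) i"
        unfolding \<xi>_def mv_def[of n "\<lambda>i b. mv n C (\<lambda>a. ?V a b) i"] ..
      also have "\<dots> = (\<Sum>j<n. mv n (\<lambda>i b. mv n C (\<lambda>a. ?V a b) i) (\<lambda>b. C b j) i * [:w j:])"
        by (rule mv_mult_left)
      also have "\<dots> = (\<Sum>j<n. mv n C (mv n ?V (\<lambda>b. C b j)) i * [:w j:])"
        unfolding mv_mult_left[of n C ?V] mv_def[of n "\<lambda>i b. mv n C (\<lambda>a. ?V a b) i"] ..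
      finally have "mv n C (mv n ?V (\<xi> w)) i - ?t * \<xi> w i =
          (\<Sum>j<n. (mv n C (mv n ?V (\<lambda>b. C b j)) i - smult (\<tau> u) (?L ^ (m - 1) * (d * C i j))) * [:w j:])"
        unfolding \<xi>_def mv_def[of n C "cvec w"] sum_distrib_left sum_subtractf[symmetric]
        by (simp add: algebra_simps sum_subtractf)
      also have "?L ^ m dvd \<dots>" using \<tau> i by (intro dvd_sum dvd_mult2) auto
      finally show ?thesis .
    qed
    have "?L ^ m dvd dp n (cvec v) (\<lambda>i. mv n C (mv n ?V (\<xi> w)) i - ?t * \<xi> w i)"
      unfolding dp_def using entry by (intro dvd_sum dvd_mult) auto
    also have "dp n (cvec v) (\<lambda>i. mv n C (mv n ?V (\<xi> w)) i - ?t * \<xi> w i) =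
        - (dp n (\<xi> v) (mv n ?V (\<xi> w)) + ?t * dp n (cvec v) (\<xi> w))"
      unfolding dp_diff_right dp_scale_right C_anti[OF v] by simp
    finally show ?thesis by (simp only: dvd_minus_iff)
  qed
  define \<omega> where "\<omega> = (\<lambda>v w. poly (dp n (cvec v) (\<xi> w)) e)"
  have cancel: "poly p e = 0" if "?L ^ m dvd ?L ^ (m - 1) * p" for p
  proof -
    have "?L ^ m = ?L ^ (m - 1) * ?L" using m by (intro power_minus_mult[symmetric]) simp
    with that have "?L ^ (m - 1) * ?L dvd ?L ^ (m - 1) * p" by (simp only:)
    then have "?L dvd p" by (subst (asm) dvd_mult_cancel_left) simp
    then show ?thesis by (simp add: poly_eq_0_iff_dvd)
  qed
  \<comment> \<open>The sum of the three congruences contains the closedness identity, which drops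
    out. Dividing the rest by \<open>[:- e, 1:] ^ (m - 1)\<close> and evaluating at \<open>e\<close>
    leaves this relation.\<close>
  have cyc: "\<tau> u * \<omega> v w + \<tau> v * \<omega> w u + \<tau> w * \<omega> u v = 0"
    if uvw: "dp n z u = 0" "dp n z v = 0" "dp n z w = 0" for u v w
  proof -
    let ?g = "\<lambda>u v w. dp n (\<xi> v) (mv n (cmatp (lie_form n c u)) (\<xi> w))"
    let ?h = "\<lambda>u v w. [:\<tau> u:] * (?L ^ (m - 1) * d) * dp n (cvec v) (\<xi> w)"
    have "?g u v w + ?g v w u + ?g w u v = 0"
      by (rule lie_form_closed[OF lie _ _ _ f0, where x = x and a = a])
        (use P_\<xi> uvw in \<open>simp_all add: A_def B_def\<close>)
    then have "(?g u v w + ?h u v w) + (?g v w u + ?h v w u) + (?g w u v + ?h w u v) =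
        ?L ^ (m - 1) * (d * ([:\<tau> u:] * dp n (cvec v) (\<xi> w) + [:\<tau> v:] * dp n (cvec w) (\<xi> u) + [:\<tau> w:] * dp n (cvec u) (\<xi> v)))"
      by (simp add: algebra_simps)
    moreover have "?L ^ m dvd (?g u v w + ?h u v w) + (?g v w u + ?h v w u) + (?g w u v + ?h w u v)"
      by (intro dvd_add deriv uvw)
    ultimately have "poly (d * ([:\<tau> u:] * dp n (cvec v) (\<xi> w) + [:\<tau> v:] * dp n (cvec w) (\<xi> u) + [:\<tau> w:] * dp n (cvec u) (\<xi> v))) e = 0"
      by (intro cancel) simp
    then show ?thesis using d by (simp add: \<omega>_def)
  qed
  obtain E F u v E' F' u' v' where ch: "border_chain n A B q z e m E F u v" and ch': "border_chain n A B q z e m E' F' u' v'"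
    and cross: "dp n (cvec v') E = 0" "dp n (cvec u) E' = 0" "dp n (cvec v') F = 0" "dp n (cvec v) E' = 0"
    using double unfolding double_chain_def A_def[symmetric] B_def[symmetric] by blast
  have \<xi>_chain: "\<xi> w i = d * X i" if "\<And>i. i < n \<Longrightarrow> mv n ?S X i = ?L ^ m * [:w i:]" "i < n" for X w i
  proof -
    have "?L ^ m * \<xi> w i = mv n C (\<lambda>i. ?L ^ m * [:w i:]) i" unfolding \<xi>_def mv_scale ..
    also have "\<dots> = mv n C (mv n ?S X) i" by (rule mv_cong) (simp_all only: that)
    also have "\<dots> = ?L ^ m * (d * X i)" using C_S[OF that(2)] by (simp add: f_def mult.assoc)
    finally show ?thesis by simp
  qed
  note \<xi>E = \<xi>_chain[OF border_chain_mv(1)[OF ch]] and \<xi>F = \<xi>_chain[OF border_chain_mv(2)[OF ch]]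
    and \<xi>E' = \<xi>_chain[OF border_chain_mv(1)[OF ch']] and \<xi>F' = \<xi>_chain[OF border_chain_mv(2)[OF ch']]
  have \<omega>_chain: "\<omega> s w = poly d e * poly (dp n (cvec s) X) e" if "\<And>i. i < n \<Longrightarrow> \<xi> w i = d * X i" for s w X
  proof -
    have "dp n (cvec s) (\<xi> w) = dp n (cvec s) (\<lambda>i. d * X i)" by (rule dp_cong) (simp_all only: that)
    then show ?thesis unfolding \<omega>_def dp_scale_right by simp
  qed
  have W: "dp n z u = 0" "dp n z v = 0" "dp n z u' = 0" "dp n z v' = 0"
    using ch ch' unfolding border_chain_def dp_const by auto
  have one: "dp n (cvec u) F = 1" "dp n (cvec u') F' = 1"
    using ch ch' unfolding border_chain_def chain_pair_def by auto
  have uv: "\<omega> u v = poly d e" "\<omega> u' v' = poly d e"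
    using \<omega>_chain[OF \<xi>F, of u] \<omega>_chain[OF \<xi>F', of u'] one by simp_all
  have zero: "\<omega> v' u = 0" "\<omega> u u' = 0" "\<omega> v' v = 0" "\<omega> v u' = 0"
    using \<omega>_chain[OF \<xi>E, of v'] \<omega>_chain[OF \<xi>E', of u] \<omega>_chain[OF \<xi>F, of v'] \<omega>_chain[OF \<xi>E', of v] cross
    by simp_all
  \<comment> \<open>In the cyclic relation for \<open>u, u', v'\<close> the terms with
    \<open>\<tau> u'\<close> and \<open>\<tau> v'\<close> carry vanishing cross products, leaving
    \<open>\<tau> u * \<omega> u' v'\<close>; likewise with \<open>v\<close> for
    \<open>u\<close>.\<close>
  have \<tau>u: "\<tau> u = 0" using cyc[OF W(1,3,4)] uv zero d by simp
  have \<tau>v: "\<tau> v = 0" using cyc[OF W(2,3,4)] uv zero d by simp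
  \<comment> \<open>\<kappa> is chosen so that \<open>a' = a - \<kappa> (x - e a)\<close> pairs to 0
    with \<open>z\<close>; its denominator is the quantity assumed nonzero.\<close>
  define \<kappa> where "\<kappa> = dp n z a / (dp n z x - e * dp n z a)"
  define a' where "a' = (\<lambda>i. a i + (- \<kappa>) * (x i + (- e) * a i))"
  have "dp n z a' = 0"
  proof -
    have "dp n z a' = dp n z a + (- \<kappa>) * (dp n z x + (- e) * dp n z a)"
      unfolding a'_def dp_add_right dp_scale_right ..
    then show ?thesis using zp by (simp add: \<kappa>_def)
  qed
  from cyc[OF this W(1,2)] have \<tau>a: "\<tau> a' = 0" using uv \<tau>u \<tau>v d by simp
  have chp: "mv n (pencil A B) F i = ?L ^ m * [:v i:]" if "i < n" for i
    using ch that unfolding border_chain_def chain_pair_def by blast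
  have EBF: "dp n E (mv n (cmatp B) F) = of_nat m * ?L ^ (m - 1)"
    using ch unfolding border_chain_def chain_pair_def by blast
  have "mv n (cmatp (lie_form n c a')) F i =
      [:1:] * mv n (cmatp B) F i - [:\<kappa>:] * (?L ^ m * [:v i:] + ?L * mv n (cmatp B) F i)" if i: "i < n" for i
  proof -
    \<comment> \<open>\<open>A - e B\<close> is the pencil plus \<open>(X - e) B\<close>. Applied to
      \<open>F\<close>, the first is a multiple of \<open>(X - e)^m\<close>, and the factor
      \<open>X - e\<close> gives the second the same order after pairing with \<open>E\<close>. So
      replacing \<open>a\<close> by \<open>a'\<close> does not affect the leading term.\<close>
    have "cmatp (lie_form n c a') i j = cmatp B i j - [:\<kappa>:] * (pencil A B i j + ?L * cmatp B i j)" for j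
      unfolding a'_def lie_form_add_scale A_def B_def pencil_def by (simp add: algebra_simps)
    then have "mv n (cmatp (lie_form n c a')) F i = (\<Sum>j<n. cmatp B i j * F j - [:\<kappa>:] * (pencil A B i j * F j + ?L * (cmatp B i j * F j)))"
      unfolding mv_def by (intro sum.cong refl) (simp only: left_diff_distrib distrib_right mult.assoc)
    also have "\<dots> = mv n (cmatp B) F i - [:\<kappa>:] * (mv n (pencil A B) F i + ?L * mv n (cmatp B) F i)"
      unfolding mv_def sum_subtractf sum_distrib_left[symmetric] sum.distrib ..
    finally show ?thesis unfolding chp[OF i] by simp
  qed
  then have "dp n E (mv n (cmatp (lie_form n c a')) F) =
      dp n E (\<lambda>i. [:1:] * mv n (cmatp B) F i - [:\<kappa>:] * (?L ^ m * [:v i:] + ?L * mv n (cmatp B) F i))"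
    by (intro dp_cong) auto
  also have "\<dots> = of_nat m * ?L ^ (m - 1) - [:\<kappa>:] * (?L ^ m * dp n E (cvec v) + ?L * (of_nat m * ?L ^ (m - 1)))"
    unfolding dp_diff_right dp_scale_right dp_add_right EBF by simp
  also have "?L * (of_nat m * ?L ^ (m - 1)) = ?L ^ m * of_nat m"
    using m by (cases m) (simp_all add: mult_ac)
  finally have E_a'_F: "dp n E (mv n (cmatp (lie_form n c a')) F) =
      of_nat m * ?L ^ (m - 1) - ?L ^ m * ([:\<kappa>:] * (dp n E (cvec v) + of_nat m))"
    by (simp add: algebra_simps)
  have "?L ^ m dvd dp n (\<xi> u) (mv n (cmatp (lie_form n c a')) (\<xi> v))"
    using deriv[OF W(1), of a' v] \<tau>a by simp
  also have "dp n (\<xi> u) (mv n (cmatp (lie_form n c a')) (\<xi> v)) = d * d * dp n E (mv n (cmatp (lie_form n c a')) F)"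
  proof -
    have "dp n (\<xi> u) (mv n (cmatp (lie_form n c a')) (\<xi> v)) =
        dp n (\<lambda>i. d * E i) (mv n (cmatp (lie_form n c a')) (\<lambda>i. d * F i))"
      by (intro dp_cong mv_cong \<xi>E \<xi>F refl)
    also have "\<dots> = d * d * dp n E (mv n (cmatp (lie_form n c a')) F)"
      unfolding dp_def mv_scale sum_distrib_left by (intro sum.cong refl) (simp only: mult_ac)
    finally show ?thesis .
  qed
  finally have "?L ^ m dvd d * d * (of_nat m * ?L ^ (m - 1)) - ?L ^ m * (d * d * ([:\<kappa>:] * (dp n E (cvec v) + of_nat m)))"
    unfolding E_a'_F by (simp only: right_diff_distrib mult_ac)
  then have "?L ^ m dvd d * d * (of_nat m * ?L ^ (m - 1))"
    by (simp only: dvd_diff_left_iff dvd_triv_left)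
  then have "?L ^ m dvd ?L ^ (m - 1) * (d * d * of_nat m)" by (simp only: mult_ac)
  from cancel[OF this] show False using d m by (simp add: of_nat_poly)
qed

section \<open>Choosing generic covectors along lines\<close>

lemma polyfun_on_line:
  assumes "p \<in> polyfuns n"
  shows "\<exists>r. \<forall>t. p (\<lambda>i. x i + t * v i, \<lambda>i. a i + t * b i) = poly r t"
  using assms
proof induction
  case (const c)
  show ?case by (rule exI[of _ "[:c:]"]) simp
next
  case (coord1 i)
  show ?case by (rule exI[of _ "[:x i, v i:]"]) simp
next
  case (coord2 i)
  show ?case by (rule exI[of _ "[:a i, b i:]"]) simp
next
  case (add p q)
  then obtain r s where "\<And>t. p (\<lambda>i. x i + t * v i, \<lambda>i. a i + t * b i) = poly r t"
    "\<And>t. q (\<lambda>i. x i + t * v i, \<lambda>i. a i + t * b i) = poly s t" by blast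
  then show ?case by (intro exI[of _ "r + s"]) simp
next
  case (mult p q)
  then obtain r s where "\<And>t. p (\<lambda>i. x i + t * v i, \<lambda>i. a i + t * b i) = poly r t"
    "\<And>t. q (\<lambda>i. x i + t * v i, \<lambda>i. a i + t * b i) = poly s t" by blast
  then show ?case by (intro exI[of _ "r * s"]) simp
qed

text \<open>A defining polynomial that is nonzero at the base point restricts to a nonzero
  polynomial in \<open>t\<close>, which has finitely many roots.\<close>

lemma zariski_open_cofinite_line:
  assumes "zariski_open n U" "(x, a) \<in> U"
  shows "finite {t. (\<lambda>i. x i + t * v i, \<lambda>i. a i + t * b i) \<notin> U}"
proof -
  obtain S where S: "S \<subseteq> polyfuns n" "U = - {z. \<forall>p\<in>S. p z = 0}"
    using assms(1) unfolding zariski_open_def by blast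
  then obtain p where p: "p \<in> S" "p (x, a) \<noteq> 0" using assms(2) by auto
  then obtain r where r: "\<And>t. p (\<lambda>i. x i + t * v i, \<lambda>i. a i + t * b i) = poly r t"
    using polyfun_on_line S(1) by blast
  have "poly r 0 \<noteq> 0" using r[of 0] p(2) by simp
  then have "finite {t. poly r t = 0}" by (intro poly_roots_finite) auto
  then show ?thesis
  proof (rule rev_finite_subset)
    show "{t. (\<lambda>i. x i + t * v i, \<lambda>i. a i + t * b i) \<notin> U} \<subseteq> {t. poly r t = 0}"
      using S(2) p(1) r by force
  qed
qed

lemma zariski_open_line_first:
  "zariski_open n U \<Longrightarrow> (x, a) \<in> U \<Longrightarrow> finite {t. (\<lambda>i. x i + t * v i, a) \<notin> U}"
  using zariski_open_cofinite_line[of n U x a v "\<lambda>_. 0"] by simp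

lemma zariski_open_line_second:
  "zariski_open n U \<Longrightarrow> (x, a) \<in> U \<Longrightarrow> finite {t. (x, \<lambda>i. a i + t * b i) \<notin> U}"
  using zariski_open_cofinite_line[of n U x a "\<lambda>_. 0" b] by simp

lemma dual_vector_exists:
  assumes "\<exists>i<n. z i \<noteq> (0::complex)"
  shows "\<exists>q. dp n q z = 1"
proof -
  obtain i where i: "i < n" "z i \<noteq> 0" using assms by blast
  have "dp n (\<lambda>j. if j = i then 1 / z i else 0) z = (\<Sum>j<n. if j = i then 1 else 0)"
    unfolding dp_def using i by (intro sum.cong) auto
  then show ?thesis using i by (intro exI[of _ "\<lambda>j. if j = i then 1 / z i else 0"]) simp
qed

lemma prod_blocks_dvd:
  fixes bs :: "jk_block list"
  shows "\<exists>M :: complex poly. M \<noteq> 0 \<and> (\<forall>e m. Jor (Some e) m \<in> set bs \<longrightarrow> [:- e, 1:] ^ m dvd M)"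
proof (induction bs)
  case (Cons b bs)
  then obtain M :: "complex poly" where M: "M \<noteq> 0" "\<And>e m. Jor (Some e) m \<in> set bs \<Longrightarrow> [:- e, 1:] ^ m dvd M" by blast
  define g where "g = (case b of Jor (Some e) m \<Rightarrow> [:- e, 1:] ^ m | _ \<Rightarrow> 1)"
  have "g \<noteq> 0" by (auto simp: g_def split: jk_block.splits option.splits)
  moreover have "[:- e, 1:] ^ m dvd g * M" if "Jor (Some e) m \<in> set (b # bs)" for e m
    using that M(2) by (auto simp: g_def)
  ultimately show ?case using M(1) by (intro exI[of _ "g * M"]) auto
qed (auto intro: exI[of _ 1])

text \<open>Let \<open>y\<close> be in the kernel of \<open>A - s B\<close>. Pair it with a solution
  of the pencil for a covector annihilating \<open>z\<close>: skewness makes the pairing 0 at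
  \<open>s\<close>, and \<open>M\<close> is nonzero there. So \<open>y\<close> is annihilated by
  every such covector and is a multiple of \<open>z\<close>.\<close>

lemma generic_kernel:
  assumes jk: "has_jk_type n A B {#1#} T"
    and skew: "\<And>i j. i < n \<Longrightarrow> j < n \<Longrightarrow> A i j = - A j i" "\<And>i j. i < n \<Longrightarrow> j < n \<Longrightarrow> B i j = - B j i"
  obtains z M where "\<exists>i<n. z i \<noteq> 0" "\<And>i. i < n \<Longrightarrow> mv n A z i = 0" "\<And>i. i < n \<Longrightarrow> mv n B z i = 0"
    "M \<noteq> (0 :: complex poly)"
    "\<And>s y. poly M s \<noteq> 0 \<Longrightarrow> (\<And>i. i < n \<Longrightarrow> mv n A y i = s * mv n B y i) \<Longrightarrow> \<exists>t. \<forall>i<n. y i = t * z i"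
proof -
  obtain bs z where z: "\<exists>i<n. z i \<noteq> 0" "\<And>i. i < n \<Longrightarrow> mv n A z i = 0" "\<And>i. i < n \<Longrightarrow> mv n B z i = 0"
    and solve: "\<And>M w. (\<And>e m. Jor (Some e) m \<in> set bs \<Longrightarrow> [:- e, 1:] ^ m dvd M) \<Longrightarrow> dp n (cvec z) w = 0 \<Longrightarrow>
      \<exists>x. \<forall>i<n. mv n (pencil A B) x i = M * w i"
    by (rule jk_structure[OF jk]) blast
  obtain M :: "complex poly" where M: "M \<noteq> 0" "\<And>e m. Jor (Some e) m \<in> set bs \<Longrightarrow> [:- e, 1:] ^ m dvd M"
    using prod_blocks_dvd[of bs] by blast
  obtain q where q: "dp n q z = 1" using dual_vector_exists[OF z(1)] by blast
  have "\<exists>t. \<forall>i<n. y i = t * z i" if s: "poly M s \<noteq> 0" and y: "\<And>i. i < n \<Longrightarrow> mv n A y i = s * mv n B y i" for s y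
  proof (intro exI allI impI)
    fix i assume i: "i < n"
    \<comment> \<open>The \<open>i\<close>-th coordinate covector corrected by a multiple of
      \<open>q\<close> to annihilate \<open>z\<close>; pairing it with \<open>y\<close> compares
      \<open>y i\<close> with \<open>dp n q y * z i\<close>.\<close>
    define w where "w = (\<lambda>j. (if j = i then 1 else 0) - z i * q j)"
    have delta: "dp n v (\<lambda>j. if j = i then 1 else 0) = v i" for v :: "nat \<Rightarrow> complex"
      unfolding dp_def using i by (simp add: if_distrib cong: if_cong)
    have dw: "dp n v w = v i - z i * dp n q v" for v
      unfolding w_def dp_diff_right dp_scale_right delta by (simp add: dp_commute)
    have "dp n (cvec z) (cvec w) = 0" unfolding dp_const dw q by simp
    with solve[of M, OF M(2)] obtain x where x: "\<And>k. k < n \<Longrightarrow> mv n (pencil A B) x k = M * [:w k:]"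
      by blast
    let ?P = "\<lambda>i j. poly (pencil A B i j) s" and ?x = "\<lambda>j. poly (x j) s"
    have "poly M s * dp n y w = dp n y (mv n ?P ?x)"
      unfolding dp_scale_right[symmetric]
    proof (rule dp_cong)
      fix k assume "k < n"
      from arg_cong[OF x[OF this], of "\<lambda>p. poly p s"] show "poly M s * w k = mv n ?P ?x k"
        by (simp add: poly_mv mult.commute)
    qed simp
    also have "\<dots> = - dp n (mv n ?P y) ?x"
    proof (rule dp_mv_skew)
      fix k l assume "k < n" "l < n"
      from skew(1)[OF this] skew(2)[OF this] show "?P k l = - ?P l k" by (simp add: pencil_def)
    qed
    also have "dp n (mv n ?P y) ?x = 0"
    proof -
      have "mv n ?P y k = mv n A y k + (- s) * mv n B y k" for k
        unfolding mv_add_scale_matrix[symmetric] by (simp add: pencil_def)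
      then have "mv n ?P y k = 0" if "k < n" for k using y[OF that] by simp
      then show ?thesis by (simp add: dp_def)
    qed
    finally have "dp n y w = 0" using s by simp
    then show "y i = dp n q y * z i" unfolding dw by (simp add: mult.commute)
  qed
  with z M(1) show thesis by (rule that)
qed

text \<open>The kernel of the form at \<open>a - x / s\<close> consists of the \<open>y\<close> with
  \<open>A y = s B y\<close>, a line for generic \<open>s\<close>. A second form with this kernel
  excludes the eigenvalue infinity.\<close>

lemma regular_pair_exists:
  assumes lie: "is_lie_algebra n c" and U: "zariski_open n U" "(x, a) \<in> U"
    and jk: "\<And>x a. (x, a) \<in> U \<Longrightarrow> has_jk_type n (lie_form n c x) (lie_form n c a) {#1#} T"
  obtains a' z where "(x, a') \<in> U" "\<exists>i<n. z i \<noteq> 0" "\<And>i. i < n \<Longrightarrow> mv n (lie_form n c x) z i = 0"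
    "\<And>i. i < n \<Longrightarrow> mv n (lie_form n c a') z i = 0"
    "\<And>y. (\<And>i. i < n \<Longrightarrow> mv n (lie_form n c a') y i = 0) \<Longrightarrow> \<exists>t. \<forall>i<n. y i = t * z i"
proof -
  obtain z M where z: "\<exists>i<n. z i \<noteq> 0" "\<And>i. i < n \<Longrightarrow> mv n (lie_form n c x) z i = 0" "\<And>i. i < n \<Longrightarrow> mv n (lie_form n c a) z i = 0"
    and M: "M \<noteq> 0" and ker: "\<And>s y. poly M s \<noteq> 0 \<Longrightarrow>
      (\<And>i. i < n \<Longrightarrow> mv n (lie_form n c x) y i = s * mv n (lie_form n c a) y i) \<Longrightarrow> \<exists>t. \<forall>i<n. y i = t * z i"
  proof (rule generic_kernel[OF jk[OF U(2)]], goal_cases)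
    case (1 i j)
    show ?case by (rule lie_form_skew[OF lie 1(2,3)])
  next
    case (2 i j)
    show ?case by (rule lie_form_skew[OF lie 2(2,3)])
  next
    case prems: 3
    show ?case by (rule prems(1)) (fact prems)+
  qed
  define bad where "bad = {t. (x, \<lambda>i. a i + t * x i) \<notin> U}"
  have "finite ({s. poly M s = 0} \<union> (\<lambda>t. - 1 / t) ` bad \<union> {0})"
    unfolding bad_def using poly_roots_finite[OF M] zariski_open_line_second[OF U] by simp
  from ex_new_if_finite[OF infinite_UNIV_char_0 this]
  obtain s where s: "s \<notin> {s. poly M s = 0} \<union> (\<lambda>t. - 1 / t) ` bad \<union> {0}" ..
  define a' where "a' = (\<lambda>i. a i + (- 1 / s) * x i)"
  have form: "mv n (lie_form n c a') y i = mv n (lie_form n c a) y i + (- 1 / s) * mv n (lie_form n c x) y i" for y i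
    unfolding a'_def lie_form_add_scale mv_add_scale_matrix ..
  have "- 1 / s \<notin> bad"
  proof
    assume "- 1 / s \<in> bad"
    then have "- 1 / (- 1 / s) \<in> (\<lambda>t. - 1 / t) ` bad" by (rule imageI)
    then show False using s by simp
  qed
  then have "(x, a') \<in> U" unfolding bad_def a'_def by simp
  moreover have "\<exists>t. \<forall>i<n. y i = t * z i" if "\<And>i. i < n \<Longrightarrow> mv n (lie_form n c a') y i = 0" for y
  proof (rule ker[of s])
    show "poly M s \<noteq> 0" using s by simp
    show "mv n (lie_form n c x) y i = s * mv n (lie_form n c a) y i" if "i < n" for i
      using \<open>\<And>i. i < n \<Longrightarrow> mv n (lie_form n c a') y i = 0\<close>[OF that] s unfolding form by (simp add: field_simps)
  qed
  moreover have "mv n (lie_form n c a') z i = 0" if "i < n" for i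
    unfolding form using z that by simp
  ultimately show thesis using that z by blast
qed

text \<open>The pair at \<open>(x + t v, a)\<close> again has a common kernel vector. It lies in the
  kernel at \<open>a\<close>, hence is a nonzero multiple of \<open>z\<close>; linearity in the
  covector and \<open>t \<noteq> 0\<close> then isolate the form at \<open>v\<close>.\<close>

lemma kernel_central:
  assumes lie: "is_lie_algebra n c" and U: "zariski_open n U" "(x, a) \<in> U"
    and jk: "\<And>x a. (x, a) \<in> U \<Longrightarrow> has_jk_type n (lie_form n c x) (lie_form n c a) {#1#} T"
    and z: "\<And>i. i < n \<Longrightarrow> mv n (lie_form n c x) z i = 0"
    and ker: "\<And>y. (\<And>i. i < n \<Longrightarrow> mv n (lie_form n c a) y i = 0) \<Longrightarrow> \<exists>t. \<forall>i<n. y i = t * z i"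
    and i: "i < n"
  shows "mv n (lie_form n c v) z i = 0"
proof -
  have "finite ({t. (\<lambda>i. x i + t * v i, a) \<notin> U} \<union> {0})"
    using zariski_open_line_first[OF U] by simp
  from ex_new_if_finite[OF infinite_UNIV_char_0 this]
  obtain t where t: "t \<notin> {t. (\<lambda>i. x i + t * v i, a) \<notin> U} \<union> {0}" ..
  then have "(\<lambda>i. x i + t * v i, a) \<in> U" by blast
  from jk[OF this]
  obtain y where y: "\<exists>i<n. y i \<noteq> 0" "\<And>i. i < n \<Longrightarrow> mv n (lie_form n c (\<lambda>i. x i + t * v i)) y i = 0"
    "\<And>i. i < n \<Longrightarrow> mv n (lie_form n c a) y i = 0"
  proof (rule jk_structure, goal_cases)
    case prems: 1
    show ?case by (rule prems(1)) (fact prems)+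
  qed
  obtain s where s: "\<And>i. i < n \<Longrightarrow> y i = s * z i" using ker[OF y(3)] by blast
  have s0: "s \<noteq> 0" using y(1) s by auto
  have "0 = mv n (lie_form n c (\<lambda>i. x i + t * v i)) (\<lambda>i. s * z i) i"
    using y(2)[OF i] mv_cong[of n _ _ y "\<lambda>i. s * z i" i] s i by metis
  also have "\<dots> = s * (mv n (lie_form n c x) z i + t * mv n (lie_form n c v) z i)"
    unfolding mv_scale lie_form_add_scale mv_add_scale_matrix ..
  finally show ?thesis using s0 t z[OF i] by simp
qed

theorem theorem17:
  shows "\<not> (\<exists>(n::nat) c K T. is_lie_algebra n c \<and> lie_jk_invariants n c K T \<and>
             K = {#1#} \<and> size (filter_mset multiple_maxima T) \<ge> 2)"
proof (intro notI, elim exE conjE)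
  fix n :: nat and c K T
  assume lie: "is_lie_algebra n c" and inv: "lie_jk_invariants n c K T" and K: "K = {#1#}"
    and two: "size (filter_mset multiple_maxima T) \<ge> 2"
  obtain U where U: "zariski_open n U" "U \<noteq> {}"
    and jkU: "\<forall>(x, a)\<in>U. has_jk_type n (lie_form n c x) (lie_form n c a) K T"
    using inv unfolding lie_jk_invariants_def by blast
  have jk: "has_jk_type n (lie_form n c x) (lie_form n c a) {#1#} T" if "(x, a) \<in> U" for x a
    using jkU that K by blast
  obtain x0 a0 where "(x0, a0) \<in> U" using U(2) by (metis all_not_in_conv surj_pair)
  from lie U(1) this
  obtain a z where x0a: "(x0, a) \<in> U" and z: "\<exists>i<n. z i \<noteq> 0"
    and x0z: "\<And>i. i < n \<Longrightarrow> mv n (lie_form n c x0) z i = 0"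
    and ker: "\<And>y. (\<And>i. i < n \<Longrightarrow> mv n (lie_form n c a) y i = 0) \<Longrightarrow> \<exists>t. \<forall>i<n. y i = t * z i"
  proof (rule regular_pair_exists[where T = T], goal_cases)
    case (1 y b)
    show ?case by (rule jk[OF 1(2)])
  next
    case prems: 2
    show ?case by (rule prems(1)) (fact prems)+
  qed
  have central: "mv n (lie_form n c v) z i = 0" if "i < n" for v i
    by (rule kernel_central[OF lie U(1) x0a jk x0z ker that])
  obtain q where q: "dp n q z = 1" using dual_vector_exists[OF z] by blast
  \<comment> \<open>Read as a covector, \<open>q\<close> satisfies \<langle>q, z\<rangle> = 1, so
    moving along it changes \<langle>x, z\<rangle> at unit speed; all but finitely many
    \<open>t\<close> stay in \<open>U\<close> and give a nonzero value.\<close>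
  have "finite ({t. (\<lambda>i. x0 i + t * q i, a) \<notin> U} \<union> {- dp n z x0})"
    using zariski_open_line_first[OF U(1) x0a] by simp
  from ex_new_if_finite[OF infinite_UNIV_char_0 this]
  obtain t where t: "t \<notin> {t. (\<lambda>i. x0 i + t * q i, a) \<notin> U} \<union> {- dp n z x0}" ..
  define x where "x = (\<lambda>i. x0 i + t * q i)"
  have xa: "(x, a) \<in> U" using t by (simp add: x_def)
  have "dp n z x = dp n z x0 + t"
    unfolding x_def dp_add_right dp_scale_right using q by (simp add: dp_commute)
  then have zx: "dp n z x \<noteq> 0" using t by (auto simp: add_eq_0_iff2)
  have pair: "skew_pair n (lie_form n c y) (lie_form n c a) q z" for y
    by (rule skew_pair.intro) (assumption | rule lie_form_skew[OF lie] central q)+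
  let ?S = "bordered n (lie_form n c x) (lie_form n c a) q"
  have pole: "\<exists>nm. pole_data n (bordered n (lie_form n c y) (lie_form n c a) q) T nm \<and> (\<exists>e1 e2. e1 \<noteq> e2 \<and>
      poly (det_of n (bordered n (lie_form n c y) (lie_form n c a) q)) e1 = 0 \<and>
      poly (det_of n (bordered n (lie_form n c y) (lie_form n c a) q)) e2 = 0 \<and>
      double_chain n (lie_form n c y) (lie_form n c a) q z e1 (nm e1) \<and>
      double_chain n (lie_form n c y) (lie_form n c a) q z e2 (nm e2))" if "(y, a) \<in> U" for y
  proof (rule skew_pair.jk_pole_data[OF pair jk[OF that]], goal_cases)
    case (1 y)
    from this(1) show ?case by (rule ker)
  next
    case prems: (2 nm)
    from prems(1) prems(2)[OF two] show ?case by blast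
  qed
  from pole[OF xa] obtain nm where pd: "pole_data n ?S T nm" and dbl: "\<exists>e1 e2. e1 \<noteq> e2 \<and>
      poly (det_of n ?S) e1 = 0 \<and> poly (det_of n ?S) e2 = 0 \<and>
      double_chain n (lie_form n c x) (lie_form n c a) q z e1 (nm e1) \<and>
      double_chain n (lie_form n c x) (lie_form n c a) q z e2 (nm e2)"
    by (elim exE conjE) blast
  have "\<exists>e. poly (det_of n ?S) e = 0 \<and> double_chain n (lie_form n c x) (lie_form n c a) q z e (nm e) \<and>
      dp n z x - e * dp n z a \<noteq> 0"
  proof -
    obtain e1 e2 where e: "e1 \<noteq> e2" "poly (det_of n ?S) e1 = 0" "poly (det_of n ?S) e2 = 0"
      "double_chain n (lie_form n c x) (lie_form n c a) q z e1 (nm e1)"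
      "double_chain n (lie_form n c x) (lie_form n c a) q z e2 (nm e2)" using dbl by blast
    \<comment> \<open>If both expressions vanished, their difference would give
      \<open>dp n z a = 0\<close> because \<open>e1 \<noteq> e2\<close>, and then
      \<open>dp n z x = 0\<close>.\<close>
    have "dp n z x - e1 * dp n z a \<noteq> 0 \<or> dp n z x - e2 * dp n z a \<noteq> 0"
      using e(1) zx by auto
    then show ?thesis using e by blast
  qed
  then obtain e where e: "poly (det_of n ?S) e = 0"
    and dc: "double_chain n (lie_form n c x) (lie_form n c a) q z e (nm e)"
    and ze: "dp n z x - e * dp n z a \<noteq> 0" by blast
  define m where "m = Polynomial.order e (det_of n ?S)"
  have D0: "det_of n ?S \<noteq> 0" using pd by (simp add: pole_data_def)
  have nm: "1 \<le> nm e" "nm e \<le> m" and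
    adj: "\<And>i j. i < n \<Longrightarrow> j < n \<Longrightarrow> [:- e, 1:] ^ (m - nm e) dvd adj_of n ?S i j"
    using pd e unfolding pole_data_def m_def by blast+
  obtain d where d: "det_of n ?S = [:- e, 1:] ^ m * d" "\<not> [:- e, 1:] dvd d"
    using order_decomp[OF D0, of e] unfolding m_def by blast
  have "\<exists>C. \<forall>i<n. \<forall>j<n. adj_of n ?S i j = [:- e, 1:] ^ (m - nm e) * C i j"
    using adj unfolding dvd_def by metis
  then obtain C where C: "\<And>i j. i < n \<Longrightarrow> j < n \<Longrightarrow> adj_of n ?S i j = [:- e, 1:] ^ (m - nm e) * C i j"
    by blast
  have drift: "\<exists>\<tau>. \<forall>i<n. \<forall>j<n. [:- e, 1:] ^ nm e dvd
      mv n C (mv n (cmatp (lie_form n c v)) (\<lambda>b. C b j)) i - smult \<tau> ([:- e, 1:] ^ (nm e - 1) * (d * C i j))" for v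
  proof -
    have lim: "(\<lambda>k. inverse (of_nat (Suc k)) :: complex) \<longlonglongrightarrow> 0"
      using LIMSEQ_inverse_real_of_nat[THEN tendsto_of_real, where 'a = complex] by (simp del: of_nat_Suc)
    have "finite {t. (\<lambda>i. x i + t * v i, a) \<notin> U}" by (rule zariski_open_line_first[OF U(1) xa])
    then have "open (- {t. (\<lambda>i. x i + t * v i, a) \<notin> U})" by (intro open_Compl finite_imp_closed)
    from topological_tendstoD[OF lim this] xa
    have "\<forall>\<^sub>F k in sequentially. (\<lambda>i. x i + inverse (of_nat (Suc k)) * v i, a) \<in> U" by simp
    then obtain k0 where k0: "\<And>k. k \<ge> k0 \<Longrightarrow> (\<lambda>i. x i + inverse (of_nat (Suc k)) * v i, a) \<in> U"
      unfolding eventually_sequentially by blast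
    \<comment> \<open>The shift by \<open>k0\<close> places every perturbed covector in
      \<open>U\<close>, so that the pole data are available for each \<open>k\<close>.\<close>
    define \<epsilon> :: "nat \<Rightarrow> complex" where "\<epsilon> = (\<lambda>k. inverse (of_nat (Suc (k + k0))))"
    have \<epsilon>: "\<epsilon> \<longlonglongrightarrow> 0" unfolding \<epsilon>_def by (rule LIMSEQ_ignore_initial_segment[OF lim])
    have \<epsilon>0: "\<epsilon> k \<noteq> 0" for k unfolding \<epsilon>_def by (simp del: of_nat_Suc)
    have "\<exists>nm'. pole_data n (\<lambda>i j. ?S i j + [:\<epsilon> k * lie_form n c v i j:]) T nm'" for k
    proof -
      have "(\<lambda>i. x i + \<epsilon> k * v i, a) \<in> U" unfolding \<epsilon>_def by (rule k0) simp
      from pole[OF this] obtain nm' where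
        "pole_data n (bordered n (lie_form n c (\<lambda>i. x i + \<epsilon> k * v i)) (lie_form n c a) q) T nm'" by blast
      moreover have "bordered n (lie_form n c (\<lambda>i. x i + \<epsilon> k * v i)) (lie_form n c a) q =
          (\<lambda>i j. ?S i j + [:\<epsilon> k * lie_form n c v i j:])"
        by (intro ext) (simp add: bordered_def pencil_def lie_form_add_scale)
      ultimately show ?thesis by auto
    qed
    from choice[OF allI, OF this]
    obtain nm' where "\<forall>k. pole_data n (\<lambda>i j. ?S i j + [:\<epsilon> k * lie_form n c v i j:]) T (nm' k)" ..
    from perturbed_adjoint_congruence[OF pd this[THEN spec] \<epsilon> \<epsilon>0 e d(1)[unfolded m_def] C[unfolded m_def]]
    show ?thesis .
  qed
  show False
  proof (rule no_double_chain[OF lie pair dc nm(1) _ _ _ drift ze])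
    show "poly d e \<noteq> 0" using d(2) by (simp add: poly_eq_0_iff_dvd)
    fix i j assume ij: "i < n" "j < n"
    show "(\<Sum>k<n. ?S i k * C k j) = (if i = j then [:- e, 1:] ^ nm e * d else 0)"
      by (rule adjoint_quotient(1)[OF d(1) _ nm(2) ij]) (rule C)
    show "(\<Sum>k<n. C i k * ?S k j) = (if i = j then [:- e, 1:] ^ nm e * d else 0)"
      by (rule adjoint_quotient(2)[OF d(1) _ nm(2) ij]) (rule C)
  qed
qed

end
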